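(* Let $\Omega,\widetilde{\Omega}\subset\mathbb{R}^n$ be domains and let $n<q<p<\infty$. Let $\varphi:\Omega\to\widetilde{\Omega}$ be a homeomorphism that generates a bounded composition operator $$\varphi^{\ast}: L^1_p(\widetilde{\Omega})\to L^1_q(\Omega),\qquad \varphi^{\ast}(f)=f\circ\varphi,$$ and let $\Phi_{p,q}$ be the set function on open bounded subsets of $\Omega$ associated with $\varphi^\ast$ (defined in the context). Then there exists a constant $H_{p,q}^{1}(\Phi_{p,q})<\infty$ such that $$\limsup_{r\to 0}\frac{L_{\varphi}^{p}(x_0,r)\,r^{n-p}}{|\varphi(B(x_0,r))|}\left(\frac{|B(x_0,r)|}{\Phi_{p,q}(B(x_0,r))}\right)^{\frac{p-q}{q}}\leq H_{p,q}^{1}(\Phi_{p,q})\quad\text{for all } x_0\in\Omega,$$ where $L_{\varphi}(x_0,r)=\max_{|x_0-y|=r}|\varphi(x_0)-\varphi(y)|$.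
   Context: $|E|$ denotes the $n$-dimensional Lebesgue measure of $E\subset\mathbb{R}^n$ and $B(x,r)$ the ball with center $x$ and radius $r$; only $r$ small enough that the relevant balls lie in $\Omega$ are considered, and the dilatation quotient is understood as $+\infty$ if $\Phi_{p,q}$ of the ball is $0$. For $1\leq p\leq\infty$, $L^1_p(\Omega)$ is the homogeneous Sobolev space of locally integrable weakly differentiable functions $f:\Omega\to\mathbb{R}$ with finite seminorm $\|f\mid L^1_p(\Omega)\|=\|\nabla f\mid L_p(\Omega)\|$. Elements of Sobolev spaces with exponent $p$ are regarded as equivalence classes up to sets of $p$-capacity zero. A homeomorphism $\varphi:\Omega\to\widetilde{\Omega}$ generates a bounded composition operator $\varphi^{\ast}:L^1_p(\widetilde{\Omega})\to L^1_q(\Omega)$, $1\leq q\leq p\leq\infty$, by the rule $\varphi^\ast(f)=f\circ\varphi$, if for every $f\in L^1_p(\widetilde{\Omega})$ the composition $\varphi^{\ast}(f)\in L^1_q(\Omega)$ is defined quasi-everywhere in $\Omega$ (i.e. outside a set of capacity zero) and there is a constant $K_{p,q}(\varphi;\Omega)<\infty$ such that $\|\varphi^{\ast}(f)\mid L^1_q(\Omega)\|\leq K_{p,q}(\varphi;\Omega)\|f\mid L^1_p(\widetilde{\Omega})\|$ for all such $f$. Set function: for open bounded $\widetilde{A}\subset\widetilde{\Omega}$ put $$\widetilde{\Phi}_{p,q}(\widetilde{A})=\sup_{f\in L^1_p(\widetilde{A})\cap C_0(\widetilde{A})}\left(\frac{\|\varphi^{\ast}(f)\mid L^1_q(\Omega)\|}{\|f\mid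 L^1_p(\widetilde{A})\|}\right)^{\kappa},\qquad \frac1\kappa=\frac1q-\frac1p,$$ where $C_0(\widetilde A)$ denotes continuous functions with compact support in $\widetilde A$ (extended by zero to $\widetilde\Omega$) and the supremum is over $f$ with nonzero seminorm. Then for open bounded $A\subset\Omega$ put $\Phi_{p,q}(A)=\widetilde{\Phi}_{p,q}(\varphi(A))$. *)

theory Defs
  imports "HOL-Analysis.Analysis"
begin

text \<open>
  Functions on a domain of \<open>\<real>\<^sup>n\<close> (any Euclidean space \<open>'a\<close>, \<open>n = DIM('a)\<close>) are total functions on \<open>'a\<close>;
  only their values on the domain matter. Integrability exponents are finite reals.
\<close>

subsection \<open>Weak gradients and the homogeneous seminorm\<close>

primrec cont_diff :: "nat \<Rightarrow> ('a::euclidean_space \<Rightarrow> real) \<Rightarrow> bool" where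
  "cont_diff 0 f \<longleftrightarrow> continuous_on UNIV f"
| "cont_diff (Suc k) f \<longleftrightarrow> f differentiable_on UNIV \<and>
     (\<forall>b\<in>Basis. cont_diff k (\<lambda>x. frechet_derivative f (at x) b))"

definition test_function :: "'a::euclidean_space set \<Rightarrow> ('a \<Rightarrow> real) \<Rightarrow> bool" where
  "test_function \<Omega> \<eta> \<longleftrightarrow> (\<forall>k. cont_diff k \<eta>) \<and>
     compact (closure {x. \<eta> x \<noteq> 0}) \<and> closure {x. \<eta> x \<noteq> 0} \<subseteq> \<Omega>"

definition loc_integrable ::
  "'a::euclidean_space set \<Rightarrow> ('a \<Rightarrow> 'b::euclidean_space) \<Rightarrow> bool" where
  "loc_integrable \<Omega> f \<longleftrightarrow> (\<forall>K. compact K \<and> K \<subseteq> \<Omega> \<longrightarrow> set_integrable lebesgue K f)"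

definition has_weak_gradient ::
  "'a::euclidean_space set \<Rightarrow> ('a \<Rightarrow> real) \<Rightarrow> ('a \<Rightarrow> 'a) \<Rightarrow> bool" where
  "has_weak_gradient \<Omega> f g \<longleftrightarrow> loc_integrable \<Omega> f \<and> loc_integrable \<Omega> g \<and>
     (\<forall>\<eta>. test_function \<Omega> \<eta> \<longrightarrow> (\<forall>b\<in>Basis.
        (\<integral>x\<in>\<Omega>. f x * frechet_derivative \<eta> (at x) b \<partial>lebesgue)
          = - (\<integral>x\<in>\<Omega>. (g x \<bullet> b) * \<eta> x \<partial>lebesgue)))"

text \<open>Real powers of extended nonnegative reals, meant for exponents \<open>a > 0\<close> only.\<close>

definition epowr :: "ennreal \<Rightarrow> real \<Rightarrow> ennreal" where
  "epowr x a = (if x = \<infinity> then \<infinity> else ennreal (enn2real x powr a))"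

definition Lp_norm ::
  "real \<Rightarrow> 'a::euclidean_space set \<Rightarrow> ('a \<Rightarrow> 'b::euclidean_space) \<Rightarrow> ennreal" where
  "Lp_norm p \<Omega> g = epowr (\<integral>\<^sup>+x\<in>\<Omega>. ennreal (norm (g x) powr p) \<partial>lebesgue) (1 / p)"

text \<open>
  The weak gradient is unique almost everywhere in \<open>\<Omega>\<close>, so the choice below does not affect the value.
\<close>

definition L1_seminorm :: "real \<Rightarrow> 'a::euclidean_space set \<Rightarrow> ('a \<Rightarrow> real) \<Rightarrow> ennreal" where
  "L1_seminorm p \<Omega> f =
     (if \<exists>g. has_weak_gradient \<Omega> f g then Lp_norm p \<Omega> (SOME g. has_weak_gradient \<Omega> f g) else \<infinity>)"

subsection \<open>Capacity and the homogeneous Sobolev space\<close>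

text \<open>
  The Sobolev \<open>p\<close>-capacity on \<open>\<real>\<^sup>n\<close>. The zero order term is essential: for \<open>p \<ge> n\<close> the
  infimum of the Dirichlet energy alone is zero for every bounded set.
\<close>

definition capacity :: "real \<Rightarrow> 'a::euclidean_space set \<Rightarrow> ennreal" where
  "capacity p E = Inf {(\<integral>\<^sup>+x. ennreal (\<bar>u x\<bar> powr p) \<partial>lebesgue)
                        + (\<integral>\<^sup>+x. ennreal (norm (g x) powr p) \<partial>lebesgue) | u g.
       has_weak_gradient UNIV u g \<and> (\<exists>U. open U \<and> E \<subseteq> U \<and> (\<forall>x\<in>U. 1 \<le> u x))}"

definition quasicontinuous :: "real \<Rightarrow> 'a::euclidean_space set \<Rightarrow> ('a \<Rightarrow> real) \<Rightarrow> bool" where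
  "quasicontinuous p \<Omega> f \<longleftrightarrow>
     (\<forall>e>0. \<exists>U. open U \<and> capacity p U < e \<and> continuous_on (\<Omega> - U) f)"

text \<open>
  The elements of \<open>L\<^sup>1\<^sub>p(\<Omega>)\<close> are equivalence classes up to sets of \<open>p\<close>-capacity zero. An almost
  everywhere class of weakly differentiable functions contains exactly one such finer class of
  quasicontinuous functions; \<open>L1_space p \<Omega>\<close> is the set of all representatives of these.
\<close>

definition L1_space :: "real \<Rightarrow> 'a::euclidean_space set \<Rightarrow> ('a \<Rightarrow> real) set" where
  "L1_space p \<Omega> = {f. (\<exists>g. has_weak_gradient \<Omega> f g) \<and> L1_seminorm p \<Omega> f < \<infinity> \<and>
                       quasicontinuous p \<Omega> f}"

subsection \<open>Composition operators and the associated set function\<close>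

text \<open>
  An element of \<open>L\<^sup>1\<^sub>p(\<Omega>')\<close> is determined only outside a set \<open>E\<close> of \<open>p\<close>-capacity zero, so
  that \<open>f \<circ> \<phi>\<close> is determined outside the preimage of \<open>E\<close>; the first conjunct says that
  this composition is defined quasi-everywhere in \<open>\<Omega>\<close> with respect to the \<open>q\<close>-capacity.
\<close>

definition generates_bounded_composition ::
  "real \<Rightarrow> real \<Rightarrow> 'a::euclidean_space set \<Rightarrow> 'a set \<Rightarrow> ('a \<Rightarrow> 'a) \<Rightarrow> bool" where
  "generates_bounded_composition p q \<Omega> \<Omega>' \<phi> \<longleftrightarrow>
     (\<forall>E\<subseteq>\<Omega>'. capacity p E = 0 \<longrightarrow> capacity q {x\<in>\<Omega>. \<phi> x \<in> E} = 0) \<and>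
     (\<forall>f\<in>L1_space p \<Omega>'. f \<circ> \<phi> \<in> L1_space q \<Omega>) \<and>
     (\<exists>K<\<infinity>. \<forall>f\<in>L1_space p \<Omega>'. L1_seminorm q \<Omega> (f \<circ> \<phi>) \<le> K * L1_seminorm p \<Omega>' f)"

definition C0_space :: "'a::euclidean_space set \<Rightarrow> ('a \<Rightarrow> real) set" where
  "C0_space A = {f. continuous_on UNIV f \<and>
                    compact (closure {x. f x \<noteq> 0}) \<and> closure {x. f x \<noteq> 0} \<subseteq> A}"

definition target_set_function ::
  "real \<Rightarrow> real \<Rightarrow> 'a::euclidean_space set \<Rightarrow> ('a \<Rightarrow> 'a) \<Rightarrow> 'a set \<Rightarrow> ennreal" where
  "target_set_function p q \<Omega> \<phi> A' =
     (SUP f\<in>{f \<in> L1_space p A' \<inter> C0_space A'. L1_seminorm p A' f \<noteq> 0}.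
        epowr (L1_seminorm q \<Omega> (f \<circ> \<phi>) / L1_seminorm p A' f) (1 / (1 / q - 1 / p)))"

definition set_function ::
  "real \<Rightarrow> real \<Rightarrow> 'a::euclidean_space set \<Rightarrow> ('a \<Rightarrow> 'a) \<Rightarrow> 'a set \<Rightarrow> ennreal" where
  "set_function p q \<Omega> \<phi> A = target_set_function p q \<Omega> \<phi> (\<phi> ` A)"

subsection \<open>The dilatation quotient\<close>

text \<open>The supremum is a maximum as soon as the sphere lies in the domain of continuity of \<open>\<phi>\<close>.\<close>

definition max_stretch :: "('a::euclidean_space \<Rightarrow> 'a) \<Rightarrow> 'a \<Rightarrow> real \<Rightarrow> real" where
  "max_stretch \<phi> x\<^sub>0 r = (SUP y\<in>sphere x\<^sub>0 r. norm (\<phi> x\<^sub>0 - \<phi> y))"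

text \<open>
  As \<open>c / 0 = \<infinity>\<close> for \<open>c > 0\<close> in \<^typ>\<open>ennreal\<close>, the quotient is \<open>\<infinity>\<close> when the set function
  vanishes on the ball.
\<close>

definition dilatation_quotient ::
  "real \<Rightarrow> real \<Rightarrow> 'a::euclidean_space set \<Rightarrow> ('a \<Rightarrow> 'a) \<Rightarrow> 'a \<Rightarrow> real \<Rightarrow> ennreal" where
  "dilatation_quotient p q \<Omega> \<phi> x\<^sub>0 r =
     ennreal (max_stretch \<phi> x\<^sub>0 r powr p * r powr (real DIM('a) - p))
       / emeasure lebesgue (\<phi> ` ball x\<^sub>0 r)
     * epowr (emeasure lebesgue (ball x\<^sub>0 r) / set_function p q \<Omega> \<phi> (ball x\<^sub>0 r)) ((p - q) / q)"

end

theory Submission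
  imports Defs "HOL-Computational_Algebra.Polynomial"
begin

text \<open>
  Write \<open>n\<close> for the dimension, \<open>B\<close> for the ball of radius \<open>r\<close> about \<open>x\<^sub>0\<close>, \<open>V\<close> for the measure of
  \<open>\<phi> ` B\<close>, \<open>L\<close> for the maximal stretch on the sphere, and \<open>1/\<kappa> = 1/q - 1/p\<close>. As \<open>\<Phi>(B) powr (1/\<kappa>)\<close> is the
  supremum of the ratios of the seminorms of \<open>f \<circ> \<phi>\<close> and \<open>f\<close> over \<open>f\<close> with compact support in
  \<open>\<phi> ` B\<close>, and as the powers of \<open>r\<close> cancel (\<open>dilatation_quotient_bound\<close>), the theorem says that
  \<open>L \<le> C * \<Phi>(B) powr (1/\<kappa>) * V powr (1/p) * r powr (1 - n/q)\<close> with \<open>C\<close> depending on \<open>n\<close> and \<open>q\<close> only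
  (\<open>stretch_bound\<close>).

  Since \<open>q > n\<close>, Morrey's inequality bounds the oscillation on \<open>B\<close> of each coordinate
  \<open>u(x) = \<phi> x \<bullet> b\<close> by \<open>r powr (1 - n/q)\<close> times the \<open>L\<^sub>q\<close> norm of its gradient. So one needs that this
  norm is at most a constant times \<open>\<Phi>(B) powr (1/\<kappa>) * V powr (1/p)\<close> (\<open>coordinate_weak_gradient\<close>). This
  would be immediate from the definition of \<open>\<Phi>\<close> if the function \<open>z \<bullet> b\<close>, whose gradient has length \<open>1\<close>,
  were admissible; but its support is not compact in \<open>\<phi> ` B\<close>, and a cut-off \<open>\<theta>\<close> adds the
  uncontrolled term \<open>(z \<bullet> b) * \<nabla>\<theta>\<close>.

  The remedy is to fold the function up. Replace \<open>z \<bullet> b\<close> by a smooth periodic wave \<open>w(m * (z \<bullet> b)) / m\<close> that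
  has slope exactly \<open>1\<close> on more than half of each period. Its amplitude is of order \<open>1/m\<close>, so that the
  term with \<open>\<nabla>\<theta>\<close> is harmless for large \<open>m\<close>, while its gradient remains bounded by a universal constant.
  Of two such waves, half a period apart, at least one has slope \<open>1\<close> near any given point
  (\<open>oscillating_test_functions\<close>). There the composition of this wave with \<open>\<phi>\<close> is \<open>u\<close> up to an additive
  constant, so by the uniqueness of weak gradients the two have the same weak gradient. Hence the gradient
  of \<open>u\<close> is almost everywhere one of the two gradients that \<open>\<Phi>(B)\<close> controls.

  Morrey's inequality is proved directly from the definition of a weak gradient. The average of a continuous
  \<open>v\<close> against a smooth kernel of width \<open>s\<close> whose centre moves from \<open>y\<close> to \<open>x\<^sub>0\<close> as \<open>s\<close> grows from
  \<open>0\<close> to \<open>r\<close> is differentiable in \<open>s\<close>, and the derivative of the kernel is the divergence of an explicit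
  field of test functions. So the derivative of the average is an integral of the weak gradient over
  a ball of radius of order \<open>s\<close>, of size \<open>s powr (- n/q)\<close> at most, which is integrable down to \<open>s = 0\<close>
  because \<open>n < q\<close>.
\<close>

section \<open>Smooth functions\<close>

definition smooth :: "('a::euclidean_space \<Rightarrow> real) \<Rightarrow> bool" where
  "smooth f \<longleftrightarrow> (\<forall>k. cont_diff k f)"

definition partial :: "'a::euclidean_space \<Rightarrow> ('a \<Rightarrow> real) \<Rightarrow> 'a \<Rightarrow> real" where
  "partial b f x = frechet_derivative f (at x) b"

lemma cont_diff_Suc_partial:
  "cont_diff (Suc k) f \<longleftrightarrow> (\<forall>x. f differentiable at x) \<and> (\<forall>b\<in>Basis. cont_diff k (partial b f))"
  by (simp add: partial_def[abs_def] differentiable_on_def)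

lemma cont_diff_pred: "cont_diff (Suc k) f \<Longrightarrow> cont_diff k f"
proof (induction k arbitrary: f)
  case 0
  then show ?case
    by (auto simp: differentiable_on_def intro!: continuous_at_imp_continuous_on differentiable_imp_continuous_within)
next
  case (Suc k)
  then show ?case unfolding cont_diff_Suc_partial[of "Suc k"] cont_diff_Suc_partial[of k] by blast
qed

lemma partial_eq: "(f has_derivative f') (at x) \<Longrightarrow> partial b f x = f' b"
  unfolding partial_def by (metis frechet_derivative_at)

lemma cont_diff_continuous: "cont_diff k f \<Longrightarrow> continuous_on UNIV f"
  by (induction k) (auto intro: differentiable_imp_continuous_on)

lemma smooth_iff:
  "smooth f \<longleftrightarrow> (\<forall>x. f differentiable at x) \<and> (\<forall>b\<in>Basis. smooth (partial b f))" (is "?L = ?R")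
proof
  assume ?L
  then show ?R unfolding smooth_def by (metis cont_diff_Suc_partial)
next
  assume R: ?R
  have "cont_diff k f" for k
  proof (cases k)
    case 0
    then show ?thesis using R
      by (auto simp: smooth_def intro!: continuous_at_imp_continuous_on differentiable_imp_continuous_within)
  next
    case (Suc j)
    then show ?thesis using R unfolding smooth_def by (metis cont_diff_Suc_partial)
  qed
  then show ?L by (simp add: smooth_def)
qed

lemma smooth_partial: "smooth f \<Longrightarrow> b \<in> Basis \<Longrightarrow> smooth (partial b f)"
  by (subst (asm) smooth_iff) auto

lemma smooth_has_derivative: "smooth f \<Longrightarrow> (f has_derivative frechet_derivative f (at x)) (at x)"
  by (metis smooth_iff frechet_derivative_works)

lemma smooth_continuous: "smooth f \<Longrightarrow> continuous_on UNIV f"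
  unfolding smooth_def using cont_diff_continuous by blast

lemma cont_diff_SucI:
  assumes "\<And>x. (f has_derivative f' x) (at x)" "\<And>b. b \<in> Basis \<Longrightarrow> cont_diff k (\<lambda>x. f' x b)"
  shows "cont_diff (Suc k) f"
proof -
  have "partial b f = (\<lambda>x. f' x b)" for b
    using partial_eq[OF assms(1)] by auto
  then show ?thesis unfolding cont_diff_Suc_partial using assms
    by (auto simp: differentiable_def)
qed

lemma cont_diff_SucD:
  assumes "cont_diff (Suc k) f"
  shows "(f has_derivative frechet_derivative f (at x)) (at x)"
    "b \<in> Basis \<Longrightarrow> cont_diff k (\<lambda>x. frechet_derivative f (at x) b)"
  using assms by (auto simp: differentiable_on_def frechet_derivative_works[symmetric])

lemma cont_diff_const [simp]: "cont_diff k (\<lambda>x. c)"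
proof (induction k arbitrary: c)
  case (Suc k)
  show ?case by (rule cont_diff_SucI[where f' = "\<lambda>x y. 0"]) (use Suc in auto)
qed simp

lemma cont_diff_add: "cont_diff k f \<Longrightarrow> cont_diff k g \<Longrightarrow> cont_diff k (\<lambda>x. f x + g x)"
proof (induction k arbitrary: f g)
  case 0
  then show ?case by (auto intro: continuous_on_add)
next
  case (Suc k)
  show ?case
    by (rule cont_diff_SucI[OF has_derivative_add[OF cont_diff_SucD(1)[OF Suc.prems(1)] cont_diff_SucD(1)[OF Suc.prems(2)]]])
      (intro Suc.IH cont_diff_SucD(2)[OF Suc.prems(1)] cont_diff_SucD(2)[OF Suc.prems(2)])
qed

lemma cont_diff_mult: "cont_diff k f \<Longrightarrow> cont_diff k g \<Longrightarrow> cont_diff k (\<lambda>x. f x * g x)"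
proof (induction k arbitrary: f g)
  case 0
  then show ?case by (auto intro: continuous_on_mult)
next
  case (Suc k)
  show ?case
    by (rule cont_diff_SucI[OF has_derivative_mult[OF cont_diff_SucD(1)[OF Suc.prems(1)] cont_diff_SucD(1)[OF Suc.prems(2)]]])
      (intro Suc.IH cont_diff_add cont_diff_pred[OF Suc.prems(1)] cont_diff_pred[OF Suc.prems(2)]
         cont_diff_SucD(2)[OF Suc.prems(1)] cont_diff_SucD(2)[OF Suc.prems(2)])
qed

lemma cont_diff_inner: "cont_diff k (\<lambda>x. x \<bullet> a)"
proof (cases k)
  case 0
  then show ?thesis by (auto intro!: continuous_on_inner continuous_on_id continuous_on_const)
next
  case (Suc j)
  have "cont_diff (Suc j) (\<lambda>x. x \<bullet> a)"
    by (rule cont_diff_SucI[where f' = "\<lambda>x y. y \<bullet> a"]) (auto intro!: derivative_eq_intros)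
  then show ?thesis using Suc by simp
qed

text \<open>
  The outer function is differentiated as a function on the Euclidean space \<open>\<real>\<close>, whose only basis vector is
  \<open>1\<close>; by linearity its derivative is multiplication by its partial derivative in direction \<open>1\<close>.
\<close>

lemma cont_diff_compose:
  fixes h :: "real \<Rightarrow> real"
  shows "cont_diff k h \<Longrightarrow> cont_diff k g \<Longrightarrow> cont_diff k (\<lambda>x. h (g x))"
proof (induction k arbitrary: h g)
  case 0
  then show ?case using continuous_on_compose2[of UNIV h UNIV g] by auto
next
  case (Suc k)
  have lin: "frechet_derivative h (at t) y = frechet_derivative h (at t) 1 * y" for t y
  proof -
    have "linear (frechet_derivative h (at t))"
      using cont_diff_SucD(1)[OF Suc.prems(1)] has_derivative_linear by blast
    from linear_scale[OF this, of y 1] show ?thesis by simp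
  qed
  have "((\<lambda>x. h (g x)) has_derivative
      (\<lambda>y. frechet_derivative h (at (g x)) 1 * frechet_derivative g (at x) y)) (at x)" for x
  proof -
    have "((\<lambda>x. h (g x)) has_derivative
      (\<lambda>y. frechet_derivative h (at (g x)) (frechet_derivative g (at x) y))) (at x)"
      by (rule has_derivative_compose[OF cont_diff_SucD(1)[OF Suc.prems(2)] cont_diff_SucD(1)[OF Suc.prems(1)]])
    moreover have "(\<lambda>y. frechet_derivative h (at (g x)) (frechet_derivative g (at x) y)) =
        (\<lambda>y. frechet_derivative h (at (g x)) 1 * frechet_derivative g (at x) y)"
      by (rule ext) (rule lin)
    ultimately show ?thesis by simp
  qed
  then show ?case
    by (rule cont_diff_SucI)
      (intro cont_diff_mult Suc.IH[of "\<lambda>t. frechet_derivative h (at t) 1"] cont_diff_pred[OF Suc.prems(2)]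
         cont_diff_SucD(2)[OF Suc.prems(1)] cont_diff_SucD(2)[OF Suc.prems(2)], simp_all)
qed

lemma cont_diff_inverse:
  "cont_diff k f \<Longrightarrow> (\<And>x. f x \<noteq> 0) \<Longrightarrow> cont_diff k (\<lambda>x. inverse (f x))"
proof (induction k)
  case 0
  then show ?case by (auto intro: continuous_on_inverse)
next
  case (Suc k)
  have "((\<lambda>x. inverse (f x)) has_derivative
      (\<lambda>h. (- 1) * (inverse (f x) * frechet_derivative f (at x) h * inverse (f x)))) (at x)" for x
    using Deriv.has_derivative_inverse[OF Suc.prems(2) cont_diff_SucD(1)[OF Suc.prems(1)]] by simp
  moreover have "cont_diff k (\<lambda>x. inverse (f x))"
    using Suc.IH[OF cont_diff_pred[OF Suc.prems(1)] Suc.prems(2)] .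
  ultimately show ?case
    by (intro cont_diff_SucI) (assumption, intro cont_diff_mult cont_diff_const cont_diff_SucD(2)[OF Suc.prems(1)])
qed

lemma smooth_const: "smooth (\<lambda>x. c)"
  and smooth_inner: "smooth (\<lambda>x. x \<bullet> a)"
  and smooth_add: "smooth f \<Longrightarrow> smooth g \<Longrightarrow> smooth (\<lambda>x. f x + g x)"
  and smooth_mult: "smooth f \<Longrightarrow> smooth g \<Longrightarrow> smooth (\<lambda>x. f x * g x)"
  and smooth_inverse: "smooth f \<Longrightarrow> (\<And>x. f x \<noteq> 0) \<Longrightarrow> smooth (\<lambda>x. inverse (f x))"
  and smooth_compose: "smooth h \<Longrightarrow> smooth f \<Longrightarrow> smooth (\<lambda>x. h (f x))"
  by (simp_all add: smooth_def cont_diff_inner cont_diff_add cont_diff_mult cont_diff_inverse cont_diff_compose)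

lemma smooth_uminus: "smooth f \<Longrightarrow> smooth (\<lambda>x. - f x)"
  using smooth_mult[OF smooth_const[of "-1"], of f] by simp

lemma smooth_diff: "smooth f \<Longrightarrow> smooth g \<Longrightarrow> smooth (\<lambda>x. f x - g x)"
  using smooth_add[OF _ smooth_uminus, of f g] by simp

lemma smooth_divide_const: "smooth f \<Longrightarrow> smooth (\<lambda>x. f x / c)"
  using smooth_mult[OF _ smooth_const[of "1/c"], of f] by simp

lemma smooth_power2: "smooth f \<Longrightarrow> smooth (\<lambda>x. (f x)\<^sup>2)"
  using smooth_mult[of f f] by (simp add: power2_eq_square)

lemma smooth_ident: "smooth (\<lambda>t::real. t)"
  using smooth_inner[of "1::real"] by simp

lemma smooth_sum: "(\<And>i. i \<in> I \<Longrightarrow> smooth (f i)) \<Longrightarrow> smooth (\<lambda>x. \<Sum>i\<in>I. f i x)"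
  by (induction I rule: infinite_finite_induct) (auto intro: smooth_const smooth_add)

lemmas smooth_intros = smooth_const smooth_inner smooth_ident smooth_add smooth_diff smooth_uminus
  smooth_mult smooth_divide_const smooth_power2 smooth_sum

lemma smooth_has_real_derivative:
  fixes f :: "real \<Rightarrow> real"
  assumes "smooth f"
  shows "(f has_real_derivative partial 1 f t) (at t)"
proof -
  have "frechet_derivative f (at t) h = partial 1 f t * h" for h
    using linear_scale[OF has_derivative_linear[OF smooth_has_derivative[OF assms]], of t h 1]
    by (simp add: partial_def)
  then have "frechet_derivative f (at t) = (*) (partial 1 f t)" by auto
  then show ?thesis
    using smooth_has_derivative[OF assms, of t] by (simp add: has_field_derivative_def)
qed

section \<open>Smooth cut-off functions\<close>

text \<open>
  The functions \<open>P(1/t) * exp(-1/t)\<close>, extended by \<open>0\<close>. They form a family that is closed under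
  differentiation, which is what makes \<open>exp(-1/t)\<close> smooth at the origin.
\<close>

definition flat_poly :: "real poly \<Rightarrow> real \<Rightarrow> real" where
  "flat_poly P t = (if t \<le> 0 then 0 else poly P (1 / t) * exp (- (1 / t)))"

lemma poly_times_exp_minus_tendsto_0:
  fixes P :: "real poly"
  shows "((\<lambda>x. poly P x * exp (- x)) \<longlongrightarrow> 0) at_top"
proof (induction P)
  case 0
  then show ?case by simp
next
  case (pCons a P)
  have 1: "((\<lambda>x::real. x ^ k * exp (- x)) \<longlongrightarrow> 0) at_top" for k :: nat
    using tendsto_power_div_exp_0[of k] by (simp add: exp_minus field_simps)
  have "((\<lambda>x. poly Q x * x ^ j * exp (- x)) \<longlongrightarrow> 0) at_top" for Q :: "real poly" and j :: nat
  proof (induction Q arbitrary: j)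
    case (pCons b Q)
    have "((\<lambda>x. b * (x ^ j * exp (- x)) + poly Q x * x ^ Suc j * exp (- x)) \<longlongrightarrow> b * 0 + 0) at_top"
      by (intro tendsto_intros 1 pCons.IH)
    then show ?case by (simp add: algebra_simps)
  qed simp
  from this[of "pCons a P" 0] show ?case by simp
qed

text \<open>
  Away from \<open>0\<close> this is the product rule; at \<open>0\<close> the difference quotient is a polynomial in
  \<open>1/t\<close> times \<open>exp(-1/t)\<close> and tends to \<open>0\<close>.
\<close>

lemma flat_poly_has_derivative:
  "(flat_poly P has_real_derivative flat_poly ([:0, 0, 1:] * (P - pderiv P)) t) (at t)"
proof -
  consider "t > 0" | "t < 0" | "t = 0" by linarith
  then show ?thesis
  proof cases
    case 1
    have "((\<lambda>t. poly P (1 / t) * exp (- (1 / t))) has_real_derivative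
        flat_poly ([:0, 0, 1:] * (P - pderiv P)) t) (at t)"
      using 1 by (auto intro!: derivative_eq_intros simp: flat_poly_def field_simps power2_eq_square)
    then show ?thesis
      by (rule has_field_derivative_transform_within_open[where S = "{0<..}"])
        (use 1 in \<open>auto simp: flat_poly_def\<close>)
  next
    case 2
    have "((\<lambda>t. 0) has_real_derivative flat_poly ([:0, 0, 1:] * (P - pderiv P)) t) (at t)"
      using 2 by (auto simp: flat_poly_def)
    then show ?thesis
      by (rule has_field_derivative_transform_within_open[where S = "{..<0}"])
        (use 2 in \<open>auto simp: flat_poly_def\<close>)
  next
    case 3
    have "((\<lambda>h. poly ([:0,1:] * P) (1 / h) * exp (- (1 / h))) \<longlongrightarrow> 0) (at_right 0)"
      using filterlim_compose[OF poly_times_exp_minus_tendsto_0[of "[:0,1:] * P"] filterlim_inverse_at_top_right]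
      by (simp add: inverse_eq_divide)
    then have "((\<lambda>h. flat_poly P h / h) \<longlongrightarrow> 0) (at_right 0)"
      by (rule Lim_transform_eventually)
         (use eventually_at_right_less[of "0::real"] in \<open>auto elim!: eventually_mono simp: flat_poly_def\<close>)
    moreover have "((\<lambda>h. flat_poly P h / h) \<longlongrightarrow> 0) (at_left 0)"
      by (rule Lim_transform_eventually[OF tendsto_const])
         (auto simp: flat_poly_def eventually_at_filter)
    ultimately have "((\<lambda>h. flat_poly P h / h) \<longlongrightarrow> 0) (at 0)"
      by (simp add: filterlim_split_at)
    then show ?thesis using 3 by (simp add: DERIV_def flat_poly_def)
  qed
qed

lemma smooth_flat_poly: "smooth (flat_poly P)"
proof -
  have "cont_diff k (flat_poly P)" for k P
  proof (induction k arbitrary: P)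
    case 0
    then show ?case
      by (auto intro!: continuous_at_imp_continuous_on DERIV_isCont[OF flat_poly_has_derivative])
  next
    case (Suc k)
    show ?case
      by (rule cont_diff_SucI[OF flat_poly_has_derivative[unfolded has_field_derivative_def]])
        (simp add: Suc.IH cont_diff_mult)
  qed
  then show ?thesis by (simp add: smooth_def)
qed

definition flat :: "real \<Rightarrow> real" where
  "flat t = (if t \<le> 0 then 0 else exp (- (1 / t)))"

lemma smooth_flat: "smooth flat"
proof -
  have "flat = flat_poly 1" by (auto simp: flat_def flat_poly_def)
  then show ?thesis using smooth_flat_poly by metis
qed

lemma flat_nonneg: "flat t \<ge> 0" and flat_pos: "t > 0 \<Longrightarrow> flat t > 0" and flat_eq_0: "t \<le> 0 \<Longrightarrow> flat t = 0"
  and flat_le_1: "flat t \<le> 1"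
  by (auto simp: flat_def)

text \<open>
  A smooth function that rises from \<open>0\<close> to \<open>1\<close> on the unit interval and is constant outside.
  The denominator never vanishes.
\<close>

definition smooth_step :: "real \<Rightarrow> real" where
  "smooth_step t = flat t * inverse (flat t + flat (1 - t))"

lemma flat_partition_pos: "flat t + flat (1 - t) > 0"
  using flat_nonneg[of t] flat_nonneg[of "1 - t"] flat_pos[of t] flat_pos[of "1 - t"] by linarith

lemma smooth_smooth_step: "smooth smooth_step"
  unfolding smooth_step_def[abs_def]
  by (intro smooth_intros smooth_inverse smooth_flat smooth_compose[OF smooth_flat])
    (use flat_partition_pos in \<open>metis less_irrefl\<close>)

lemma smooth_step_eq_0: "t \<le> 0 \<Longrightarrow> smooth_step t = 0"
  and smooth_step_eq_1: "t \<ge> 1 \<Longrightarrow> smooth_step t = 1"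
  using flat_pos[of t] by (auto simp: smooth_step_def flat_eq_0)

lemma smooth_step_bounds: "0 \<le> smooth_step t" "smooth_step t \<le> 1"
  using flat_partition_pos[of t] flat_nonneg[of t] flat_nonneg[of "1 - t"]
  by (auto simp: smooth_step_def field_simps)

lemma smooth_norm_power2: "smooth (\<lambda>z::'a::euclidean_space. (norm (z - a))\<^sup>2)"
proof -
  have "(\<lambda>z. (norm (z - a))\<^sup>2) = (\<lambda>z. \<Sum>b\<in>Basis. (z \<bullet> b - a \<bullet> b)\<^sup>2)"
    unfolding power2_norm_eq_inner
    by (subst euclidean_inner) (simp add: inner_diff_left power2_eq_square)
  then show ?thesis by (simp add: smooth_intros)
qed

text \<open>
  Vanishing outside some compact subset of \<open>\<Omega>\<close> is easier to handle than a condition on the closure of the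
  support.
\<close>

lemma test_function_iff:
  "test_function \<Omega> \<eta> \<longleftrightarrow> smooth \<eta> \<and> (\<exists>K. compact K \<and> K \<subseteq> \<Omega> \<and> (\<forall>x. x \<notin> K \<longrightarrow> \<eta> x = 0))" (is "?L = ?R")
proof
  assume ?L
  then show ?R unfolding test_function_def smooth_def
    using closure_subset[of "{x. \<eta> x \<noteq> 0}"] by blast
next
  assume ?R
  then obtain K where K: "compact K" "K \<subseteq> \<Omega>" "{x. \<eta> x \<noteq> 0} \<subseteq> K" and s: "smooth \<eta>" by auto
  have "closure {x. \<eta> x \<noteq> 0} \<subseteq> K"
    using K closure_minimal compact_imp_closed by blast
  moreover have "compact (closure {x. \<eta> x \<noteq> 0})"
    unfolding compact_closure using K bounded_subset compact_imp_bounded by blast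
  ultimately show ?L using K(2) s unfolding test_function_def smooth_def by blast
qed

text \<open>
  Finitely many ball-shaped bumps inside \<open>U\<close> cover \<open>K\<close>, so that their sum exceeds some \<open>\<delta> > 0\<close> on a
  neighbourhood of \<open>K\<close>. Composing the sum, divided by \<open>\<delta>\<close>, with the smooth step flattens it to \<open>1\<close> there.
\<close>

lemma smooth_cutoff_exists:
  fixes K U :: "'a::euclidean_space set"
  assumes "compact K" "open U" "K \<subseteq> U"
  obtains \<theta> W where "test_function U \<theta>" "\<And>x. 0 \<le> \<theta> x" "\<And>x. \<theta> x \<le> 1" "open W" "K \<subseteq> W" "\<And>x. x \<in> W \<Longrightarrow> \<theta> x = 1"
proof -
  have "\<exists>r. 0 < r \<and> cball x r \<subseteq> U" if "x \<in> K" for x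
    using assms that open_contains_cball by (metis subsetD)
  then obtain r where r: "\<And>x. x \<in> K \<Longrightarrow> 0 < r x \<and> cball x (r x) \<subseteq> U" by metis
  have "K \<subseteq> (\<Union>x\<in>K. ball x (r x))" using r by force
  then obtain F where F: "F \<subseteq> K" "finite F" "K \<subseteq> (\<Union>x\<in>F. ball x (r x))"
    using compactE_image[OF \<open>compact K\<close>, of K "\<lambda>x. ball x (r x)"] by auto
  define \<sigma> where "\<sigma> z = (\<Sum>x\<in>F. flat ((r x)\<^sup>2 - (norm (z - x))\<^sup>2))" for z
  have sm: "smooth \<sigma>" unfolding \<sigma>_def
    by (intro smooth_intros smooth_compose[OF smooth_flat] smooth_norm_power2)
  have pos: "\<sigma> z > 0" if "z \<in> K" for z
  proof -
    obtain x where x: "x \<in> F" "z \<in> ball x (r x)" using F \<open>z \<in> K\<close> by auto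
    then have "(norm (z - x))\<^sup>2 < (r x)\<^sup>2"
      by (intro power_strict_mono) (auto simp: dist_norm norm_minus_commute)
    then show ?thesis unfolding \<sigma>_def
      by (intro sum_pos2[OF F(2) x(1)]) (auto intro: flat_pos flat_nonneg)
  qed
  obtain \<delta> where d: "\<delta> > 0" "\<And>z. z \<in> K \<Longrightarrow> \<delta> < \<sigma> z"
  proof (cases "K = {}")
    case True then show ?thesis using that[of 1] by auto
  next
    case False
    obtain z where z: "z \<in> K" "\<And>y. y \<in> K \<Longrightarrow> \<sigma> z \<le> \<sigma> y"
      using continuous_attains_inf[OF \<open>compact K\<close> False] smooth_continuous[OF sm] continuous_on_subset by blast
    show ?thesis using that[of "\<sigma> z / 2"] pos[OF z(1)] z(2) by force
  qed
  show ?thesis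
  proof
    have "\<sigma> z = 0" if "z \<notin> (\<Union>x\<in>F. cball x (r x))" for z
    proof -
      have "(r x)\<^sup>2 \<le> (norm (z - x))\<^sup>2" if "x \<in> F" for x
        using that \<open>z \<notin> _\<close> r F(1) by (intro power_mono) (fastforce simp: dist_norm norm_minus_commute)+
      then show ?thesis unfolding \<sigma>_def by (auto intro!: sum.neutral flat_eq_0)
    qed
    moreover have "compact (\<Union>x\<in>F. cball x (r x))"
      using F(2) by (intro compact_UN) auto
    moreover have "(\<Union>x\<in>F. cball x (r x)) \<subseteq> U"
      using F(1) r by (intro UN_least) auto
    ultimately show "test_function U (\<lambda>z. smooth_step (\<sigma> z / \<delta>))"
      unfolding test_function_iff
      by (intro conjI smooth_compose[OF smooth_smooth_step] smooth_intros sm) (auto simp: smooth_step_eq_0)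
    have "open (\<sigma> -` {\<delta><..})"
      using smooth_continuous[OF sm] by (simp add: open_vimage)
    moreover have "\<sigma> -` {\<delta><..} = {z. \<delta> < \<sigma> z}" by auto
    ultimately show "open {z. \<delta> < \<sigma> z}" by simp
  qed (use d smooth_step_bounds in \<open>auto intro!: smooth_step_eq_1\<close>)
qed

section \<open>Integration by parts and the fundamental lemma\<close>

definition gradient :: "('a::euclidean_space \<Rightarrow> real) \<Rightarrow> 'a \<Rightarrow> 'a" where
  "gradient f x = (\<Sum>b\<in>Basis. partial b f x *\<^sub>R b)"

lemma gradient_inner: "b \<in> Basis \<Longrightarrow> gradient f x \<bullet> b = partial b f x"
  by (simp add: gradient_def inner_sum_left inner_Basis if_distrib sum.delta cong: if_cong)

lemma norm_gradient_le:
  fixes f :: "'a::euclidean_space \<Rightarrow> real"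
  assumes "\<And>b. b \<in> Basis \<Longrightarrow> \<bar>partial b f x\<bar> \<le> C"
  shows "norm (gradient f x) \<le> real DIM('a) * C"
proof -
  have "norm (gradient f x) \<le> (\<Sum>b\<in>Basis. \<bar>gradient f x \<bullet> b\<bar>)" by (rule norm_le_l1)
  also have "\<dots> \<le> (\<Sum>b\<in>(Basis::'a set). C)"
    by (intro sum_mono) (simp add: gradient_inner assms)
  finally show ?thesis by simp
qed

lemma partial_mult:
  "smooth f \<Longrightarrow> smooth g \<Longrightarrow> partial b (\<lambda>x. f x * g x) x = f x * partial b g x + partial b f x * g x"
  by (subst partial_eq[OF has_derivative_mult[OF smooth_has_derivative smooth_has_derivative]])
     (simp_all add: partial_def)

lemma partial_eq_0:
  assumes "open U" "x \<in> U" "\<And>y. y \<in> U \<Longrightarrow> f y = 0"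
  shows "partial b f x = 0"
proof -
  have "(f has_derivative (\<lambda>h. 0)) (at x)"
    by (rule has_derivative_transform_within_open[OF has_derivative_const[of 0] assms(1,2)])
       (use assms(3) in auto)
  then show ?thesis by (simp add: partial_eq)
qed

lemma partial_eq_0_outside:
  "closed K \<Longrightarrow> (\<And>x. x \<notin> K \<Longrightarrow> f x = 0) \<Longrightarrow> x \<notin> K \<Longrightarrow> partial b f x = 0"
  by (rule partial_eq_0[of "- K"]) auto

lemma gradient_eq_0_outside:
  "closed K \<Longrightarrow> (\<And>x. x \<notin> K \<Longrightarrow> f x = 0) \<Longrightarrow> x \<notin> K \<Longrightarrow> gradient f x = 0"
  by (simp add: gradient_def partial_eq_0_outside)

lemma test_function_partial_eq_0: "test_function U \<eta> \<Longrightarrow> x \<notin> U \<Longrightarrow> partial b \<eta> x = 0"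
  unfolding test_function_iff by (metis compact_imp_closed partial_eq_0_outside subsetD)

lemma test_function_eq_0: "test_function U \<eta> \<Longrightarrow> x \<notin> U \<Longrightarrow> \<eta> x = 0"
  unfolding test_function_iff by blast

lemma test_function_mono: "test_function U \<eta> \<Longrightarrow> U \<subseteq> V \<Longrightarrow> test_function V \<eta>"
  unfolding test_function_iff by blast

lemma test_function_smooth: "test_function U \<eta> \<Longrightarrow> smooth \<eta>"
  unfolding test_function_iff by blast

lemma test_function_mult: "smooth f \<Longrightarrow> test_function U \<eta> \<Longrightarrow> test_function U (\<lambda>x. f x * \<eta> x)"
  unfolding test_function_iff by (auto intro: smooth_mult)

lemma continuous_compact_support_integrable:
  fixes f :: "'a::euclidean_space \<Rightarrow> 'b::euclidean_space"
  assumes "continuous_on UNIV f" "compact K" "\<And>x. x \<notin> K \<Longrightarrow> f x = 0"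
  shows "integrable lborel f" "integrable lebesgue f"
proof -
  have "(\<lambda>x. indicator K x *\<^sub>R f x) = f" using assms(3) by (auto simp: indicator_def)
  then show "integrable lborel f"
    using borel_integrable_compact[OF assms(2) continuous_on_subset[OF assms(1)]] by simp
  then show "integrable lebesgue f"
    using assms(1) by (simp add: integrable_completion borel_measurable_continuous_onI)
qed

lemma continuous_compact_support_bounded:
  fixes f :: "'a::euclidean_space \<Rightarrow> 'b::real_normed_vector"
  assumes "continuous_on UNIV f" "compact K" "\<And>x. x \<notin> K \<Longrightarrow> f x = 0"
  obtains C where "C > 0" "\<And>x. norm (f x) \<le> C"
proof -
  have "compact (f ` K)" using assms continuous_on_subset compact_continuous_image by blast
  then obtain C where "\<And>x. x \<in> K \<Longrightarrow> norm (f x) \<le> C"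
    unfolding image_iff using compact_imp_bounded[of "f ` K"] bounded_iff by (metis imageI)
  then have "norm (f x) \<le> max C 1" for x using assms(3) by (cases "x \<in> K") fastforce+
  then show ?thesis by (intro that[of "max C 1"]) auto
qed

text \<open>
  By translation invariance the difference quotients of \<open>F\<close> have integral \<open>0\<close>. They converge to the
  partial derivative, dominated by its maximum on one fixed ball.
\<close>

lemma integral_partial_eq_0:
  fixes F :: "'a::euclidean_space \<Rightarrow> real"
  assumes F: "smooth F" and K: "compact K" "\<And>x. x \<notin> K \<Longrightarrow> F x = 0" and b: "b \<in> Basis"
  shows "integral\<^sup>L lebesgue (partial b F) = 0"
proof -
  have cont: "continuous_on UNIV F" "continuous_on UNIV (partial b F)"
    using F b smooth_partial smooth_continuous by blast+
  have vanish: "partial b F x = 0" if "x \<notin> K" for x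
    using partial_eq_0_outside[OF compact_imp_closed[OF K(1)]] K(2) that by blast
  obtain C where C: "C > 0" "\<And>x. norm (partial b F x) \<le> C"
    using continuous_compact_support_bounded[OF cont(2) K(1) vanish] by blast
  obtain R where R: "\<And>x. x \<in> K \<Longrightarrow> norm x \<le> R"
    using compact_imp_bounded[OF K(1)] by (auto simp: bounded_iff)
  define h where "h n = inverse (real (Suc n))" for n
  have h: "0 < h n" "h n \<le> 1" for n by (auto simp: h_def field_simps)
  have hlim: "h \<longlonglongrightarrow> 0" unfolding h_def by (rule LIMSEQ_inverse_real_of_nat)
  define D where "D n x = (F (h n *\<^sub>R b + x) - F x) / h n" for n x
  have dF: "((\<lambda>t. F (x + t *\<^sub>R b)) has_real_derivative partial b F (x + t *\<^sub>R b)) (at t)" for x t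
  proof -
    have "((\<lambda>t. F (x + t *\<^sub>R b)) has_derivative
        (\<lambda>s. frechet_derivative F (at (x + t *\<^sub>R b)) (s *\<^sub>R b))) (at t)"
      by (rule has_derivative_compose[OF _ smooth_has_derivative[OF F]])
         (auto intro!: derivative_eq_intros)
    moreover have "frechet_derivative F (at (x + t *\<^sub>R b)) (s *\<^sub>R b) = s * partial b F (x + t *\<^sub>R b)" for s
      using linear_scale[OF has_derivative_linear[OF smooth_has_derivative[OF F]], of "x + t *\<^sub>R b" s b]
      by (simp add: partial_def)
    ultimately show ?thesis
      unfolding has_field_derivative_def by (simp add: mult_commute_abs)
  qed
  have limD: "(\<lambda>n. D n x) \<longlonglongrightarrow> partial b F x" for x
  proof -
    have "((\<lambda>t. (F (x + t *\<^sub>R b) - F x) / t) \<longlongrightarrow> partial b F x) (at 0)"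
      using dF[of x 0] by (simp add: DERIV_def)
    moreover have "filterlim h (at 0) sequentially"
    proof (rule filterlim_atI[OF hlim])
      have "h n \<noteq> 0" for n using h(1)[of n] by simp
      then show "\<forall>\<^sub>F n in sequentially. h n \<noteq> 0" by simp
    qed
    ultimately show ?thesis
      unfolding D_def by (simp add: add.commute filterlim_compose[of "\<lambda>t. (F (x + t *\<^sub>R b) - F x) / t"])
  qed
  have bndD: "norm (D n x) \<le> indicat_real (cball 0 (R + 1)) x * C" for n x
  proof (cases "norm x \<le> R + 1")
    case True
    have "\<exists>t. 0 < t \<and> t < h n \<and> F (x + h n *\<^sub>R b) - F (x + 0 *\<^sub>R b) = (h n - 0) * partial b F (x + t *\<^sub>R b)"
      by (rule MVT2[OF h(1)]) (use dF in auto)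
    then obtain t where "F (x + h n *\<^sub>R b) - F x = h n * partial b F (x + t *\<^sub>R b)" by auto
    then have "D n x = partial b F (x + t *\<^sub>R b)" using h(1)[of n] by (simp add: D_def add.commute)
    then show ?thesis using C(2) True by (simp add: indicator_def)
  next
    case False
    have "norm x \<le> norm (h n *\<^sub>R b + x) + norm (h n *\<^sub>R b)"
      using norm_triangle_ineq4[of "h n *\<^sub>R b + x" "h n *\<^sub>R b"] by simp
    then have "x \<notin> K" "h n *\<^sub>R b + x \<notin> K" using False R[of x] R[of "h n *\<^sub>R b + x"] h[of n] b by auto
    then show ?thesis using K(2) False by (simp add: D_def)
  qed
  have Fint: "integrable lborel F" using continuous_compact_support_integrable[OF cont(1) K] by simp
  have shift: "integrable lborel (\<lambda>x. F (c + x))" "(\<integral>x. F (c + x) \<partial>lborel) = integral\<^sup>L lborel F" for c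
  proof -
    have m: "F \<in> borel_measurable borel" "(+) c \<in> lborel \<rightarrow>\<^sub>M borel"
      using cont(1) by (auto intro: borel_measurable_continuous_onI)
    show "integrable lborel (\<lambda>x. F (c + x))"
      using integrable_distr[OF m(2), of F] Fint lborel_distr_plus[of c] by simp
    show "(\<integral>x. F (c + x) \<partial>lborel) = integral\<^sup>L lborel F"
      using integral_distr[OF m(2) m(1)] lborel_distr_plus[of c] by simp
  qed
  have "integral\<^sup>L lborel (D n) = 0" for n
    unfolding D_def using shift[of "h n *\<^sub>R b"] Fint by simp
  moreover have "(\<lambda>n. integral\<^sup>L lborel (D n)) \<longlonglongrightarrow> integral\<^sup>L lborel (partial b F)"
  proof (rule integral_dominated_convergence)
    show "integrable lborel (\<lambda>x::'a. indicat_real (cball 0 (R + 1)) x * C)"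
      using borel_integrable_compact[of "cball (0::'a) (R + 1)" "\<lambda>x. C"] by simp
    show "partial b F \<in> borel_measurable lborel"
      using cont(2) by (simp add: borel_measurable_continuous_onI)
    show "D n \<in> borel_measurable lborel" for n
      unfolding D_def using borel_measurable_integrable[OF shift(1)] borel_measurable_integrable[OF Fint]
      by (intro borel_measurable_divide borel_measurable_diff borel_measurable_const)
  qed (use limD bndD in auto)
  ultimately have "integral\<^sup>L lborel (partial b F) = 0"
    by (simp add: tendsto_const_iff)
  then show ?thesis
    using cont(2) by (simp add: integral_completion borel_measurable_continuous_onI)
qed

lemma integral_partial_test_eq_0:
  assumes "test_function U \<eta>" "b \<in> Basis"
  shows "(\<integral>x\<in>U. partial b \<eta> x \<partial>lebesgue) = 0"
proof -
  have "(\<integral>x\<in>U. partial b \<eta> x \<partial>lebesgue) = integral\<^sup>L lebesgue (partial b \<eta>)"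
    unfolding set_lebesgue_integral_def
    by (intro Bochner_Integration.integral_cong) (use assms in \<open>auto simp: indicator_def test_function_partial_eq_0\<close>)
  also have "\<dots> = 0"
    using assms integral_partial_eq_0 unfolding test_function_iff by blast
  finally show ?thesis .
qed

lemma has_weak_gradient_partial:
  "has_weak_gradient \<Omega> f g \<longleftrightarrow> loc_integrable \<Omega> f \<and> loc_integrable \<Omega> g \<and>
     (\<forall>\<eta>. test_function \<Omega> \<eta> \<longrightarrow> (\<forall>b\<in>Basis.
        (\<integral>x\<in>\<Omega>. f x * partial b \<eta> x \<partial>lebesgue) = - (\<integral>x\<in>\<Omega>. (g x \<bullet> b) * \<eta> x \<partial>lebesgue)))"
  by (simp add: has_weak_gradient_def partial_def)

lemma continuous_loc_integrable:
  fixes f :: "'a::euclidean_space \<Rightarrow> 'b::euclidean_space"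
  assumes "continuous_on U f"
  shows "loc_integrable U f"
  unfolding loc_integrable_def set_integrable_def
proof safe
  fix K assume K: "compact K" "K \<subseteq> U"
  have "integrable lborel (\<lambda>x. indicator K x *\<^sub>R f x)"
    by (rule borel_integrable_compact[OF K(1) continuous_on_subset[OF assms K(2)]])
  then show "integrable lebesgue (\<lambda>x. indicator K x *\<^sub>R f x)"
    by (simp add: integrable_completion borel_measurable_integrable)
qed

lemma continuous_gradient: "smooth f \<Longrightarrow> continuous_on UNIV (gradient f)"
  unfolding gradient_def[abs_def]
  by (intro continuous_on_sum continuous_on_scaleR continuous_on_const smooth_continuous smooth_partial)

text \<open>
  Integration by parts: the partial derivative of the product of \<open>f\<close> and a test function has integral \<open>0\<close>.
\<close>

lemma smooth_has_weak_gradient: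
  assumes f: "smooth f"
  shows "has_weak_gradient U f (gradient f)"
  unfolding has_weak_gradient_partial
proof (intro conjI allI impI ballI)
  show "loc_integrable U f" "loc_integrable U (gradient f)"
    by (rule continuous_loc_integrable, rule continuous_on_subset[OF _ subset_UNIV],
        simp add: f smooth_continuous continuous_gradient)+
  fix \<eta> and b :: 'a assume \<eta>: "test_function U \<eta>" and b: "b \<in> Basis"
  obtain K where K: "compact K" "\<And>x. x \<notin> K \<Longrightarrow> \<eta> x = 0" and s: "smooth \<eta>"
    using \<eta> unfolding test_function_iff by blast
  have p0: "partial b \<eta> x = 0" if "x \<notin> K" for x
    using partial_eq_0_outside[OF compact_imp_closed[OF K(1)]] K(2) that by blast
  have i: "integrable lebesgue (\<lambda>x. f x * partial b \<eta> x)" "integrable lebesgue (\<lambda>x. partial b f x * \<eta> x)"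
    by (rule continuous_compact_support_integrable(2)[OF smooth_continuous K(1)];
      use f s b K(2) p0 in \<open>auto intro!: smooth_intros smooth_partial\<close>)+
  have "0 = integral\<^sup>L lebesgue (partial b (\<lambda>x. f x * \<eta> x))"
    using integral_partial_eq_0[of "\<lambda>x. f x * \<eta> x" K b] f s K b by (simp add: smooth_mult)
  also have "partial b (\<lambda>x. f x * \<eta> x) = (\<lambda>x. f x * partial b \<eta> x + partial b f x * \<eta> x)"
    using partial_mult[OF f s] by auto
  also have "integral\<^sup>L lebesgue \<dots> = (\<integral>x. f x * partial b \<eta> x \<partial>lebesgue) + (\<integral>x. partial b f x * \<eta> x \<partial>lebesgue)"
    using i by (rule Bochner_Integration.integral_add)
  also have "(\<integral>x. f x * partial b \<eta> x \<partial>lebesgue) = (\<integral>x\<in>U. f x * partial b \<eta> x \<partial>lebesgue)"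
    unfolding set_lebesgue_integral_def
    by (intro Bochner_Integration.integral_cong) (use \<eta> in \<open>auto simp: indicator_def test_function_partial_eq_0\<close>)
  also have "(\<integral>x. partial b f x * \<eta> x \<partial>lebesgue) = (\<integral>x\<in>U. (gradient f x \<bullet> b) * \<eta> x \<partial>lebesgue)"
    unfolding set_lebesgue_integral_def
    by (intro Bochner_Integration.integral_cong)
       (use \<eta> b in \<open>auto simp: indicator_def test_function_eq_0 gradient_inner\<close>)
  finally show "(\<integral>x\<in>U. f x * partial b \<eta> x \<partial>lebesgue) = - (\<integral>x\<in>U. (gradient f x \<bullet> b) * \<eta> x \<partial>lebesgue)"
    by simp
qed

text \<open>
  The indicator of \<open>K\<close> is the limit of cut-off functions that are \<open>1\<close> on \<open>K\<close> and supported in shrinking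
  neighbourhoods of \<open>K\<close>. The supports lie in one compact set \<open>K0\<close>, on which \<open>h\<close> is integrable.
\<close>

lemma compact_integral_eq_0_of_tests:
  fixes h :: "'a::euclidean_space \<Rightarrow> real"
  assumes U: "open U" and h: "loc_integrable U h"
    and zero: "\<And>\<eta>. test_function U \<eta> \<Longrightarrow> (\<integral>x\<in>U. h x * \<eta> x \<partial>lebesgue) = 0"
    and K: "compact K" "K \<subseteq> U"
  shows "(\<integral>x\<in>K. h x \<partial>lebesgue) = 0"
proof -
  \<comment> \<open>Its support provides the compact set that carries all later cut-offs.\<close>
  obtain \<theta> W where \<theta>: "test_function U \<theta>" "open W" "K \<subseteq> W" "\<And>x. x \<in> W \<Longrightarrow> \<theta> x = (1::real)"
    using smooth_cutoff_exists[OF K(1) U K(2)] by metis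
  obtain K0 where K0: "compact K0" "K0 \<subseteq> U" "\<And>x. x \<notin> K0 \<Longrightarrow> \<theta> x = 0"
    using \<theta>(1) unfolding test_function_iff by blast
  have WK0: "W \<subseteq> K0" using \<theta>(4) K0(3) by force
  define V where "V n = W \<inter> (\<Union>x\<in>K. ball x (inverse (real (Suc n))))" for n
  have V: "open (V n)" "K \<subseteq> V n" for n
    using \<theta>(2,3) by (auto simp: V_def)
  have "\<exists>\<eta>. test_function (V n) \<eta> \<and> (\<forall>x. 0 \<le> \<eta> x \<and> \<eta> x \<le> 1) \<and> (\<forall>x\<in>K. \<eta> x = 1)" for n
    using smooth_cutoff_exists[OF K(1) V] by (metis subsetD)
  then obtain \<eta> where \<eta>: "\<And>n. test_function (V n) (\<eta> n)" "\<And>n x. 0 \<le> \<eta> n x" "\<And>n x. \<eta> n x \<le> 1"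
    "\<And>n x. x \<in> K \<Longrightarrow> \<eta> n x = 1" by metis
  have V0: "\<eta> n x = 0" if "x \<notin> V n" for n x using \<eta>(1) that test_function_eq_0 by blast
  have lim: "(\<lambda>n. \<eta> n x) \<longlonglongrightarrow> indicat_real K x" for x
  proof (cases "x \<in> K")
    case True then show ?thesis using \<eta>(4) by (simp add: tendsto_const)
  next
    case False
    have "open (- K)" "x \<in> - K" using False compact_imp_closed[OF K(1)] by auto
    then obtain e where e: "e > 0" "ball x e \<subseteq> - K" by (rule openE)
    obtain n0 where "inverse (real (Suc n0)) < e" using reals_Archimedean[OF e(1)] by blast
    then have "\<eta> n x = 0" if "n \<ge> n0" for n
    proof -
      have "inverse (real (Suc n)) \<le> inverse (real (Suc n0))" using that by (simp add: field_simps)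
      then have "ball x (inverse (real (Suc n))) \<subseteq> ball x e"
        using \<open>inverse (real (Suc n0)) < e\<close> by (intro subset_ball) linarith
      then have "y \<notin> ball x (inverse (real (Suc n)))" if "y \<in> K" for y using e(2) that by blast
      then have "x \<notin> V n" by (simp add: V_def dist_commute del: of_nat_Suc)
      then show ?thesis by (rule V0)
    qed
    then have "\<forall>\<^sub>F n in sequentially. \<eta> n x = indicat_real K x"
      using False by (auto simp: eventually_sequentially)
    then show ?thesis by (rule tendsto_eventually)
  qed
  have hK0: "integrable lebesgue (\<lambda>x. indicator K0 x *\<^sub>R h x)"
    using h K0 unfolding loc_integrable_def set_integrable_def by blast
  have hK: "integrable lebesgue (\<lambda>x. indicator K x *\<^sub>R h x)"
    using h K unfolding loc_integrable_def set_integrable_def by blast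
  have sm: "smooth (\<eta> n)" for n using \<eta>(1) test_function_smooth by blast
  have "(\<lambda>n. \<integral>x. indicator K0 x *\<^sub>R h x * \<eta> n x \<partial>lebesgue) \<longlonglongrightarrow> (\<integral>x. indicator K x *\<^sub>R h x \<partial>lebesgue)"
  proof (rule integral_dominated_convergence[where w = "\<lambda>x. \<bar>indicator K0 x *\<^sub>R h x\<bar>"])
    show "(\<lambda>x. indicat_real K x *\<^sub>R h x) \<in> borel_measurable lebesgue" using hK by blast
    have "\<eta> n \<in> borel_measurable lebesgue" for n
      using borel_measurable_continuous_onI[OF smooth_continuous[OF sm]]
      by (simp add: measurable_completion)
    then show "(\<lambda>x. indicat_real K0 x *\<^sub>R h x * \<eta> n x) \<in> borel_measurable lebesgue" for n
      using hK0 by (intro borel_measurable_times) auto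
    have "K \<subseteq> K0" using \<theta>(3) WK0 by auto
    have "(\<lambda>n. indicat_real K0 x *\<^sub>R h x * \<eta> n x) \<longlonglongrightarrow> indicat_real K0 x *\<^sub>R h x * indicat_real K x" for x
      by (intro tendsto_intros lim)
    moreover have "indicat_real K0 x *\<^sub>R h x * indicat_real K x = indicat_real K x *\<^sub>R h x" for x
      using \<open>K \<subseteq> K0\<close> by (auto simp: indicator_def)
    ultimately have "(\<lambda>n. indicat_real K0 x *\<^sub>R h x * \<eta> n x) \<longlonglongrightarrow> indicat_real K x *\<^sub>R h x" for x
      by (simp only:)
    then show "AE x in lebesgue. (\<lambda>n. indicat_real K0 x *\<^sub>R h x * \<eta> n x) \<longlonglongrightarrow> indicat_real K x *\<^sub>R h x"
      by (rule AE_I2)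
    show "AE x in lebesgue. norm (indicat_real K0 x *\<^sub>R h x * \<eta> n x) \<le> \<bar>indicat_real K0 x *\<^sub>R h x\<bar>" for n
      using \<eta>(2,3) by (auto simp: abs_mult intro!: mult_left_le)
  qed (use hK0 in auto)
  moreover have "(\<integral>x. indicator K0 x *\<^sub>R h x * \<eta> n x \<partial>lebesgue) = 0" for n
  proof -
    have "V n \<subseteq> U" using WK0 K0(2) by (auto simp: V_def)
    have "(\<integral>x. indicator K0 x *\<^sub>R h x * \<eta> n x \<partial>lebesgue) = (\<integral>x\<in>U. h x * \<eta> n x \<partial>lebesgue)"
      unfolding set_lebesgue_integral_def
    proof (intro Bochner_Integration.integral_cong refl)
      fix x show "indicat_real K0 x *\<^sub>R h x * \<eta> n x = indicat_real U x *\<^sub>R (h x * \<eta> n x)"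
        using V0[of x n] WK0 K0(2) by (cases "x \<in> V n") (auto simp: V_def indicator_def)
    qed
    also have "\<dots> = 0" using zero test_function_mono[OF \<eta>(1) \<open>V n \<subseteq> U\<close>] by blast
    finally show ?thesis .
  qed
  ultimately show ?thesis
    unfolding set_lebesgue_integral_def by (simp add: tendsto_const_iff)
qed

text \<open>
  Inner regularity: if \<open>f\<close> were positive on a set of positive measure, it would be positive on a compact subset
  of positive measure and have a positive integral there.
\<close>

lemma AE_le_0_of_compact_integrals:
  fixes f :: "'a::euclidean_space \<Rightarrow> real"
  assumes C: "compact C" and f: "set_integrable lebesgue C f"
    and zero: "\<And>K. compact K \<Longrightarrow> K \<subseteq> C \<Longrightarrow> (\<integral>x\<in>K. f x \<partial>lebesgue) = 0"
  shows "AE x in lebesgue. x \<in> C \<longrightarrow> f x \<le> 0"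
proof -
  have mf: "(\<lambda>x. indicator C x *\<^sub>R f x) \<in> borel_measurable lebesgue"
    using f unfolding set_integrable_def by blast
  define P where "P = {x. indicator C x *\<^sub>R f x > 0}"
  have P: "P \<in> sets lebesgue"
  proof -
    have "P = (\<lambda>x. indicator C x *\<^sub>R f x) -` {0<..} \<inter> space lebesgue" by (auto simp: P_def)
    then show ?thesis using measurable_sets[OF mf, of "{0<..}"] by simp
  qed
  have PC: "x \<in> P \<longleftrightarrow> x \<in> C \<and> f x > 0" for x by (auto simp: P_def indicator_def)
  have null: "emeasure lebesgue T = 0" if T: "closed T" "T \<subseteq> P" for T
  proof -
    have TC: "T \<subseteq> C" using T PC by auto
    have cT: "compact T" using compact_Int_closed[OF C T(1)] TC by (simp add: Int_absorb1)
    have Tm: "T \<in> sets lebesgue" using T(1) by (simp add: borel_closed)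
    have int: "integrable lebesgue (\<lambda>x. indicator T x *\<^sub>R f x)"
      using set_integrable_subset[OF f Tm TC] by (simp add: set_integrable_def)
    have "AE x in lebesgue. indicator T x *\<^sub>R f x = 0"
    proof (subst integral_nonneg_eq_0_iff_AE[symmetric, OF int])
      show "AE x in lebesgue. 0 \<le> indicator T x *\<^sub>R f x"
        using T(2) PC by (auto simp: indicator_def intro!: AE_I2 less_imp_le)
      show "(\<integral>x. indicator T x *\<^sub>R f x \<partial>lebesgue) = 0"
        using zero[OF cT TC] by (simp add: set_lebesgue_integral_def)
    qed
    then have "AE x in lebesgue. x \<notin> T"
      by (rule AE_mp) (use T(2) PC in \<open>auto simp: indicator_def intro!: AE_I2\<close>)
    then show ?thesis using Tm by (simp add: AE_iff_null_sets[symmetric] null_setsD1)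
  qed
  have small: "emeasure lebesgue P \<le> 0 + ennreal e" if "e > 0" for e
  proof -
    obtain T where T: "closed T" "T \<subseteq> P" "P - T \<in> lmeasurable" "emeasure lebesgue (P - T) < ennreal e"
      using sets_lebesgue_inner_closed[OF P \<open>e > 0\<close>] by blast
    have "emeasure lebesgue P = emeasure lebesgue (T \<union> (P - T))" using T by (simp add: Un_absorb1)
    also have "\<dots> \<le> emeasure lebesgue T + emeasure lebesgue (P - T)"
      by (rule emeasure_subadditive) (use T(1) T(3) in \<open>auto simp: borel_closed fmeasurableD\<close>)
    finally show ?thesis using T(4) null[OF T(1,2)] by (simp add: less_imp_le order_trans)
  qed
  have "emeasure lebesgue P \<le> 0" by (rule ennreal_le_epsilon) (rule small)
  then have "P \<in> null_sets lebesgue" using P by (intro null_setsI) simp_all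
  then have "AE x in lebesgue. x \<notin> P" by (rule AE_not_in)
  then show ?thesis by eventually_elim (use PC in force)
qed

lemma fundamental_lemma_variations:
  fixes h :: "'a::euclidean_space \<Rightarrow> real"
  assumes U: "open U" and h: "loc_integrable U h"
    and zero: "\<And>\<eta>. test_function U \<eta> \<Longrightarrow> (\<integral>x\<in>U. h x * \<eta> x \<partial>lebesgue) = 0"
  shows "AE x in lebesgue. x \<in> U \<longrightarrow> h x = 0"
proof -
  obtain C where C: "\<And>n::nat. compact (C n)" "\<And>n. C n \<subseteq> U" "\<Union>(range C) = U"
    by (rule open_Union_compact_subsets[OF U]) (blast intro: that)
  have "AE x in lebesgue. x \<in> C n \<longrightarrow> h x = 0" for n
  proof -
    have i: "set_integrable lebesgue (C n) h" using h C unfolding loc_integrable_def by blast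
    have z: "(\<integral>x\<in>K. h x \<partial>lebesgue) = 0" if "compact K" "K \<subseteq> C n" for K
      using compact_integral_eq_0_of_tests[OF U h zero] that C(2) by blast
    have "AE x in lebesgue. x \<in> C n \<longrightarrow> h x \<le> 0"
      using AE_le_0_of_compact_integrals[OF C(1) i z] .
    moreover have "AE x in lebesgue. x \<in> C n \<longrightarrow> - h x \<le> 0"
    proof (rule AE_le_0_of_compact_integrals[OF C(1)])
      show "set_integrable lebesgue (C n) (\<lambda>x. - h x)"
        using i by (simp add: set_integrable_def)
      show "(\<integral>x\<in>K. - h x \<partial>lebesgue) = 0" if "compact K" "K \<subseteq> C n" for K
        using z[OF that] by (simp add: set_lebesgue_integral_def)
    qed
    ultimately show ?thesis by eventually_elim auto
  qed
  then have "AE x in lebesgue. \<forall>n. x \<in> C n \<longrightarrow> h x = 0" by (subst AE_all_countable) blast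
  moreover have "\<exists>n. x \<in> C n" if "x \<in> U" for x using C(3) that by blast
  ultimately show ?thesis by (auto elim!: eventually_mono)
qed

section \<open>Weak gradients\<close>

lemma loc_integrable_times_integrable:
  fixes f \<psi> :: "'a::euclidean_space \<Rightarrow> real"
  assumes f: "loc_integrable U f" and \<psi>: "continuous_on UNIV \<psi>"
    and K: "compact K" "K \<subseteq> U" "\<And>x. x \<notin> K \<Longrightarrow> \<psi> x = 0"
  shows "set_integrable lebesgue U (\<lambda>x. f x * \<psi> x)"
proof -
  obtain C where C: "C > 0" "\<And>x. norm (\<psi> x) \<le> C"
    using continuous_compact_support_bounded[OF \<psi> K(1,3)] by metis
  have i: "integrable lebesgue (\<lambda>x. indicator K x *\<^sub>R f x)"
    using f K unfolding loc_integrable_def set_integrable_def by metis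
  have m: "\<psi> \<in> borel_measurable lebesgue"
    using borel_measurable_continuous_onI[OF \<psi>] by (simp add: measurable_completion)
  have "integrable lebesgue (\<lambda>x. (indicator K x *\<^sub>R f x) * \<psi> x)"
  proof (rule Bochner_Integration.integrable_bound)
    show "integrable lebesgue (\<lambda>x. C * (indicator K x *\<^sub>R f x))"
      using i by (rule integrable_mult_right)
    show "(\<lambda>x. (indicator K x *\<^sub>R f x) * \<psi> x) \<in> borel_measurable lebesgue"
      by (rule borel_measurable_times[OF borel_measurable_integrable[OF i] m])
    show "AE x in lebesgue. norm (indicat_real K x *\<^sub>R f x * \<psi> x) \<le> norm (C * indicat_real K x *\<^sub>R f x)"
    proof (rule AE_I2)
      fix x
      have "\<bar>f x\<bar> * \<bar>\<psi> x\<bar> \<le> \<bar>f x\<bar> * C" using C(2)[of x] by (intro mult_left_mono) auto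
      then show "norm (indicat_real K x *\<^sub>R f x * \<psi> x) \<le> norm (C * indicat_real K x *\<^sub>R f x)"
        using C(1) by (simp add: abs_mult indicator_def mult.commute)
    qed
  qed
  moreover have "(\<lambda>x. (indicator K x *\<^sub>R f x) * \<psi> x) = (\<lambda>x. indicator U x *\<^sub>R (f x * \<psi> x))"
    using K(2,3) by (fastforce simp: indicator_def)
  ultimately show ?thesis by (simp add: set_integrable_def)
qed

lemma loc_integrable_inner: "loc_integrable U g \<Longrightarrow> loc_integrable U (\<lambda>x. g x \<bullet> b)"
  unfolding loc_integrable_def set_integrable_def
  using integrable_inner_left[of b lebesgue "\<lambda>x. indicator K x *\<^sub>R g x" for K] by simp

lemma loc_integrable_subset: "loc_integrable U f \<Longrightarrow> V \<subseteq> U \<Longrightarrow> loc_integrable V f"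
  unfolding loc_integrable_def by auto

lemma weak_gradient_test_integrable:
  assumes "has_weak_gradient U f g" "test_function U \<eta>" "b \<in> Basis"
  shows "set_integrable lebesgue U (\<lambda>x. f x * partial b \<eta> x)"
    and "set_integrable lebesgue U (\<lambda>x. (g x \<bullet> b) * \<eta> x)"
proof -
  obtain K where K: "compact K" "K \<subseteq> U" "\<And>x. x \<notin> K \<Longrightarrow> \<eta> x = 0" and s: "smooth \<eta>"
    using assms(2) unfolding test_function_iff by metis
  show "set_integrable lebesgue U (\<lambda>x. f x * partial b \<eta> x)"
  proof (rule loc_integrable_times_integrable[OF _ _ K(1,2)])
    show "partial b \<eta> x = 0" if "x \<notin> K" for x
      by (rule partial_eq_0_outside[OF compact_imp_closed[OF K(1)] K(3) that])
  qed (use assms s in \<open>simp_all add: has_weak_gradient_def smooth_partial smooth_continuous\<close>)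
  show "set_integrable lebesgue U (\<lambda>x. (g x \<bullet> b) * \<eta> x)"
    by (rule loc_integrable_times_integrable[OF _ _ K])
      (use assms s in \<open>simp_all add: has_weak_gradient_def loc_integrable_inner smooth_continuous\<close>)
qed

lemma weak_gradient_subset:
  assumes w: "has_weak_gradient U f g" and VU: "V \<subseteq> U"
  shows "has_weak_gradient V f g"
  unfolding has_weak_gradient_partial
proof (intro conjI allI impI ballI)
  show "loc_integrable V f" "loc_integrable V g"
    using w VU loc_integrable_subset unfolding has_weak_gradient_def by metis+
  fix \<eta> and b :: 'a assume \<eta>: "test_function V \<eta>" and b: "b \<in> Basis"
  have "(\<integral>x\<in>V. f x * partial b \<eta> x \<partial>lebesgue) = (\<integral>x\<in>U. f x * partial b \<eta> x \<partial>lebesgue)"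
    unfolding set_lebesgue_integral_def
    by (intro Bochner_Integration.integral_cong)
       (use \<eta> VU in \<open>auto simp: indicator_def test_function_partial_eq_0\<close>)
  moreover have "(\<integral>x\<in>V. (g x \<bullet> b) * \<eta> x \<partial>lebesgue) = (\<integral>x\<in>U. (g x \<bullet> b) * \<eta> x \<partial>lebesgue)"
    unfolding set_lebesgue_integral_def
    by (intro Bochner_Integration.integral_cong)
       (use \<eta> VU in \<open>auto simp: indicator_def test_function_eq_0\<close>)
  ultimately show "(\<integral>x\<in>V. f x * partial b \<eta> x \<partial>lebesgue) = - (\<integral>x\<in>V. (g x \<bullet> b) * \<eta> x \<partial>lebesgue)"
    using w test_function_mono[OF \<eta> VU] b unfolding has_weak_gradient_partial by simp
qed

lemma weak_gradient_cong:
  assumes "\<And>x. x \<in> U \<Longrightarrow> f x = f' x" "has_weak_gradient U f g"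
  shows "has_weak_gradient U f' g"
proof -
  have "(\<lambda>x. indicator K x *\<^sub>R f' x) = (\<lambda>x. indicator K x *\<^sub>R f x)" if "K \<subseteq> U" for K
    using that assms(1) by (fastforce simp: indicator_def)
  then have "loc_integrable U f' \<longleftrightarrow> loc_integrable U f"
    unfolding loc_integrable_def set_integrable_def by metis
  moreover have "(\<integral>x\<in>U. f' x * partial b \<eta> x \<partial>lebesgue) = (\<integral>x\<in>U. f x * partial b \<eta> x \<partial>lebesgue)" for \<eta> b
    unfolding set_lebesgue_integral_def
    by (intro Bochner_Integration.integral_cong) (use assms(1) in \<open>auto simp: indicator_def\<close>)
  ultimately show ?thesis using assms(2) unfolding has_weak_gradient_partial by simp
qed

text \<open>
  The functions may differ by a constant, as partial derivatives of test functions have integral \<open>0\<close>.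
  Applied locally, the lemma lets the weak gradient of a composition be read off from any function that
  agrees with it up to a constant.
\<close>

lemma weak_gradient_unique:
  assumes V: "open V" and f: "has_weak_gradient V f g" and f': "has_weak_gradient V f' g'"
    and eq: "\<And>x. x \<in> V \<Longrightarrow> f x = f' x + c"
  shows "AE x in lebesgue. x \<in> V \<longrightarrow> g x = g' x"
proof -
  have "AE x in lebesgue. x \<in> V \<longrightarrow> g x \<bullet> b - g' x \<bullet> b = 0" if b: "b \<in> Basis" for b
  proof (rule fundamental_lemma_variations[OF V])
    show "loc_integrable V (\<lambda>x. g x \<bullet> b - g' x \<bullet> b)"
      using f f' loc_integrable_inner[of V g b] loc_integrable_inner[of V g' b]
      unfolding has_weak_gradient_def loc_integrable_def by (simp add: set_integral_diff(1))
    fix \<eta> assume \<eta>: "test_function V \<eta>"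
    note i = weak_gradient_test_integrable[OF f \<eta> b] weak_gradient_test_integrable[OF f' \<eta> b]
    have "(\<integral>x\<in>V. (g x \<bullet> b - g' x \<bullet> b) * \<eta> x \<partial>lebesgue)
        = (\<integral>x\<in>V. (g x \<bullet> b) * \<eta> x \<partial>lebesgue) - (\<integral>x\<in>V. (g' x \<bullet> b) * \<eta> x \<partial>lebesgue)"
      using set_integral_diff(2)[OF i(2) i(4)] by (simp add: left_diff_distrib)
    also have "\<dots> = (\<integral>x\<in>V. f' x * partial b \<eta> x \<partial>lebesgue) - (\<integral>x\<in>V. f x * partial b \<eta> x \<partial>lebesgue)"
      using f f' \<eta> b unfolding has_weak_gradient_partial by simp
    also have "\<dots> = (\<integral>x\<in>V. f' x * partial b \<eta> x - f x * partial b \<eta> x \<partial>lebesgue)"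
      using set_integral_diff(2)[OF i(3) i(1)] by simp
    also have "\<dots> = (\<integral>x\<in>V. (- c) * partial b \<eta> x \<partial>lebesgue)"
      unfolding set_lebesgue_integral_def
      by (intro Bochner_Integration.integral_cong) (auto simp: indicator_def eq algebra_simps)
    also have "\<dots> = (- c) * (\<integral>x\<in>V. partial b \<eta> x \<partial>lebesgue)"
      by (rule set_integral_mult_right)
    also have "\<dots> = 0" using integral_partial_test_eq_0[OF \<eta> b] by simp
    finally show "(\<integral>x\<in>V. (g x \<bullet> b - g' x \<bullet> b) * \<eta> x \<partial>lebesgue) = 0" .
  qed
  then have "AE x in lebesgue. \<forall>b\<in>Basis. x \<in> V \<longrightarrow> g x \<bullet> b - g' x \<bullet> b = 0"
    by (intro AE_finite_allI) auto
  then show ?thesis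
    by eventually_elim (auto intro: euclidean_eqI)
qed

section \<open>Seminorms of test functions\<close>

lemma epowr_ennreal: "x \<ge> 0 \<Longrightarrow> epowr (ennreal x) a = ennreal (x powr a)"
  by (simp add: epowr_def)

lemma epowr_mono: "x \<le> y \<Longrightarrow> a \<ge> 0 \<Longrightarrow> epowr x a \<le> epowr y a"
  by (cases x; cases y) (auto simp: epowr_def powr_mono2 top_unique ennreal_leI)

lemma epowr_le_imp_le:
  assumes "epowr X a \<le> ennreal S" "a > 0" "S \<ge> 0"
  shows "X \<le> ennreal (S powr (1 / a))"
proof (cases X)
  case (real x)
  then have "x powr a \<le> S" using assms by (simp add: epowr_ennreal)
  then have "(x powr a) powr (1 / a) \<le> S powr (1 / a)" using assms(2) by (intro powr_mono2) auto
  then show ?thesis using real assms(2) by (simp add: powr_powr ennreal_leI)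
next
  case top
  then show ?thesis using assms(1) by (simp add: epowr_def top_unique)
qed

text \<open>
  The seminorm is defined through a chosen weak gradient; by uniqueness any weak gradient computes it.
\<close>

lemma L1_seminorm_eq:
  assumes "open U" "has_weak_gradient U f g"
  shows "L1_seminorm p U f = Lp_norm p U g"
proof -
  let ?h = "SOME g. has_weak_gradient U f g"
  have h: "has_weak_gradient U f ?h" by (rule someI[of "has_weak_gradient U f", OF assms(2)])
  have "AE x in lebesgue. x \<in> U \<longrightarrow> ?h x = g x"
    by (rule weak_gradient_unique[OF assms(1) h assms(2), of 0]) simp
  then have "(\<integral>\<^sup>+x\<in>U. ennreal (norm (?h x) powr p) \<partial>lebesgue) = (\<integral>\<^sup>+x\<in>U. ennreal (norm (g x) powr p) \<partial>lebesgue)"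
    by (intro nn_integral_cong_AE) (auto elim!: eventually_mono simp: indicator_def)
  moreover have "L1_seminorm p U f = Lp_norm p U ?h"
    unfolding L1_seminorm_def using assms(2) by auto
  ultimately show ?thesis by (simp add: Lp_norm_def)
qed

lemma L1_seminorm_test_extend:
  assumes "open U" "open V" "V \<subseteq> U" "test_function V f"
  shows "L1_seminorm p U f = L1_seminorm p V f"
proof -
  have f: "smooth f" using assms(4) by (rule test_function_smooth)
  have "gradient f x = 0" if "x \<notin> V" for x
    using test_function_partial_eq_0[OF assms(4) that] by (simp add: gradient_def)
  then have "(\<integral>\<^sup>+x\<in>U. ennreal (norm (gradient f x) powr p) \<partial>lebesgue) =
      (\<integral>\<^sup>+x\<in>V. ennreal (norm (gradient f x) powr p) \<partial>lebesgue)"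
    by (intro nn_integral_cong) (use assms(3) in \<open>auto simp: indicator_def\<close>)
  then show ?thesis
    using L1_seminorm_eq[OF assms(1) smooth_has_weak_gradient[OF f]]
      L1_seminorm_eq[OF assms(2) smooth_has_weak_gradient[OF f]] by (simp add: Lp_norm_def)
qed

lemma L1_seminorm_test_le:
  assumes "open V" "test_function V f" "V \<in> lmeasurable" "p > 0" "\<And>x. norm (gradient f x) \<le> C"
  shows "L1_seminorm p V f \<le> ennreal (C * measure lebesgue V powr (1 / p))"
proof -
  have C: "C \<ge> 0" using assms(5) norm_ge_zero order_trans by blast
  have "(\<integral>\<^sup>+x\<in>V. ennreal (norm (gradient f x) powr p) \<partial>lebesgue) \<le> (\<integral>\<^sup>+x. ennreal (C powr p) * indicator V x \<partial>lebesgue)"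
    by (intro nn_integral_mono mult_right_mono ennreal_leI powr_mono2) (use assms in auto)
  also have "\<dots> = ennreal (C powr p) * emeasure lebesgue V"
    using assms(3) by (intro nn_integral_cmult_indicator) auto
  also have "\<dots> = ennreal (C powr p * measure lebesgue V)"
    using assms(3) by (simp add: emeasure_eq_measure2 ennreal_mult)
  finally have "Lp_norm p V (gradient f) \<le> epowr (ennreal (C powr p * measure lebesgue V)) (1 / p)"
    unfolding Lp_norm_def using assms(4) by (intro epowr_mono) auto
  also have "\<dots> = ennreal (C * measure lebesgue V powr (1 / p))"
    using C assms(4) by (subst epowr_ennreal) (auto simp: powr_mult powr_powr)
  finally show ?thesis
    using L1_seminorm_eq[OF assms(1) smooth_has_weak_gradient[OF test_function_smooth[OF assms(2)]]] by simp
qed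

lemma partial_const: "partial b (\<lambda>x. c) x = 0"
  by (simp add: partial_eq[OF has_derivative_const])

lemma capacity_empty: "capacity p {} = 0"
proof -
  let ?z = "\<lambda>x::'a::euclidean_space. 0::real"
  have z: "gradient ?z x = 0" for x
    by (simp add: gradient_def partial_const)
  have "capacity p ({}::'a set) \<le> (\<integral>\<^sup>+x. ennreal (\<bar>?z x\<bar> powr p) \<partial>lebesgue)
      + (\<integral>\<^sup>+x. ennreal (norm (gradient ?z x) powr p) \<partial>lebesgue)"
    unfolding capacity_def
    by (rule Inf_lower, rule CollectI,
        intro exI[of _ ?z] exI[of _ "gradient ?z"] conjI refl smooth_has_weak_gradient smooth_const)
       (rule exI[of _ "{}"], simp)
  also have "\<dots> = 0" by (simp add: z)
  finally show ?thesis by simp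
qed

lemma continuous_quasicontinuous: "continuous_on \<Omega> f \<Longrightarrow> quasicontinuous p \<Omega> f"
  unfolding quasicontinuous_def by (auto intro!: exI[of _ "{}"] simp: capacity_empty)

text \<open>
  The gradient is bounded with bounded support, and a continuous function is quasicontinuous with the empty
  exceptional set.
\<close>

lemma test_function_L1_space:
  assumes "open U" "test_function U f" "p > 0"
  shows "f \<in> L1_space p U"
proof -
  have f: "smooth f" using assms(2) by (rule test_function_smooth)
  obtain K where K: "compact K" "K \<subseteq> U" "\<And>x. x \<notin> K \<Longrightarrow> f x = 0"
    using assms(2) unfolding test_function_iff by metis
  have g0: "gradient f x = 0" if "x \<notin> K" for x
    by (rule gradient_eq_0_outside[OF compact_imp_closed[OF K(1)] K(3) that])
  obtain C where C: "C > 0" "\<And>x. norm (gradient f x) \<le> C"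
    by (rule continuous_compact_support_bounded[OF continuous_gradient[OF f] K(1) g0], assumption, rule that)
  obtain R where R: "K \<subseteq> ball 0 R"
    using bounded_subset_ballD[OF compact_imp_bounded[OF K(1)], of 0] by blast
  let ?V = "U \<inter> ball 0 R"
  have V: "open ?V" "?V \<subseteq> U" "test_function ?V f" "?V \<in> lmeasurable"
    using assms(1) K R f by (auto simp: test_function_iff intro!: lmeasurable_open bounded_subset[OF bounded_ball])
  have "L1_seminorm p U f = L1_seminorm p ?V f"
    by (rule L1_seminorm_test_extend[OF assms(1) V(1-3)])
  also have "\<dots> < \<infinity>"
    using L1_seminorm_test_le[OF V(1,3,4) assms(3) C(2)] by (simp add: le_less_trans[OF _ ennreal_less_top])
  finally have "L1_seminorm p U f < \<infinity>" .
  moreover have "quasicontinuous p U f"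
    by (intro continuous_quasicontinuous continuous_on_subset[OF smooth_continuous[OF f] subset_UNIV])
  ultimately show ?thesis
    unfolding L1_space_def using smooth_has_weak_gradient[OF f] by blast
qed

lemma test_function_C0_space: "test_function U f \<Longrightarrow> f \<in> C0_space U"
  using smooth_continuous[OF test_function_smooth, of U f]
  by (auto simp: C0_space_def test_function_def)

section \<open>Averages with a shrinking kernel\<close>

text \<open>
  The coordinate that maps the ball of radius \<open>s/2\<close> about \<open>y + s e\<close> to the ball of radius \<open>1/2\<close> about the origin.
  As \<open>s\<close> shrinks to \<open>0\<close>, the centre \<open>y + s e\<close> moves to \<open>y\<close> along a segment.
\<close>

definition rescaled :: "'a::euclidean_space \<Rightarrow> 'a \<Rightarrow> real \<Rightarrow> 'a \<Rightarrow> 'a" where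
  "rescaled y e s z = (1 / s) *\<^sub>R (z - y) - e"

text \<open>
  A smooth bump on the ball of radius \<open>1/2\<close>.
\<close>

definition profile :: "'a::euclidean_space \<Rightarrow> real" where
  "profile w = flat (1 / 4 - w \<bullet> w)"

text \<open>
  The factor keeps the integral over the whole space independent of \<open>s\<close>.
\<close>

definition averaging_kernel :: "'a::euclidean_space \<Rightarrow> 'a \<Rightarrow> real \<Rightarrow> 'a \<Rightarrow> real" where
  "averaging_kernel y e s z = profile (rescaled y e s z) / s ^ DIM('a)"

text \<open>
  The component in direction \<open>b\<close> of the field \<open>profile * (z - y) / s ^ (n + 1)\<close>, which carries the mass of
  the kernel outwards as \<open>s\<close> grows; this is the continuity equation \<open>\<partial>\<^sub>s kernel + div field = 0\<close>, see
  \<open>kernel_has_rate\<close> and \<open>sum_partial_transport\<close>.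
\<close>

definition transport :: "'a::euclidean_space \<Rightarrow> 'a \<Rightarrow> real \<Rightarrow> 'a \<Rightarrow> 'a \<Rightarrow> real" where
  "transport y e s b z = profile (rescaled y e s z) * ((z - y) \<bullet> b) / s ^ Suc (DIM('a))"

abbreviation flat' :: "real \<Rightarrow> real" where "flat' \<equiv> partial 1 flat"

lemma continuous_flat': "continuous_on UNIV flat'"
  by (intro smooth_continuous smooth_partial smooth_flat) simp

lemma profile_nonneg: "0 \<le> profile w" and profile_le_1: "profile w \<le> 1"
  by (simp_all add: profile_def flat_nonneg flat_le_1)

lemma profile_eq_0: "norm w \<ge> 1 / 2 \<Longrightarrow> profile w = 0"
proof -
  assume "norm w \<ge> 1 / 2"
  then have "(1 / 2)\<^sup>2 \<le> (norm w)\<^sup>2" by (intro power_mono) auto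
  then have "(1 / 2)\<^sup>2 \<le> w \<bullet> w" unfolding power2_norm_eq_inner .
  then have "1 / 4 - w \<bullet> w \<le> 0" by (simp add: power2_eq_square)
  then show ?thesis by (simp add: profile_def flat_eq_0)
qed

lemma profile_rescaled_eq_0:
  assumes "s > 0" "z \<notin> cball (y + s *\<^sub>R e) (s / 2)"
  shows "profile (rescaled y e s z) = 0"
proof (rule profile_eq_0)
  have "s *\<^sub>R rescaled y e s z = z - (y + s *\<^sub>R e)"
    using assms(1) by (simp add: rescaled_def algebra_simps)
  then have "s * norm (rescaled y e s z) = dist z (y + s *\<^sub>R e)"
    using assms(1) by (metis abs_of_pos dist_norm norm_scaleR)
  moreover have "dist z (y + s *\<^sub>R e) > s * (1 / 2)" using assms(2) by (simp add: dist_commute)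
  ultimately have "s * (1 / 2) < s * norm (rescaled y e s z)" by simp
  then show "norm (rescaled y e s z) \<ge> 1 / 2" using assms(1) by simp
qed

lemma smooth_profile_rescaled: "smooth (\<lambda>z. profile (rescaled y e s z))"
proof -
  have "(\<lambda>z. rescaled y e s z \<bullet> rescaled y e s z) = (\<lambda>z. \<Sum>b\<in>Basis. ((z \<bullet> b - y \<bullet> b) / s - e \<bullet> b)\<^sup>2)"
    by (subst euclidean_inner) (simp add: rescaled_def inner_diff_left power2_eq_square)
  then have "smooth (\<lambda>z. rescaled y e s z \<bullet> rescaled y e s z)" by (simp only:) (intro smooth_intros)
  then show ?thesis unfolding profile_def by (intro smooth_compose[OF smooth_flat] smooth_intros)
qed

lemma smooth_transport: "smooth (transport y e s b)"
  unfolding transport_def[abs_def] by (intro smooth_intros smooth_profile_rescaled) (simp add: inner_diff_left smooth_intros)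

lemma partial_transport:
  fixes z :: "'a::euclidean_space"
  assumes "s > 0" "b \<in> Basis"
  shows "partial b (transport y e s b) z =
    (profile (rescaled y e s z) - flat' (1 / 4 - rescaled y e s z \<bullet> rescaled y e s z) *
       (2 * (rescaled y e s z \<bullet> b)) / s * ((z - y) \<bullet> b)) / s ^ Suc (DIM('a))"
proof -
  let ?w = "rescaled y e s"
  have dq: "((\<lambda>z. 1 / 4 - ?w z \<bullet> ?w z) has_derivative (\<lambda>h. - (2 * (?w z \<bullet> h)) / s)) (at z)"
    unfolding rescaled_def
    by (use assms(1) in \<open>auto intro!: derivative_eq_intros simp: inner_commute algebra_simps inner_diff_left inner_diff_right add_divide_distrib diff_divide_distrib\<close>)
  have "((\<lambda>z. profile (?w z)) has_derivative (\<lambda>h. flat' (1 / 4 - ?w z \<bullet> ?w z) * (- (2 * (?w z \<bullet> h)) / s))) (at z)"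
    unfolding profile_def
    using has_derivative_compose[OF dq smooth_has_real_derivative[OF smooth_flat, unfolded has_field_derivative_def]] by simp
  then have "(transport y e s b has_derivative (\<lambda>h. (profile (?w z) * (h \<bullet> b) +
      flat' (1 / 4 - ?w z \<bullet> ?w z) * (- (2 * (?w z \<bullet> h)) / s) * ((z - y) \<bullet> b)) / s ^ Suc (DIM('a)))) (at z)"
    unfolding transport_def[abs_def]
    by (intro bounded_linear.has_derivative[OF bounded_linear_divide] has_derivative_mult)
       (auto intro!: derivative_eq_intros)
  then show ?thesis using assms(2) by (simp add: partial_eq)
qed

definition kernel_rate :: "'a::euclidean_space \<Rightarrow> 'a \<Rightarrow> real \<Rightarrow> 'a \<Rightarrow> real" where
  "kernel_rate y e s z =
    (flat' (1 / 4 - rescaled y e s z \<bullet> rescaled y e s z) * (2 * (rescaled y e s z \<bullet> (z - y))) / s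
      - real DIM('a) * profile (rescaled y e s z)) / s ^ Suc (DIM('a))"

lemma kernel_has_rate:
  fixes z :: "'a::euclidean_space"
  assumes s: "s > 0"
  shows "((\<lambda>s. averaging_kernel y e s z) has_real_derivative kernel_rate y e s z) (at s)"
proof -
  let ?w = "\<lambda>s. rescaled y e s z"
  have dq: "((\<lambda>s. 1 / 4 - ?w s \<bullet> ?w s) has_real_derivative (2 * (?w s \<bullet> (z - y))) / s\<^sup>2) (at s)"
  proof -
    let ?u = "z - y"
    have "((\<lambda>t. 1 / 4 - ((?u \<bullet> ?u) * t\<^sup>2 - 2 * (e \<bullet> ?u) * t + e \<bullet> e)) has_real_derivative
        2 * (e \<bullet> ?u) - 2 * (?u \<bullet> ?u) * inverse s) (at (inverse s))"
      by (auto intro!: derivative_eq_intros)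
    from DERIV_chain2[OF this DERIV_inverse]
    have "((\<lambda>s. 1 / 4 - ((?u \<bullet> ?u) * (inverse s)\<^sup>2 - 2 * (e \<bullet> ?u) * inverse s + e \<bullet> e)) has_real_derivative
        (2 * (e \<bullet> ?u) - 2 * (?u \<bullet> ?u) * inverse s) * - (inverse s ^ Suc (Suc 0))) (at s)"
      using s by simp
    moreover have "1 / 4 - ?w s \<bullet> ?w s = 1 / 4 - ((?u \<bullet> ?u) * (inverse s)\<^sup>2 - 2 * (e \<bullet> ?u) * inverse s + e \<bullet> e)" for s
      unfolding rescaled_def inverse_eq_divide[symmetric]
      by (simp add: inner_diff_left inner_diff_right inner_commute power2_eq_square algebra_simps)
    moreover have "(2 * (e \<bullet> ?u) - 2 * (?u \<bullet> ?u) * inverse s) * - (inverse s ^ Suc (Suc 0)) = (2 * (?w s \<bullet> ?u)) / s\<^sup>2"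
      unfolding rescaled_def divide_inverse
      by (simp add: inner_diff_left inner_diff_right inner_commute power2_eq_square algebra_simps)
    ultimately show ?thesis by (simp only:)
  qed
  have "((\<lambda>s. profile (?w s)) has_real_derivative flat' (1 / 4 - ?w s \<bullet> ?w s) * ((2 * (?w s \<bullet> (z - y))) / s\<^sup>2)) (at s)"
    unfolding profile_def using DERIV_chain2[OF smooth_has_real_derivative[OF smooth_flat] dq] .
  moreover have "((\<lambda>s. s ^ DIM('a)) has_real_derivative real DIM('a) * s ^ (DIM('a) - Suc 0)) (at s)"
    by (rule DERIV_pow)
  ultimately have "((\<lambda>s. averaging_kernel y e s z) has_real_derivative
      ((flat' (1 / 4 - ?w s \<bullet> ?w s) * ((2 * (?w s \<bullet> (z - y))) / s\<^sup>2)) * s ^ DIM('a)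
        - profile (?w s) * (real DIM('a) * s ^ (DIM('a) - Suc 0))) / (s ^ DIM('a) * s ^ DIM('a))) (at s)"
    unfolding averaging_kernel_def using s by (intro DERIV_divide) auto
  moreover obtain m where m: "DIM('a) = Suc m" using DIM_positive[where 'a='a] gr0_implies_Suc by blast
  have "((flat' (1 / 4 - ?w s \<bullet> ?w s) * ((2 * (?w s \<bullet> (z - y))) / s\<^sup>2)) * s ^ DIM('a)
        - profile (?w s) * (real DIM('a) * s ^ (DIM('a) - Suc 0))) / (s ^ DIM('a) * s ^ DIM('a)) = kernel_rate y e s z"
    unfolding kernel_rate_def m using s by (simp add: field_simps power2_eq_square)
  ultimately show ?thesis by simp
qed

lemma sum_partial_transport:
  fixes z :: "'a::euclidean_space"
  assumes "s > 0"
  shows "(\<Sum>b\<in>Basis. partial b (transport y e s b) z) = - kernel_rate y e s z"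
proof -
  let ?w = "rescaled y e s z" and ?f = "flat' (1 / 4 - rescaled y e s z \<bullet> rescaled y e s z)"
  have "(\<Sum>b\<in>Basis. partial b (transport y e s b) z) =
     (\<Sum>b\<in>(Basis::'a set). (profile ?w - ?f * 2 / s * ((?w \<bullet> b) * ((z - y) \<bullet> b))) / s ^ Suc (DIM('a)))"
    by (intro sum.cong refl) (simp add: partial_transport assms)
  also have "\<dots> = (real DIM('a) * profile ?w - ?f * 2 / s * (?w \<bullet> (z - y))) / s ^ Suc (DIM('a))"
    by (subst euclidean_inner[of ?w]) (simp only: sum_divide_distrib[symmetric] sum_subtractf sum_distrib_left[symmetric] sum_constant)
  also have "\<dots> = - kernel_rate y e s z"
    unfolding kernel_rate_def minus_divide_left minus_diff_eq by (simp add: mult.assoc)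
  finally show ?thesis .
qed

lemma continuous_kernel_rate:
  "continuous_on ({0<..} \<times> UNIV) (\<lambda>(s, z). kernel_rate y e s z)"
  unfolding kernel_rate_def profile_def rescaled_def split_beta
  by (intro continuous_intros continuous_on_compose2[OF continuous_flat']
      continuous_on_compose2[OF smooth_continuous[OF smooth_flat]]) auto

lemma continuous_kernel: "continuous_on UNIV (averaging_kernel y e s)"
proof (cases "s = 0")
  case False
  then show ?thesis unfolding averaging_kernel_def[abs_def]
    by (intro continuous_on_divide smooth_continuous[OF smooth_profile_rescaled] continuous_on_const) simp
qed (simp add: averaging_kernel_def[abs_def] power_0_left)

lemma kernel_eq_0: "s > 0 \<Longrightarrow> z \<notin> cball (y + s *\<^sub>R e) (s / 2) \<Longrightarrow> averaging_kernel y e s z = 0"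
  by (simp add: averaging_kernel_def profile_rescaled_eq_0 del: mem_cball)

lemma transport_eq_0: "s > 0 \<Longrightarrow> z \<notin> cball (y + s *\<^sub>R e) (s / 2) \<Longrightarrow> transport y e s b z = 0"
  by (simp add: transport_def profile_rescaled_eq_0 del: mem_cball)

text \<open>
  On the support \<open>z - y\<close> has length at most \<open>s/2 + s\<close>, since the centre is within distance \<open>s\<close> of \<open>y\<close>.
\<close>

lemma transport_bound:
  fixes z :: "'a::euclidean_space"
  assumes s: "s > 0" and e: "norm e \<le> 1" and b: "b \<in> Basis"
  shows "\<bar>transport y e s b z\<bar> \<le> 3 / 2 / s ^ DIM('a)"
proof (cases "z \<in> cball (y + s *\<^sub>R e) (s / 2)")
  case True
  have "norm (z - y) \<le> norm (z - (y + s *\<^sub>R e)) + norm (s *\<^sub>R e)"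
    using norm_triangle_ineq[of "z - (y + s *\<^sub>R e)" "s *\<^sub>R e"] by simp
  also have "\<dots> \<le> s / 2 + s"
    using True s e by (intro add_mono) (auto simp: dist_norm norm_minus_commute)
  finally have "\<bar>(z - y) \<bullet> b\<bar> \<le> 3 / 2 * s" using Basis_le_norm[OF b, of "z - y"] by simp
  then have "profile (rescaled y e s z) * \<bar>(z - y) \<bullet> b\<bar> \<le> 1 * (3 / 2 * s)"
    by (intro mult_mono profile_le_1) auto
  then have "profile (rescaled y e s z) * \<bar>(z - y) \<bullet> b\<bar> / s ^ Suc (DIM('a)) \<le> (3 / 2 * s) / s ^ Suc (DIM('a))"
    using s by (intro divide_right_mono) auto
  also have "\<dots> = 3 / 2 / s ^ DIM('a)" using s by simp
  finally show ?thesis using s by (simp add: transport_def abs_mult profile_nonneg)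
qed (use s in \<open>simp add: transport_eq_0 del: mem_cball\<close>)

text \<open>
  The substitution \<open>z = (y + s e) + s w\<close>.
\<close>

lemma integral_kernel:
  fixes y e :: "'a::euclidean_space"
  assumes s: "s > 0"
  shows "integral\<^sup>L lborel (averaging_kernel y e s) = integral\<^sup>L lborel (profile :: 'a \<Rightarrow> real)"
proof -
  define T where "T w = (y + s *\<^sub>R e) + s *\<^sub>R w" for w
  have m: "averaging_kernel y e s \<in> borel_measurable borel"
    using continuous_kernel by (rule borel_measurable_continuous_onI)
  have mT: "T \<in> lborel \<rightarrow>\<^sub>M borel"
    unfolding T_def by (simp add: borel_measurable_continuous_onI continuous_intros)
  have r: "rescaled y e s (T w) = w" for w using s by (simp add: rescaled_def T_def algebra_simps)
  have "integral\<^sup>L lborel (averaging_kernel y e s) =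
      integral\<^sup>L (density (distr lborel borel T) (\<lambda>_. ennreal (\<bar>s\<bar> ^ DIM('a)))) (averaging_kernel y e s)"
    using lborel_affine[of s "y + s *\<^sub>R e"] s unfolding T_def by (simp add: ennreal_power[symmetric])
  also have "\<dots> = (\<integral>z. \<bar>s\<bar> ^ DIM('a) *\<^sub>R averaging_kernel y e s z \<partial>distr lborel borel T)"
    using m by (intro integral_density) auto
  also have "\<dots> = (\<integral>w. \<bar>s\<bar> ^ DIM('a) *\<^sub>R averaging_kernel y e s (T w) \<partial>lborel)"
    using m by (intro integral_distr mT) auto
  also have "\<dots> = integral\<^sup>L lborel (profile :: 'a \<Rightarrow> real)"
    using s by (simp add: averaging_kernel_def r)
  finally show ?thesis .
qed

lemma integral_profile_pos: "integral\<^sup>L lborel (profile :: 'a::euclidean_space \<Rightarrow> real) > 0"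
proof -
  let ?p = "profile :: 'a \<Rightarrow> real"
  have c: "continuous_on UNIV ?p"
    using smooth_continuous[OF smooth_profile_rescaled[of 0 0 1]] by (simp add: rescaled_def)
  have i: "integrable lborel ?p"
    by (rule continuous_compact_support_integrable(1)[OF c compact_cball[of 0 "1/2"]])
       (rule profile_eq_0, simp)
  have "integral\<^sup>L lborel ?p \<noteq> 0"
  proof
    assume "integral\<^sup>L lborel ?p = 0"
    then have "AE x in lborel. ?p x = 0"
      by (subst (asm) integral_nonneg_eq_0_iff_AE[OF i]) (simp_all add: profile_nonneg)
    moreover have "?p x > 0" if "x \<in> ball 0 (1/2)" for x
    proof -
      have "(norm x)\<^sup>2 < (1 / 2)\<^sup>2" using that by (intro power_strict_mono) auto
      then have "x \<bullet> x < (1 / 2)\<^sup>2" unfolding power2_norm_eq_inner .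
      then show ?thesis unfolding profile_def by (intro flat_pos) (simp add: power2_eq_square)
    qed
    ultimately have "AE x in lborel. x \<notin> ball (0::'a) (1/2)" by (force elim!: eventually_mono)
    then have "emeasure lborel (ball (0::'a) (1/2)) = 0" by (subst (asm) AE_iff_null_sets[symmetric]) auto
    then show False using unit_ball_vol_pos[of "real DIM('a)"] by (simp add: emeasure_ball)
  qed
  moreover have "integral\<^sup>L lborel ?p \<ge> 0" by (intro integral_nonneg_AE) (simp add: profile_nonneg)
  ultimately show ?thesis by simp
qed

section \<open>Morrey's inequality\<close>

lemma test_function_transport:
  "s > 0 \<Longrightarrow> cball (y + s *\<^sub>R e) (s / 2) \<subseteq> U \<Longrightarrow> test_function U (transport y e s b)"
  unfolding test_function_iff
  by (intro conjI smooth_transport exI[of _ "cball (y + s *\<^sub>R e) (s / 2)"] compact_cball allI impI transport_eq_0)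

lemma kernel_rate_eq_0:
  assumes "s > 0" "z \<notin> cball (y + s *\<^sub>R e) (s / 2)"
  shows "kernel_rate y e s z = 0"
proof -
  have "partial b (transport y e s b) z = 0" for b
    by (rule partial_eq_0_outside[OF closed_cball _ assms(2)]) (rule transport_eq_0[OF assms(1)])
  then show ?thesis using sum_partial_transport[OF assms(1), of y e z] by simp
qed

lemma continuous_kernel_rate_at:
  assumes "s > 0" shows "continuous_on UNIV (kernel_rate y e s)"
proof -
  have "continuous_on UNIV (\<lambda>z. (s, z))" by (intro continuous_intros)
  from continuous_on_compose2[OF continuous_kernel_rate this, of y e] show ?thesis
    using assms by auto
qed

lemma cball_support_subset:
  fixes y e :: "'a::euclidean_space"
  assumes "s > 0" "norm e \<le> 1"
  shows "cball (y + s *\<^sub>R e) (s / 2) \<subseteq> cball y (3 / 2 * s)"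
proof
  fix z assume "z \<in> cball (y + s *\<^sub>R e) (s / 2)"
  then have "dist z (y + s *\<^sub>R e) \<le> s / 2" by (simp add: dist_commute)
  moreover have "dist (y + s *\<^sub>R e) y \<le> s" using assms by (simp add: dist_norm)
  ultimately have "dist z y \<le> 3 / 2 * s" using dist_triangle[of z y "y + s *\<^sub>R e"] by linarith
  then show "z \<in> cball y (3 / 2 * s)" by (simp add: dist_commute)
qed

lemma integral_cbox_eq_lborel:
  fixes F :: "'a::euclidean_space \<Rightarrow> real"
  assumes "continuous_on UNIV F" "compact K" "K \<subseteq> cbox a b" "\<And>x. x \<notin> K \<Longrightarrow> F x = 0"
  shows "integral (cbox a b) F = integral\<^sup>L lborel F"
proof -
  have "(\<lambda>x. if x \<in> cbox a b then F x else 0) = F" using assms(3,4) by fastforce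
  then have "integral (cbox a b) F = integral UNIV F"
    using integral_restrict_UNIV[of "cbox a b" F] by simp
  also have "\<dots> = integral\<^sup>L lborel F"
    by (rule integral_lborel[OF continuous_compact_support_integrable(1)[OF assms(1,2,4)]])
  finally show ?thesis .
qed

lemma average_has_derivative:
  fixes v :: "'a::euclidean_space \<Rightarrow> real"
  assumes v: "continuous_on UNIV v" and s: "s > 0" and e: "norm e \<le> 1"
  shows "((\<lambda>s. \<integral>z. v z * averaging_kernel y e s z \<partial>lborel) has_real_derivative
      (\<integral>z. v z * kernel_rate y e s z \<partial>lborel)) (at s)"
proof -
  obtain a where a: "cball y (3 * s) \<subseteq> cbox (- a) a"
    using bounded_subset_cbox_symmetric[OF bounded_cball] by blast
  let ?S = "{0<..<2 * s}"
  have D: "cball (y + t *\<^sub>R e) (t / 2) \<subseteq> cbox (- a) a" if "t \<in> ?S" for t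
  proof -
    have "cball (y + t *\<^sub>R e) (t / 2) \<subseteq> cball y (3 / 2 * t)"
      using that e by (intro cball_support_subset) auto
    also have "\<dots> \<subseteq> cball y (3 * s)" using that by (intro subset_cball) auto
    finally show ?thesis using a by blast
  qed
  \<comment> \<open>Integrals over a box, as differentiation under the integral sign needs a compact domain.\<close>
  have eq: "integral (cbox (- a) a) (\<lambda>z. v z * averaging_kernel y e t z) = (\<integral>z. v z * averaging_kernel y e t z \<partial>lborel)"
    if "t \<in> ?S" for t
    by (rule integral_cbox_eq_lborel[OF _ compact_cball D[OF that]])
       (use that kernel_eq_0[of t _ y e] in \<open>auto intro!: continuous_on_mult v continuous_kernel simp del: mem_cball\<close>)
  have eq': "integral (cbox (- a) a) (\<lambda>z. v z * kernel_rate y e s z) = (\<integral>z. v z * kernel_rate y e s z \<partial>lborel)"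
    by (rule integral_cbox_eq_lborel[OF _ compact_cball D])
       (use s kernel_rate_eq_0[of s _ y e] in \<open>auto intro!: continuous_on_mult v continuous_kernel_rate_at simp del: mem_cball\<close>)
  have "((\<lambda>t. integral (cbox (- a) a) (\<lambda>z. v z * averaging_kernel y e t z)) has_field_derivative
      integral (cbox (- a) a) (\<lambda>z. v z * kernel_rate y e s z)) (at s within ?S)"
  proof (rule leibniz_rule_field_derivative)
    fix t z assume "t \<in> ?S"
    then show "((\<lambda>t. v z * averaging_kernel y e t z) has_real_derivative v z * kernel_rate y e t z) (at t within ?S)"
      by (intro DERIV_cmult has_field_derivative_at_within[OF kernel_has_rate]) simp
  next
    fix t assume "t \<in> ?S"
    show "(\<lambda>z. v z * averaging_kernel y e t z) integrable_on cbox (- a) a"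
      by (rule integrable_continuous, rule continuous_on_subset[OF _ subset_UNIV])
         (rule continuous_on_mult[OF v continuous_kernel])
  next
    have "continuous_on (?S \<times> cbox (- a) a) (\<lambda>x. v (snd x))"
      by (rule continuous_on_compose2[OF v continuous_on_snd[OF continuous_on_id]]) auto
    moreover have "continuous_on (?S \<times> cbox (- a) a) (\<lambda>x. kernel_rate y e (fst x) (snd x))"
      by (rule continuous_on_subset[OF continuous_kernel_rate[unfolded split_beta]]) auto
    ultimately show "continuous_on (?S \<times> cbox (- a) a) (\<lambda>(t, z). v z * kernel_rate y e t z)"
      unfolding split_beta by (rule continuous_on_mult)
  qed (use s in auto)
  then have "((\<lambda>t. integral (cbox (- a) a) (\<lambda>z. v z * averaging_kernel y e t z)) has_field_derivative
      (\<integral>z. v z * kernel_rate y e s z \<partial>lborel)) (at s)"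
    using s by (simp add: at_within_open[of s ?S] eq')
  then show ?thesis
    by (rule has_field_derivative_transform_within_open[where S = ?S]) (use s eq in auto)
qed

text \<open>
  The rate of change of the kernel is minus a divergence of test functions, so the definition of the weak gradient
  applies to each component.
\<close>

lemma average_rate_eq_gradient_integral:
  fixes v :: "'a::euclidean_space \<Rightarrow> real"
  assumes v: "continuous_on UNIV v" and w: "has_weak_gradient U v g"
    and s: "s > 0" and D: "cball (y + s *\<^sub>R e) (s / 2) \<subseteq> U"
  shows "(\<integral>z. v z * kernel_rate y e s z \<partial>lborel) =
    (\<Sum>b\<in>Basis. \<integral>x\<in>U. (g x \<bullet> b) * transport y e s b x \<partial>lebesgue)"
proof -
  let ?T = "transport y e s"
  have test: "test_function U (?T b)" for b by (rule test_function_transport[OF s D])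
  have c: "continuous_on UNIV (\<lambda>z. v z * partial b (?T b) z)" if "b \<in> Basis" for b
    by (intro continuous_on_mult v smooth_continuous smooth_partial smooth_transport that)
  have p0: "partial b (?T b) x = 0" if "x \<notin> cball (y + s *\<^sub>R e) (s / 2)" for b x
    by (rule partial_eq_0_outside[OF closed_cball transport_eq_0[OF s] that])
  have i: "integrable lebesgue (\<lambda>z. v z * partial b (?T b) z)" if "b \<in> Basis" for b
    by (rule continuous_compact_support_integrable(2)[OF c[OF that] compact_cball[of "y + s *\<^sub>R e" "s / 2"]])
       (simp add: p0 del: mem_cball)
  have "(\<integral>z. v z * kernel_rate y e s z \<partial>lborel) = (\<integral>z. v z * kernel_rate y e s z \<partial>lebesgue)"
    by (rule integral_completion[symmetric])
       (simp add: borel_measurable_continuous_onI continuous_on_mult v continuous_kernel_rate_at[OF s])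
  also have "\<dots> = (\<integral>z. - (\<Sum>b\<in>Basis. v z * partial b (?T b) z) \<partial>lebesgue)"
    by (simp add: sum_distrib_left[symmetric] sum_partial_transport[OF s])
  also have "\<dots> = - (\<integral>z. (\<Sum>b\<in>Basis. v z * partial b (?T b) z) \<partial>lebesgue)" by simp
  also have "\<dots> = (\<Sum>b\<in>Basis. - (\<integral>z. v z * partial b (?T b) z \<partial>lebesgue))"
    by (subst Bochner_Integration.integral_sum) (use i in \<open>simp_all add: sum_negf\<close>)
  also have "\<dots> = (\<Sum>b\<in>Basis. - (\<integral>z\<in>U. v z * partial b (?T b) z \<partial>lebesgue))"
  proof (intro sum.cong refl arg_cong[of _ _ uminus])
    fix b show "(\<integral>z. v z * partial b (?T b) z \<partial>lebesgue) = (\<integral>z\<in>U. v z * partial b (?T b) z \<partial>lebesgue)"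
      unfolding set_lebesgue_integral_def
      by (intro Bochner_Integration.integral_cong) (auto simp: indicator_def test_function_partial_eq_0[OF test])
  qed
  also have "\<dots> = (\<Sum>b\<in>Basis. \<integral>x\<in>U. (g x \<bullet> b) * ?T b x \<partial>lebesgue)"
    by (intro sum.cong refl) (use w test in \<open>simp add: has_weak_gradient_partial\<close>)
  finally show ?thesis .
qed

text \<open>
  Integrating this inequality over a set \<open>D\<close> and choosing \<open>a\<close> well bounds the integral of \<open>t\<close> by the \<open>L\<^sub>q\<close> norm,
  up to a constant as Hoelder's inequality would.
\<close>

lemma le_affine_powr:
  assumes "a > 0" "t \<ge> 0" "q > (1::real)"
  shows "t \<le> a + a powr (1 - q) * t powr q"
proof (cases "t \<le> a")
  case False
  have "1 \<le> (t / a) powr (q - 1)" using False assms by (intro ge_one_powr_ge_zero) auto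
  then have "t * 1 \<le> t * (t / a) powr (q - 1)" using assms by (intro mult_left_mono)
  also have "\<dots> = a powr (1 - q) * (t powr 1 * t powr (q - 1))"
    using assms False by (simp add: powr_divide powr_diff field_simps)
  also have "t powr 1 * t powr (q - 1) = t powr q" by (subst powr_add[symmetric]) simp
  finally show ?thesis using assms(1) by simp
qed (use assms in \<open>simp add: add_increasing2\<close>)

text \<open>
  The field is of size \<open>s ^ (- n)\<close> on a ball of volume of order \<open>s ^ n\<close>, so the integral is at most a multiple of
  the mean of \<open>norm (g x)\<close> on that ball, and the mean is at most \<open>M\<close> times the volume to the power \<open>- 1/q\<close>.
\<close>

lemma transport_integral_bound:
  fixes g :: "'a::euclidean_space \<Rightarrow> 'a"
  assumes s: "s > 0" and e: "norm e \<le> 1" and b: "b \<in> Basis" and D: "cball (y + s *\<^sub>R e) (s / 2) \<subseteq> U"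
    and g: "loc_integrable U g" and M: "M > 0" and q: "q > real DIM('a)"
    and G: "(\<integral>\<^sup>+x\<in>U. ennreal (norm (g x) powr q) \<partial>lebesgue) \<le> ennreal (M powr q)"
  shows "\<bar>\<integral>x\<in>U. (g x \<bullet> b) * transport y e s b x \<partial>lebesgue\<bar>
      \<le> 3 / 2 * (unit_ball_vol (real DIM('a)) + 1) * M * s powr (- real DIM('a) / q)"
proof -
  define n where "n = DIM('a)"
  define D where "D = cball (y + s *\<^sub>R e) (s / 2)"
  have DU: "D \<subseteq> U" using D by (simp add: D_def)
  have q1: "q > 1" using q DIM_positive[where 'a='a] by linarith
  \<comment> \<open>This threshold makes both terms of \<open>le_affine_powr\<close> contribute the same power of \<open>s\<close>.\<close>
  define a where "a = M * s powr (- real n / q)"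
  have a: "a > 0" using M s by (simp add: a_def)
  define c where "c = 3 / 2 / s ^ n"
  have c: "c > 0" using s by (simp add: c_def)
  let ?\<omega> = "unit_ball_vol (real DIM('a))"
  let ?F = "\<lambda>x. indicator U x *\<^sub>R ((g x \<bullet> b) * transport y e s b x)"
  have gD: "integrable lebesgue (\<lambda>x. indicator D x *\<^sub>R g x)"
    using g DU unfolding loc_integrable_def set_integrable_def by (simp add: D_def)
  have iF: "integrable lebesgue ?F"
    using loc_integrable_times_integrable[OF loc_integrable_inner[OF g] smooth_continuous[OF smooth_transport] compact_cball D]
      transport_eq_0[OF s] unfolding set_integrable_def by blast
  have pt: "norm (?F x) \<le> c * (a * indicator D x + a powr (1 - q) * norm (indicator D x *\<^sub>R g x) powr q)" for x
  proof (cases "x \<in> D")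
    case True
    have "norm (?F x) = \<bar>g x \<bullet> b\<bar> * \<bar>transport y e s b x\<bar>" using True DU by (auto simp: abs_mult)
    also have "\<dots> \<le> norm (g x) * c"
      unfolding c_def n_def using transport_bound[OF s e b] Basis_le_norm[OF b] by (intro mult_mono) auto
    also have "\<dots> \<le> (a + a powr (1 - q) * norm (g x) powr q) * c"
      using c a q1 by (intro mult_right_mono le_affine_powr) auto
    finally show ?thesis using True by (simp add: mult.commute)
  next
    case False
    then have "transport y e s b x = 0" using transport_eq_0[OF s] unfolding D_def by blast
    then show ?thesis using c a by simp
  qed
  have Dm: "D \<in> sets lebesgue" by (simp add: D_def)
  have "emeasure lebesgue D = ennreal (?\<omega> * (s / 2) ^ n)"
    unfolding D_def n_def using s by (simp add: emeasure_cball)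
  also have "\<dots> \<le> ennreal (?\<omega> * s ^ n)"
    using s by (intro ennreal_leI mult_left_mono power_mono) auto
  finally have eD: "emeasure lebesgue D \<le> ennreal (?\<omega> * s ^ n)" .
  have m: "(\<lambda>x. norm (indicator D x *\<^sub>R g x) powr q) \<in> borel_measurable lebesgue"
    using borel_measurable_integrable[OF gD] by measurable
  have "(\<integral>\<^sup>+x. ennreal (norm (indicator D x *\<^sub>R g x) powr q) \<partial>lebesgue)
      \<le> (\<integral>\<^sup>+x\<in>U. ennreal (norm (g x) powr q) \<partial>lebesgue)"
    using DU q1 by (intro nn_integral_mono) (auto simp: indicator_def)
  then have gq: "(\<integral>\<^sup>+x. ennreal (norm (indicator D x *\<^sub>R g x) powr q) \<partial>lebesgue) \<le> ennreal (M powr q)"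
    using G by (rule order_trans)
  have "ennreal (norm (integral\<^sup>L lebesgue ?F)) \<le> (\<integral>\<^sup>+x. ennreal (norm (?F x)) \<partial>lebesgue)"
    by (rule integral_norm_bound_ennreal[OF iF])
  also have "\<dots> \<le> (\<integral>\<^sup>+x. ennreal c * (ennreal a * indicator D x +
      ennreal (a powr (1 - q)) * ennreal (norm (indicator D x *\<^sub>R g x) powr q)) \<partial>lebesgue)"
  proof (rule nn_integral_mono)
    fix x
    have "ennreal (norm (?F x)) \<le> ennreal (c * (a * indicator D x + a powr (1 - q) * norm (indicator D x *\<^sub>R g x) powr q))"
      by (rule ennreal_leI[OF pt])
    also have "\<dots> = ennreal c * (ennreal a * indicator D x +
      ennreal (a powr (1 - q)) * ennreal (norm (indicator D x *\<^sub>R g x) powr q))"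
      using c a by (simp add: ennreal_mult ennreal_plus indicator_def)
    finally show "ennreal (norm (?F x)) \<le> ennreal c * (ennreal a * indicator D x +
      ennreal (a powr (1 - q)) * ennreal (norm (indicator D x *\<^sub>R g x) powr q))" .
  qed
  also have "\<dots> = ennreal c * (ennreal a * emeasure lebesgue D +
      ennreal (a powr (1 - q)) * (\<integral>\<^sup>+x. ennreal (norm (indicator D x *\<^sub>R g x) powr q) \<partial>lebesgue))"
    using Dm m by (simp add: nn_integral_cmult nn_integral_add)
  also have "\<dots> \<le> ennreal c * (ennreal a * ennreal (?\<omega> * s ^ n) + ennreal (a powr (1 - q)) * ennreal (M powr q))"
    by (intro mult_left_mono add_mono eD gq) auto
  also have "\<dots> = ennreal (c * (a * (?\<omega> * s ^ n) + a powr (1 - q) * M powr q))"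
    using c a s by (simp add: ennreal_mult ennreal_plus)
  also have "c * (a * (?\<omega> * s ^ n) + a powr (1 - q) * M powr q) = 3 / 2 * (?\<omega> + 1) * a"
  proof -
    have "a powr (1 - q) * M powr q = M powr (1 - q) * M powr q * s powr (- real n / q * (1 - q))"
      using M s by (simp add: a_def powr_mult powr_powr)
    also have "M powr (1 - q) * M powr q = M" using M by (simp add: powr_add[symmetric])
    also have "- real n / q * (1 - q) = - real n / q + real n" using q1 by (simp add: field_simps)
    also have "M * s powr (- real n / q + real n) = a * s ^ n"
      unfolding a_def powr_add using s by (simp add: powr_realpow)
    finally show ?thesis using s by (simp add: c_def field_simps)
  qed
  finally have "norm (integral\<^sup>L lebesgue ?F) \<le> 3 / 2 * (?\<omega> + 1) * a"
    using a by (subst (asm) ennreal_le_iff) auto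
  then show ?thesis by (simp add: a_def n_def set_lebesgue_integral_def mult.assoc)
qed

lemma average_tendsto:
  fixes v :: "'a::euclidean_space \<Rightarrow> real"
  assumes v: "continuous_on UNIV v" and e: "norm e \<le> 1"
  shows "((\<lambda>s. \<integral>z. v z * averaging_kernel y e s z \<partial>lborel) \<longlongrightarrow> v y * integral\<^sup>L lborel (profile :: 'a \<Rightarrow> real)) (at_right 0)"
proof (rule tendstoI)
  define I where "I = integral\<^sup>L lborel (profile :: 'a \<Rightarrow> real)"
  have I: "I > 0" unfolding I_def by (rule integral_profile_pos)
  fix \<epsilon> :: real assume "\<epsilon> > 0"
  then have \<delta>: "\<epsilon> / (2 * I) > 0" using I by simp
  have "isCont v y" using v by (simp add: continuous_on_eq_continuous_at)
  then obtain d where d: "d > 0" "\<And>z. dist z y < d \<Longrightarrow> dist (v z) (v y) < \<epsilon> / (2 * I)"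
    using \<delta> unfolding continuous_at_eps_delta by metis
  have "dist (\<integral>z. v z * averaging_kernel y e s z \<partial>lborel) (v y * I) < \<epsilon>" if s: "0 < s" "s < d / 2" for s
  proof -
    let ?D = "cball (y + s *\<^sub>R e) (s / 2)"
    have k0: "averaging_kernel y e s z \<ge> 0" for z using s by (simp add: averaging_kernel_def profile_nonneg)
    have kI: "integrable lborel (averaging_kernel y e s)"
      by (rule continuous_compact_support_integrable(1)[OF continuous_kernel compact_cball kernel_eq_0[OF s(1)]])
    have vI: "integrable lborel (\<lambda>z. v z * averaging_kernel y e s z)"
      by (rule continuous_compact_support_integrable(1)[OF continuous_on_mult[OF v continuous_kernel] compact_cball[of "y + s *\<^sub>R e" "s / 2"]])
         (simp add: kernel_eq_0[OF s(1)] del: mem_cball)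
    have "(\<integral>z. v z * averaging_kernel y e s z \<partial>lborel) - v y * I = (\<integral>z. (v z - v y) * averaging_kernel y e s z \<partial>lborel)"
      unfolding I_def integral_kernel[OF s(1), symmetric, of y e] using kI vI by (simp add: left_diff_distrib)
    also have "norm \<dots> \<le> (\<integral>z. \<epsilon> / (2 * I) * averaging_kernel y e s z \<partial>lborel)"
    proof (rule Bochner_Integration.integral_norm_bound_integral)
      show "integrable lborel (\<lambda>z. (v z - v y) * averaging_kernel y e s z)"
        using kI vI by (simp add: left_diff_distrib)
      show "integrable lborel (\<lambda>z. \<epsilon> / (2 * I) * averaging_kernel y e s z)" using kI by simp
      fix z
      show "norm ((v z - v y) * averaging_kernel y e s z) \<le> \<epsilon> / (2 * I) * averaging_kernel y e s z"
      proof (cases "z \<in> ?D")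
        case True
        then have "z \<in> cball y (3 / 2 * s)" using cball_support_subset[OF s(1) e] by blast
        then have "dist z y < d" using s by (simp add: dist_commute)
        then have "\<bar>v z - v y\<bar> \<le> \<epsilon> / (2 * I)" using d(2)[of z] by (simp add: dist_real_def)
        from mult_right_mono[OF this k0[of z]] show ?thesis using k0[of z] by (simp add: abs_mult)
      qed (simp add: kernel_eq_0[OF s(1)] del: mem_cball)
    qed
    also have "\<dots> = \<epsilon> / 2"
      using I integral_kernel[OF s(1), of y e] by (simp add: I_def[symmetric])
    finally show ?thesis using \<open>\<epsilon> > 0\<close> by (simp add: dist_real_def)
  qed
  moreover have "\<forall>\<^sub>F s in at_right 0. 0 < s \<and> s < d / 2"
    using d(1) by (auto simp: eventually_at_right_field intro!: exI[of _ "d / 2"])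
  ultimately show "\<forall>\<^sub>F s in at_right 0. dist (\<integral>z. v z * averaging_kernel y e s z \<partial>lborel)
      (v y * integral\<^sup>L lborel (profile :: 'a \<Rightarrow> real)) < \<epsilon>"
    unfolding I_def by (auto elim!: eventually_mono)
qed

text \<open>
  The kernels of width \<open>s\<close> about \<open>y + s e\<close> with \<open>e = (x0 - y)/r\<close> stay inside the ball about \<open>x0\<close>. At
  \<open>s = r\<close> the kernel is centred at \<open>x0\<close> and no longer depends on \<open>y\<close>; as \<open>s\<close> tends to \<open>0\<close> the average tends to
  a multiple of \<open>v y\<close>. In between, the average changes by at most the integral of a multiple of
  \<open>s powr (- n/q)\<close>.
\<close>

lemma average_difference_bound:
  fixes v :: "'a::euclidean_space \<Rightarrow> real"
  assumes v: "continuous_on UNIV v" and w: "has_weak_gradient (ball x0 r) v g"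
    and r: "r > 0" and y: "dist x0 y \<le> r" and M: "M > 0" and q: "q > real DIM('a)"
    and G: "(\<integral>\<^sup>+x\<in>ball x0 r. ennreal (norm (g x) powr q) \<partial>lebesgue) \<le> ennreal (M powr q)"
  shows "\<bar>(\<integral>z. v z * averaging_kernel x0 0 r z \<partial>lborel) - v y * integral\<^sup>L lborel (profile :: 'a \<Rightarrow> real)\<bar>
    \<le> real DIM('a) * (3 / 2) * (unit_ball_vol (real DIM('a)) + 1) / (1 - real DIM('a) / q) * M * r powr (1 - real DIM('a) / q)"
proof -
  \<comment> \<open>With this drift the centre \<open>y + s e\<close> reaches \<open>x0\<close> at \<open>s = r\<close>.\<close>
  define e where "e = (1 / r) *\<^sub>R (x0 - y)"
  define A where "A s = (\<integral>z. v z * averaging_kernel y e s z \<partial>lborel)" for s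
  define A' where "A' s = (\<integral>z. v z * kernel_rate y e s z \<partial>lborel)" for s
  define \<alpha> where "\<alpha> = 1 - real DIM('a) / q"
  have \<alpha>: "\<alpha> > 0" using q by (simp add: \<alpha>_def field_simps)
  define C where "C = real DIM('a) * (3 / 2) * (unit_ball_vol (real DIM('a)) + 1)"
  \<comment> \<open>A primitive of the bound for the rate of change; it vanishes at \<open>0\<close> since \<open>\<alpha> > 0\<close>.\<close>
  define G where "G s = C / \<alpha> * M * s powr \<alpha>" for s
  have e: "norm e \<le> 1" using y r by (simp add: e_def dist_norm)
  have D: "cball (y + s *\<^sub>R e) (s / 2) \<subseteq> ball x0 r" if s: "0 < s" "s \<le> r" for s
  proof
    fix z assume "z \<in> cball (y + s *\<^sub>R e) (s / 2)"
    then have "dist (y + s *\<^sub>R e) z \<le> s / 2" by simp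
    moreover have "x0 - (y + s *\<^sub>R e) = (1 - s / r) *\<^sub>R (x0 - y)" by (simp add: e_def algebra_simps)
    then have "dist x0 (y + s *\<^sub>R e) = (1 - s / r) * dist x0 y" using s r by (simp add: dist_norm)
    moreover have "(1 - s / r) * dist x0 y \<le> (1 - s / r) * r" using s r y by (intro mult_left_mono) auto
    moreover have "(1 - s / r) * r = r - s" using r by (simp add: field_simps)
    ultimately show "z \<in> ball x0 r" using dist_triangle[of x0 z "y + s *\<^sub>R e"] s by simp
  qed
  have A: "(A has_real_derivative A' s) (at s)" if "0 < s" for s
    unfolding A_def A'_def by (rule average_has_derivative[OF v that e])
  have A'_bound: "\<bar>A' s\<bar> \<le> C * M * s powr (\<alpha> - 1)" if s: "0 < s" "s \<le> r" for s
  proof -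
    have "\<bar>A' s\<bar> = \<bar>\<Sum>b\<in>Basis. \<integral>x\<in>ball x0 r. (g x \<bullet> b) * transport y e s b x \<partial>lebesgue\<bar>"
      unfolding A'_def by (subst average_rate_eq_gradient_integral[OF v w s(1) D[OF s]]) simp
    also have "\<dots> \<le> (\<Sum>b\<in>(Basis::'a set). 3 / 2 * (unit_ball_vol (real DIM('a)) + 1) * M * s powr (- real DIM('a) / q))"
      by (rule order_trans[OF sum_abs], intro sum_mono transport_integral_bound[OF s(1) e _ D[OF s] _ M q G])
         (use w in \<open>simp_all add: has_weak_gradient_def\<close>)
    also have "\<dots> = C * M * s powr (\<alpha> - 1)" by (simp add: C_def \<alpha>_def)
    finally show ?thesis .
  qed
  have G': "(G has_real_derivative C * M * s powr (\<alpha> - 1)) (at s)" if "0 < s" for s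
    unfolding G_def using that \<alpha> by (auto intro!: derivative_eq_intros)
  have diff: "\<bar>A r - A s\<bar> \<le> G r" if s: "0 < s" "s < r" for s
  proof -
    have C0: "C \<ge> 0" unfolding C_def by simp
    have G0: "G s \<ge> 0" unfolding G_def using \<alpha> M C0 by simp
    have "G s - A s \<le> G r - A r"
    proof (rule DERIV_nonneg_imp_nondecreasing[OF less_imp_le[OF s(2)]])
      fix t assume t: "s \<le> t" "t \<le> r"
      then have "((\<lambda>s. G s - A s) has_real_derivative C * M * t powr (\<alpha> - 1) - A' t) (at t)"
        using s by (intro DERIV_diff G' A) auto
      moreover have "0 \<le> C * M * t powr (\<alpha> - 1) - A' t"
        using A'_bound[of t] s t by (simp add: abs_le_iff)
      ultimately show "\<exists>d. ((\<lambda>s. G s - A s) has_real_derivative d) (at t) \<and> 0 \<le> d" by blast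
    qed
    moreover have "G s + A s \<le> G r + A r"
    proof (rule DERIV_nonneg_imp_nondecreasing[OF less_imp_le[OF s(2)]])
      fix t assume t: "s \<le> t" "t \<le> r"
      then have "((\<lambda>s. G s + A s) has_real_derivative C * M * t powr (\<alpha> - 1) + A' t) (at t)"
        using s by (intro DERIV_add G' A) auto
      moreover have "0 \<le> C * M * t powr (\<alpha> - 1) + A' t"
        using A'_bound[of t] s t by (simp add: abs_le_iff)
      ultimately show "\<exists>d. ((\<lambda>s. G s + A s) has_real_derivative d) (at t) \<and> 0 \<le> d" by blast
    qed
    ultimately show ?thesis using G0 by linarith
  qed
  let ?L = "v y * integral\<^sup>L lborel (profile :: 'a \<Rightarrow> real)"
  have "((\<lambda>s. \<bar>A r - A s\<bar>) \<longlongrightarrow> \<bar>A r - ?L\<bar>) (at_right 0)"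
    unfolding A_def by (intro tendsto_intros average_tendsto[OF v e])
  moreover have "\<forall>\<^sub>F s in at_right 0. \<bar>A r - A s\<bar> \<le> G r"
    using diff r by (auto simp: eventually_at_right_field intro!: exI[of _ r])
  ultimately have "\<bar>A r - ?L\<bar> \<le> G r"
    by (rule tendsto_upperbound) simp
  moreover have "averaging_kernel y e r = averaging_kernel x0 0 r"
  proof
    fix z
    have "rescaled y e r z = rescaled x0 0 r z"
      by (simp add: rescaled_def e_def scaleR_diff_right[symmetric])
    then show "averaging_kernel y e r z = averaging_kernel x0 0 r z" by (simp add: averaging_kernel_def)
  qed
  ultimately show ?thesis unfolding A_def G_def C_def \<alpha>_def by simp
qed

text \<open>
  The values at \<open>y\<close> and at \<open>x0\<close> are compared with the same average over the ball.
\<close>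

lemma Morrey_inequality:
  assumes q: "q > real DIM('a::euclidean_space)"
  obtains C where "C > 0" and "\<And>(v::'a \<Rightarrow> real) g x0 y r M.
    continuous_on UNIV v \<Longrightarrow> has_weak_gradient (ball x0 r) v g \<Longrightarrow> r > 0 \<Longrightarrow> dist x0 y \<le> r \<Longrightarrow> M > 0 \<Longrightarrow>
    (\<integral>\<^sup>+x\<in>ball x0 r. ennreal (norm (g x) powr q) \<partial>lebesgue) \<le> ennreal (M powr q) \<Longrightarrow>
    \<bar>v y - v x0\<bar> \<le> C * M * r powr (1 - real DIM('a) / q)"
proof -
  define I where "I = integral\<^sup>L lborel (profile :: 'a \<Rightarrow> real)"
  have I: "I > 0" unfolding I_def by (rule integral_profile_pos)
  define C where "C = real DIM('a) * (3 / 2) * (unit_ball_vol (real DIM('a)) + 1) / (1 - real DIM('a) / q)"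
  have "1 - real DIM('a) / q > 0" using q by (simp add: field_simps)
  moreover have "unit_ball_vol (real DIM('a)) + 1 > 0" by (intro add_pos_pos) simp_all
  ultimately have C: "C > 0" unfolding C_def by (intro divide_pos_pos mult_pos_pos) auto
  show ?thesis
  proof (rule that[of "2 * C / I"])
    show "2 * C / I > 0" using C I by simp
    fix v :: "'a \<Rightarrow> real" and g x0 y r M
    assume h: "continuous_on UNIV v" "has_weak_gradient (ball x0 r) v g" "r > 0" "dist x0 y \<le> r" "M > 0"
      "(\<integral>\<^sup>+x\<in>ball x0 r. ennreal (norm (g x) powr q) \<partial>lebesgue) \<le> ennreal (M powr q)"
    define A where "A = (\<integral>z. v z * averaging_kernel x0 0 r z \<partial>lborel)"
    define B where "B = C * M * r powr (1 - real DIM('a) / q)"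
    have "\<bar>A - v y * I\<bar> \<le> B"
      using average_difference_bound[OF h(1-5) q h(6)] unfolding A_def B_def C_def I_def .
    moreover have "\<bar>A - v x0 * I\<bar> \<le> B"
      using average_difference_bound[OF h(1-3) _ h(5) q h(6), of x0] h(3) unfolding A_def B_def C_def I_def by simp
    ultimately have "\<bar>v y * I - v x0 * I\<bar> \<le> 2 * B" by linarith
    also have "\<bar>v y * I - v x0 * I\<bar> = \<bar>v y - v x0\<bar> * I"
      using I by (simp add: left_diff_distrib[symmetric] abs_mult)
    finally show "\<bar>v y - v x0\<bar> \<le> 2 * C / I * M * r powr (1 - real DIM('a) / q)"
      using I by (simp add: B_def field_simps)
  qed
qed

section \<open>Oscillating test functions\<close>

text \<open>
  One period of the wave. The constants are \<open>81/400 = (9/20)\<^sup>2\<close> and \<open>9/80 = (9/20)\<^sup>2 - (3/10)\<^sup>2\<close>: the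
  function equals \<open>t\<close> for \<open>\<bar>t\<bar> \<le> 3/10\<close> and vanishes for \<open>\<bar>t\<bar> \<ge> 9/20\<close>. As \<open>3/10 > 1/4\<close>, the intervals of slope \<open>1\<close>
  about the integers and about the half-integers together cover the line; as \<open>9/20 < 1/2\<close>, integer translates have
  disjoint supports.
\<close>

definition tooth :: "real \<Rightarrow> real" where
  "tooth t = t * smooth_step ((81 / 400 - t\<^sup>2) / (9 / 80))"

lemma smooth_tooth: "smooth tooth"
  unfolding tooth_def[abs_def] by (intro smooth_intros smooth_compose[OF smooth_smooth_step])

lemma tooth_eq_0: "\<bar>t\<bar> \<ge> 9 / 20 \<Longrightarrow> tooth t = 0"
proof -
  assume "\<bar>t\<bar> \<ge> 9 / 20"
  then have "(9 / 20)\<^sup>2 \<le> \<bar>t\<bar>\<^sup>2" by (intro power_mono) auto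
  then show ?thesis by (simp add: tooth_def smooth_step_eq_0 power2_eq_square)
qed

lemma tooth_eq_self: "\<bar>t\<bar> \<le> 3 / 10 \<Longrightarrow> tooth t = t"
proof -
  assume "\<bar>t\<bar> \<le> 3 / 10"
  then have "\<bar>t\<bar>\<^sup>2 \<le> (3 / 10)\<^sup>2" by (intro power_mono) auto
  then show ?thesis by (simp add: tooth_def smooth_step_eq_1 power2_eq_square)
qed

lemma tooth_bound: "\<bar>tooth t\<bar> \<le> 1 / 2"
proof (cases "\<bar>t\<bar> \<ge> 9 / 20")
  case False
  have "\<bar>tooth t\<bar> \<le> \<bar>t\<bar> * 1"
    unfolding tooth_def abs_mult using smooth_step_bounds by (intro mult_left_mono) auto
  then show ?thesis using False by simp
qed (simp add: tooth_eq_0)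

lemma tooth_derivative_eq_0: "\<bar>t\<bar> \<ge> 1 / 2 \<Longrightarrow> partial 1 tooth t = 0"
  by (rule partial_eq_0_outside[of "cball 0 (9 / 20)"]) (auto simp: tooth_eq_0)

lemma tooth_derivative_bounded: obtains C where "C > 0" "\<And>t. \<bar>partial 1 tooth t\<bar> \<le> C"
proof -
  have c: "continuous_on UNIV (partial 1 tooth)"
    by (intro smooth_continuous smooth_partial smooth_tooth) simp
  have z: "partial 1 tooth t = 0" if "t \<notin> cball 0 (1 / 2)" for t
    using that by (intro tooth_derivative_eq_0) simp
  obtain C where "C > 0" "\<And>t. norm (partial 1 tooth t) \<le> C"
    by (rule continuous_compact_support_bounded[OF c compact_cball z]) (assumption, rule that)
  then show ?thesis using that by simp
qed

text \<open>
  At most one integer is closer to \<open>t\<close> than \<open>1/2\<close>.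
\<close>

lemma sum_integer_translates_single:
  fixes F :: "real \<Rightarrow> real"
  assumes F: "\<And>t. \<bar>t\<bar> \<ge> 1 / 2 \<Longrightarrow> F t = 0" and I: "finite I" "k \<in> I" "\<bar>t - of_int k\<bar> < 1 / 2"
  shows "(\<Sum>i\<in>I. F (t - of_int i)) = F (t - of_int k)"
proof -
  have "F (t - of_int i) = 0" if "i \<in> I - {k}" for i
  proof (rule F)
    have "1 \<le> \<bar>i - k\<bar>" using that by auto
    then have "1 \<le> \<bar>real_of_int i - real_of_int k\<bar>" by linarith
    then show "1 / 2 \<le> \<bar>t - real_of_int i\<bar>" using I(3) by linarith
  qed
  then have "(\<Sum>i\<in>I. F (t - of_int i)) = (\<Sum>i\<in>{k}. F (t - of_int i))"
    using I(1,2) by (intro sum.mono_neutral_right) auto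
  then show ?thesis by simp
qed

lemma sum_integer_translates_bound:
  fixes F :: "real \<Rightarrow> real"
  assumes F: "\<And>t. \<bar>t\<bar> \<ge> 1 / 2 \<Longrightarrow> F t = 0" and C: "\<And>t. \<bar>F t\<bar> \<le> C" and I: "finite I"
  shows "\<bar>\<Sum>i\<in>I. F (t - of_int i)\<bar> \<le> C"
proof (cases "\<exists>k\<in>I. \<bar>t - of_int k\<bar> < 1 / 2")
  case True
  then obtain k where "k \<in> I" "\<bar>t - of_int k\<bar> < 1 / 2" by blast
  then show ?thesis using sum_integer_translates_single[of F I k t, OF F I] C by simp
next
  case False
  then have "(\<Sum>i\<in>I. F (t - of_int i)) = 0" by (intro sum.neutral ballI F) (simp add: not_less)
  then show ?thesis using C[of 0] by simp
qed

text \<open>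
  A finite piece of the periodic wave. The variable ranges over a bounded set in the application, and a finite
  sum is plainly smooth.
\<close>

definition sawtooth :: "int set \<Rightarrow> real \<Rightarrow> real" where
  "sawtooth I t = (\<Sum>k\<in>I. tooth (t - of_int k))"

lemma smooth_sawtooth: "smooth (sawtooth I)"
  unfolding sawtooth_def[abs_def] by (intro smooth_intros smooth_compose[OF smooth_tooth])

lemma sawtooth_bound: "finite I \<Longrightarrow> \<bar>sawtooth I t\<bar> \<le> 1 / 2"
  unfolding sawtooth_def by (rule sum_integer_translates_bound[OF _ tooth_bound]) (simp_all add: tooth_eq_0)

lemma sawtooth_eq:
  assumes "finite I" "k \<in> I" "\<bar>t - of_int k\<bar> \<le> 3 / 10"
  shows "sawtooth I t = t - of_int k"
  unfolding sawtooth_def using assms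
  by (subst sum_integer_translates_single[of tooth I k t]) (simp_all add: tooth_eq_0 tooth_eq_self)

lemma sawtooth_derivative_bound:
  assumes "finite I" "\<And>t. \<bar>partial 1 tooth t\<bar> \<le> C"
  shows "\<bar>partial 1 (sawtooth I) t\<bar> \<le> C"
proof -
  have "((\<lambda>t. \<Sum>k\<in>I. tooth (t - of_int k)) has_real_derivative (\<Sum>k\<in>I. partial 1 tooth (t - of_int k))) (at t)"
  proof (rule DERIV_sum)
    fix k :: int
    have "((\<lambda>t. t - of_int k) has_real_derivative 1) (at t)" by (auto intro!: derivative_eq_intros)
    from DERIV_chain2[OF smooth_has_real_derivative[OF smooth_tooth] this]
    show "((\<lambda>t. tooth (t - of_int k)) has_real_derivative partial 1 tooth (t - of_int k)) (at t)" by simp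
  qed
  then have "partial 1 (sawtooth I) t = (\<Sum>k\<in>I. partial 1 tooth (t - of_int k))"
    unfolding sawtooth_def[abs_def] has_field_derivative_def by (simp add: partial_eq)
  then show ?thesis
    using sum_integer_translates_bound[OF tooth_derivative_eq_0 assms(2,1)] by simp
qed

text \<open>
  The wave of period \<open>1/m\<close> in direction \<open>b\<close>, with phase \<open>\<sigma>\<close>, cut off by \<open>\<theta>\<close>.
\<close>

definition wrinkle :: "int set \<Rightarrow> real \<Rightarrow> real \<Rightarrow> 'a::euclidean_space \<Rightarrow> ('a \<Rightarrow> real) \<Rightarrow> 'a \<Rightarrow> real" where
  "wrinkle I m \<sigma> b \<theta> z = sawtooth I (m * (z \<bullet> b) + \<sigma>) / m * \<theta> z"

lemma test_function_wrinkle: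
  assumes "test_function U \<theta>"
  shows "test_function U (wrinkle I m \<sigma> b \<theta>)"
  unfolding wrinkle_def[abs_def]
  by (intro test_function_mult assms smooth_intros smooth_compose[OF smooth_sawtooth])

text \<open>
  Differentiating the wave gives a factor \<open>m\<close> that cancels \<open>1/m\<close>; differentiating the cut-off leaves the amplitude
  \<open>1/(2m)\<close>, and \<open>m\<close> dominates the gradient of \<open>\<theta>\<close>.
\<close>

lemma wrinkle_partial_bound:
  assumes \<theta>: "smooth \<theta>" "\<And>z. 0 \<le> \<theta> z" "\<And>z. \<theta> z \<le> 1" and b: "b \<in> Basis" "b' \<in> Basis"
    and m: "m > 0" "\<bar>partial b' \<theta> z\<bar> \<le> m" and I: "finite I"
    and C: "\<And>t. \<bar>partial 1 tooth t\<bar> \<le> C"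
  shows "\<bar>partial b' (wrinkle I m \<sigma> b \<theta>) z\<bar> \<le> C + 1"
proof -
  let ?t = "m * (z \<bullet> b) + \<sigma>"
  have "((\<lambda>z. m * (z \<bullet> b) + \<sigma>) has_derivative (\<lambda>h. m * (h \<bullet> b))) (at z)"
    by (auto intro!: derivative_eq_intros)
  from has_derivative_compose[OF this smooth_has_real_derivative[OF smooth_sawtooth, unfolded has_field_derivative_def]]
  have "((\<lambda>z. sawtooth I (m * (z \<bullet> b) + \<sigma>)) has_derivative (\<lambda>h. partial 1 (sawtooth I) ?t * (m * (h \<bullet> b)))) (at z)" .
  then have "((\<lambda>z. sawtooth I (m * (z \<bullet> b) + \<sigma>) / m) has_derivative (\<lambda>h. partial 1 (sawtooth I) ?t * (m * (h \<bullet> b)) / m)) (at z)"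
    by (rule bounded_linear.has_derivative[OF bounded_linear_divide])
  from partial_eq[OF has_derivative_mult[OF this smooth_has_derivative[OF \<theta>(1)]], of b']
  have eq: "partial b' (wrinkle I m \<sigma> b \<theta>) z =
      sawtooth I ?t / m * partial b' \<theta> z + partial 1 (sawtooth I) ?t * (b' \<bullet> b) * \<theta> z"
    using m(1) by (simp add: wrinkle_def[abs_def] partial_def)
  have C0: "C \<ge> 0" using C[of 0] by linarith
  have "\<bar>sawtooth I ?t / m * partial b' \<theta> z\<bar> \<le> (1 / 2 / m) * m"
    unfolding abs_mult using sawtooth_bound[OF I, of ?t] m by (intro mult_mono) (auto simp: divide_simps)
  \<comment> \<open>The term from the cut-off costs at most \<open>1\<close>.\<close>
  moreover have "(1 / 2 / m) * m \<le> 1" using m(1) by simp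
  moreover have "\<bar>partial 1 (sawtooth I) ?t * (b' \<bullet> b) * \<theta> z\<bar> \<le> C * 1 * 1"
    unfolding abs_mult using sawtooth_derivative_bound[OF I C] \<theta> b C0
    by (intro mult_mono) (auto simp: inner_Basis)
  ultimately show ?thesis unfolding eq
    using abs_triangle_ineq[of "sawtooth I ?t / m * partial b' \<theta> z" "partial 1 (sawtooth I) ?t * (b' \<bullet> b) * \<theta> z"]
    by linarith
qed

lemma near_integer_or_half_integer:
  fixes t :: real
  obtains k :: int where "\<bar>t - of_int k\<bar> < 3 / 10" "\<bar>of_int k\<bar> \<le> \<bar>t\<bar> + 2"
  | k :: int where "\<bar>t + 1 / 2 - of_int k\<bar> < 3 / 10" "\<bar>of_int k\<bar> \<le> \<bar>t\<bar> + 2"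
proof -
  define j where "j = round t"
  have j: "\<bar>of_int j - t\<bar> \<le> 1 / 2" unfolding j_def by (rule of_int_round_abs_le)
  consider "\<bar>t - of_int j\<bar> < 3 / 10" | "t - of_int j \<le> - (3 / 10)" | "t - of_int j \<ge> 3 / 10" by linarith
  then show ?thesis
  proof cases
    case 1 then show ?thesis using that(1)[of j] j by linarith
  next
    case 2 then show ?thesis using that(2)[of j] j by linarith
  next
    case 3
    then have "\<bar>t + 1 / 2 - of_int (j + 1)\<bar> < 3 / 10" "\<bar>of_int (j + 1)\<bar> \<le> \<bar>t\<bar> + 2"
      using j by simp_all
    then show ?thesis by (rule that(2))
  qed
qed

text \<open>
  On a neighbourhood \<open>W\<close> of \<open>K\<close> the function \<open>f0\<close> is the coordinate \<open>z \<bullet> b\<close>, with no control of its gradient off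
  \<open>W\<close>. The functions \<open>f1\<close> and \<open>f2\<close>, waves half a period apart, have gradients bounded
  everywhere by a constant that depends on the dimension only, and near each point of \<open>W\<close> one of them
  is \<open>f0\<close> up to a constant.
\<close>

lemma oscillating_test_functions:
  obtains C where "C > 0" and "\<And>(U::'a::euclidean_space set) K b.
    open U \<Longrightarrow> compact K \<Longrightarrow> K \<subseteq> U \<Longrightarrow> b \<in> Basis \<Longrightarrow>
    \<exists>f0 f1 f2 W. open W \<and> K \<subseteq> W \<and> test_function U f0 \<and> test_function U f1 \<and> test_function U f2 \<and>
      (\<forall>z\<in>W. f0 z = z \<bullet> b) \<and> (\<forall>z. norm (gradient f1 z) \<le> C \<and> norm (gradient f2 z) \<le> C) \<and>
      (\<forall>z\<in>W. \<exists>V c. open V \<and> z \<in> V \<and> ((\<forall>y\<in>V. f0 y = f1 y + c) \<or> (\<forall>y\<in>V. f0 y = f2 y + c)))"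
proof -
  obtain C where C: "C > 0" "\<And>t. \<bar>partial 1 tooth t\<bar> \<le> C" by (rule tooth_derivative_bounded) (rule that)
  show ?thesis
  proof (rule that[of "real DIM('a) * (C + 1)"])
    show "0 < real DIM('a) * (C + 1)" using C(1) by simp
    fix U K :: "'a set" and b :: 'a assume U: "open U" and K: "compact K" "K \<subseteq> U" and b: "b \<in> Basis"
    obtain \<theta> W0 where \<theta>: "test_function U \<theta>" "\<And>x. 0 \<le> \<theta> x" "\<And>x. \<theta> x \<le> 1"
      and W0: "open W0" "K \<subseteq> W0" "\<And>x. x \<in> W0 \<Longrightarrow> \<theta> x = 1"
      by (rule smooth_cutoff_exists[OF K(1) U K(2)]) (rule that)
    obtain R where R: "K \<subseteq> ball 0 R" "R > 0"
      using bounded_subset_ballD[OF compact_imp_bounded[OF K(1)], of 0] by blast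
    obtain Q where Q: "compact Q" "\<And>x. x \<notin> Q \<Longrightarrow> \<theta> x = 0" and s: "smooth \<theta>"
      using \<theta>(1) unfolding test_function_iff by blast
    have g0: "gradient \<theta> x = 0" if "x \<notin> Q" for x
      by (rule gradient_eq_0_outside[OF compact_imp_closed[OF Q(1)] Q(2) that])
    obtain m where m: "m > 0" "\<And>x. norm (gradient \<theta> x) \<le> m"
      by (rule continuous_compact_support_bounded[OF continuous_gradient[OF s] Q(1) g0]) (assumption, rule that)
    have pm: "\<bar>partial b' \<theta> x\<bar> \<le> m" if "b' \<in> Basis" for b' x
      using Basis_le_norm[OF that, of "gradient \<theta> x"] m(2)[of x] gradient_inner[OF that, of \<theta> x] by simp
    \<comment> \<open>Enough translates to cover the range of \<open>m * (z \<bullet> b)\<close> on the ball of radius \<open>R\<close>, shifted by \<open>1/2\<close> if need be.\<close>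
    define N where "N = \<lceil>m * R + 2\<rceil>"
    define I where "I = {- N..N}"
    have I: "finite I" by (simp add: I_def)
    define f0 where "f0 z = (z \<bullet> b) * \<theta> z" for z
    define f where "f \<sigma> = wrinkle I m \<sigma> b \<theta>" for \<sigma>
    define W where "W = W0 \<inter> ball 0 R"
    have W: "open W" "K \<subseteq> W" using W0 R by (auto simp: W_def)
    have f0W: "f0 z = z \<bullet> b" if "z \<in> W" for z using that W0(3) by (simp add: f0_def W_def)
    have test0: "test_function U f0" unfolding f0_def[abs_def] by (intro test_function_mult \<theta>(1) smooth_inner)
    have test: "test_function U (f \<sigma>)" for \<sigma> unfolding f_def by (rule test_function_wrinkle[OF \<theta>(1)])
    have grad: "norm (gradient (f \<sigma>) z) \<le> real DIM('a) * (C + 1)" for \<sigma> z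
      unfolding f_def by (rule norm_gradient_le, rule wrinkle_partial_bound[OF s \<theta>(2,3) b _ m(1) pm I C(2)])
    have loc: "\<exists>V c. open V \<and> z \<in> V \<and> (\<forall>y\<in>V. f0 y = f \<sigma> y + c)"
      if z: "z \<in> W" and k: "\<bar>m * (z \<bullet> b) + \<sigma> - of_int k\<bar> < 3 / 10" "\<bar>real_of_int k\<bar> \<le> \<bar>m * (z \<bullet> b)\<bar> + 2" for z \<sigma> k
    proof -
      have "\<bar>z \<bullet> b\<bar> \<le> R" using Basis_le_norm[OF b, of z] z by (simp add: W_def)
      then have "m * \<bar>z \<bullet> b\<bar> \<le> m * R" using m(1) by (intro mult_left_mono) auto
      moreover have "\<bar>m * (z \<bullet> b)\<bar> = m * \<bar>z \<bullet> b\<bar>" using m(1) by (simp add: abs_mult)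
      ultimately have "\<bar>real_of_int k\<bar> \<le> m * R + 2" using k(2) by linarith
      also have "\<dots> \<le> real_of_int N" unfolding N_def by (rule le_of_int_ceiling)
      finally have kI: "k \<in> I" unfolding I_def by auto
      let ?V = "W \<inter> {y. \<bar>m * (y \<bullet> b) + \<sigma> - of_int k\<bar> < 3 / 10}"
      have "open ?V" by (intro open_Int W(1) open_Collect_less continuous_intros)
      moreover have "f0 y = f \<sigma> y + (of_int k - \<sigma>) / m" if y: "y \<in> ?V" for y
      proof -
        have "sawtooth I (m * (y \<bullet> b) + \<sigma>) = m * (y \<bullet> b) + \<sigma> - of_int k"
          using y by (intro sawtooth_eq I kI) simp
        moreover have "\<theta> y = 1" using y W0(3) by (simp add: W_def)
        ultimately have "f \<sigma> y = (m * (y \<bullet> b) + \<sigma> - of_int k) / m" "f0 y = y \<bullet> b"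
          unfolding f_def wrinkle_def f0_def by simp_all
        then show ?thesis using m(1) by (simp add: field_simps)
      qed
      ultimately show ?thesis using z k(1) by blast
    qed
    have near: "\<exists>V c. open V \<and> z \<in> V \<and> ((\<forall>y\<in>V. f0 y = f 0 y + c) \<or> (\<forall>y\<in>V. f0 y = f (1 / 2) y + c))" if z: "z \<in> W" for z
    proof (cases "m * (z \<bullet> b)" rule: near_integer_or_half_integer)
      case (1 k) then show ?thesis using loc[OF z, of 0 k] by auto
    next
      case (2 k) then show ?thesis using loc[OF z, of "1 / 2" k] by auto
    qed
    show "\<exists>f0 f1 f2 W. open W \<and> K \<subseteq> W \<and> test_function U f0 \<and> test_function U f1 \<and> test_function U f2 \<and>
      (\<forall>z\<in>W. f0 z = z \<bullet> b) \<and> (\<forall>z. norm (gradient f1 z) \<le> real DIM('a) * (C + 1) \<and> norm (gradient f2 z) \<le> real DIM('a) * (C + 1)) \<and>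
      (\<forall>z\<in>W. \<exists>V c. open V \<and> z \<in> V \<and> ((\<forall>y\<in>V. f0 y = f1 y + c) \<or> (\<forall>y\<in>V. f0 y = f2 y + c)))"
      by (rule exI[of _ f0], rule exI[of _ "f 0"], rule exI[of _ "f (1 / 2)"], rule exI[of _ W],
          intro conjI ballI allI W test0 test grad f0W near)
  qed
qed

section \<open>The gradient of a coordinate of the homeomorphism\<close>

text \<open>
  By the Lindelof property countably many of the neighbourhoods suffice.
\<close>

lemma AE_locally:
  fixes S :: "'a::euclidean_space set"
  assumes "\<And>x. x \<in> S \<Longrightarrow> \<exists>V. open V \<and> x \<in> V \<and> (AE y in lebesgue. y \<in> V \<longrightarrow> P y)"
  shows "AE y in lebesgue. y \<in> S \<longrightarrow> P y"
proof -
  let ?F = "{V. open V \<and> (AE y in lebesgue. y \<in> V \<longrightarrow> P y)}"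
  obtain F' where F': "F' \<subseteq> ?F" "countable F'" "\<Union>F' = \<Union>?F"
    using Lindelof[of ?F] by auto
  have "AE y in lebesgue. \<forall>V\<in>F'. y \<in> V \<longrightarrow> P y"
    using F'(1) by (subst AE_ball_countable[OF F'(2)]) auto
  moreover have "S \<subseteq> \<Union>F'" unfolding F'(3) using assms by blast
  ultimately show ?thesis by (auto elim!: eventually_mono)
qed

text \<open>
  The defining supremum of the set function, solved for the seminorm of \<open>f \<circ> \<phi>\<close>.
\<close>

lemma composition_test_bound:
  fixes \<Omega> \<Omega>' A' :: "'a::euclidean_space set"
  assumes \<Omega>': "open \<Omega>'" and A': "open A'" "A' \<subseteq> \<Omega>'" "A' \<in> lmeasurable"
    and pq: "0 < q" "q < p" and gen: "generates_bounded_composition p q \<Omega> \<Omega>' \<phi>"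
    and F: "target_set_function p q \<Omega> \<phi> A' = ennreal F" "F \<ge> 0"
    and f: "test_function A' f" "\<And>x. norm (gradient f x) \<le> C"
  shows "f \<circ> \<phi> \<in> L1_space q \<Omega>"
    and "L1_seminorm q \<Omega> (f \<circ> \<phi>) \<le> ennreal (F powr (1 / q - 1 / p) * (C * measure lebesgue A' powr (1 / p)))"
proof -
  have p: "p > 0" using pq by simp
  have f\<Omega>: "f \<in> L1_space p \<Omega>'"
    by (rule test_function_L1_space[OF \<Omega>' test_function_mono[OF f(1) A'(2)] p])
  show "f \<circ> \<phi> \<in> L1_space q \<Omega>"
    using gen f\<Omega> unfolding generates_bounded_composition_def by blast
  have C0: "C \<ge> 0" using f(2)[of 0] norm_ge_zero order_trans by blast
  let ?s = "L1_seminorm p A' f" and ?a = "L1_seminorm q \<Omega> (f \<circ> \<phi>)"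
  have s: "?s \<le> ennreal (C * measure lebesgue A' powr (1 / p))"
    by (rule L1_seminorm_test_le[OF A'(1) f(1) A'(3) p f(2)])
  show "?a \<le> ennreal (F powr (1 / q - 1 / p) * (C * measure lebesgue A' powr (1 / p)))"
  proof (cases "?s = 0")
    case True
    \<comment> \<open>The supremum omits functions of seminorm \<open>0\<close>; boundedness of the composition operator covers them.\<close>
    obtain K where "?a \<le> K * L1_seminorm p \<Omega>' f"
      using gen f\<Omega> unfolding generates_bounded_composition_def by blast
    also have "L1_seminorm p \<Omega>' f = 0"
      using L1_seminorm_test_extend[OF \<Omega>' A'(1,2) f(1), of p] True by simp
    finally have "?a \<le> 0" unfolding mult_zero_right .
    then show ?thesis by (rule order_trans) simp
  next
    case False
    let ?\<kappa> = "1 / (1 / q - 1 / p)"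
    have \<kappa>: "?\<kappa> > 0" using pq by (simp add: frac_less2)
    have "f \<in> {f \<in> L1_space p A' \<inter> C0_space A'. L1_seminorm p A' f \<noteq> 0}"
      using False test_function_L1_space[OF A'(1) f(1) p] test_function_C0_space[OF f(1)] by simp
    then have "epowr (?a / ?s) ?\<kappa> \<le> target_set_function p q \<Omega> \<phi> A'"
      unfolding target_set_function_def by (rule SUP_upper)
    then have "?a / ?s \<le> ennreal (F powr (1 / ?\<kappa>))"
      unfolding F(1) by (rule epowr_le_imp_le[OF _ \<kappa> F(2)])
    then have "?a / ?s * ?s \<le> ennreal (F powr (1 / q - 1 / p)) * ennreal (C * measure lebesgue A' powr (1 / p))"
      using s by (intro mult_mono) auto
    moreover have "?s \<noteq> top" using s by (auto simp: top_unique)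
    then have "?a / ?s * ?s = ?a"
      using False by (simp add: ennreal_divide_times top.not_eq_extremum)
    ultimately show ?thesis using C0 by (simp add: ennreal_mult)
  qed
qed

lemma continuous_extend_by_zero:
  fixes h :: "'a::t2_space \<Rightarrow> 'b::real_normed_vector"
  assumes "open \<Omega>" "continuous_on \<Omega> h" "compact Q" "Q \<subseteq> \<Omega>" "\<And>x. x \<in> \<Omega> - Q \<Longrightarrow> h x = 0"
  shows "continuous_on UNIV (\<lambda>x. if x \<in> \<Omega> then h x else 0)"
proof -
  let ?v = "\<lambda>x. if x \<in> \<Omega> then h x else 0"
  have "continuous_on (\<Omega> \<union> (- Q)) ?v"
  proof (rule continuous_on_open_Un[OF assms(1)])
    show "open (- Q)" using compact_imp_closed[OF assms(3)] by auto
    show "continuous_on \<Omega> ?v"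
      by (rule continuous_on_eq[OF assms(2)]) simp
    show "continuous_on (- Q) ?v"
      by (rule continuous_on_eq[OF continuous_on_const[of _ 0]]) (use assms(5) in auto)
  qed
  moreover have "\<Omega> \<union> (- Q) = UNIV" using assms(4) by auto
  ultimately show ?thesis by simp
qed

text \<open>
  On \<open>K\<close> the coordinate \<open>\<phi> x \<bullet> b\<close> agrees with a continuous function \<open>v\<close>, defined everywhere, that has a weak gradient
  on \<open>\<Omega>\<close>, namely the composition of \<open>f0\<close> from \<open>oscillating_test_functions\<close> with \<open>\<phi>\<close>. Almost everywhere on \<open>K\<close>
  its gradient is that of \<open>f1 \<circ> \<phi>\<close> or that of \<open>f2 \<circ> \<phi>\<close>, and \<open>composition_test_bound\<close> applies to both.
  The constant does not depend on \<open>K\<close>, so \<open>K\<close> may exhaust \<open>A\<close>.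
\<close>

lemma coordinate_weak_gradient:
  fixes q :: real
  assumes n: "q > 0"
  obtains C where "C > 0" and "\<And>(\<Omega>::'a::euclidean_space set) \<Omega>' \<phi> \<psi> A p F K b.
    open \<Omega> \<Longrightarrow> open \<Omega>' \<Longrightarrow> q < p \<Longrightarrow> homeomorphism \<Omega> \<Omega>' \<phi> \<psi> \<Longrightarrow>
    generates_bounded_composition p q \<Omega> \<Omega>' \<phi> \<Longrightarrow> open A \<Longrightarrow> A \<subseteq> \<Omega> \<Longrightarrow> open (\<phi> ` A) \<Longrightarrow> \<phi> ` A \<in> lmeasurable \<Longrightarrow>
    set_function p q \<Omega> \<phi> A = ennreal F \<Longrightarrow> F \<ge> 0 \<Longrightarrow> compact K \<Longrightarrow> K \<subseteq> A \<Longrightarrow> b \<in> Basis \<Longrightarrow>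
    \<exists>v g. continuous_on UNIV v \<and> (\<forall>x\<in>K. v x = \<phi> x \<bullet> b) \<and> has_weak_gradient \<Omega> v g \<and>
      (\<integral>\<^sup>+x\<in>K. ennreal (norm (g x) powr q) \<partial>lebesgue)
        \<le> ennreal ((C * F powr (1 / q - 1 / p) * measure lebesgue (\<phi> ` A) powr (1 / p)) powr q)"
proof -
  obtain C where C: "C > 0" and osc: "\<And>(U::'a set) K b. open U \<Longrightarrow> compact K \<Longrightarrow> K \<subseteq> U \<Longrightarrow> b \<in> Basis \<Longrightarrow>
    \<exists>f0 f1 f2 W. open W \<and> K \<subseteq> W \<and> test_function U f0 \<and> test_function U f1 \<and> test_function U f2 \<and>
      (\<forall>z\<in>W. f0 z = z \<bullet> b) \<and> (\<forall>z. norm (gradient f1 z) \<le> C \<and> norm (gradient f2 z) \<le> C) \<and>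
      (\<forall>z\<in>W. \<exists>V c. open V \<and> z \<in> V \<and> ((\<forall>y\<in>V. f0 y = f1 y + c) \<or> (\<forall>y\<in>V. f0 y = f2 y + c)))"
    by (rule oscillating_test_functions) (rule that)
  show ?thesis
  proof (rule that[of "2 powr (1 / q) * C"])
    show "0 < 2 powr (1 / q) * C" using C by simp
    fix \<Omega> \<Omega>' A K :: "'a set" and \<phi> \<psi> :: "'a \<Rightarrow> 'a" and p F :: real and b :: 'a
    assume \<Omega>: "open \<Omega>" and \<Omega>': "open \<Omega>'" and pq: "q < p" and hom: "homeomorphism \<Omega> \<Omega>' \<phi> \<psi>"
      and gen: "generates_bounded_composition p q \<Omega> \<Omega>' \<phi>" and A: "open A" "A \<subseteq> \<Omega>"
      and A': "open (\<phi> ` A)" "\<phi> ` A \<in> lmeasurable"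
      and F: "set_function p q \<Omega> \<phi> A = ennreal F" "F \<ge> 0" and K: "compact K" "K \<subseteq> A" and b: "b \<in> Basis"
    define S where "S = F powr (1 / q - 1 / p) * (C * measure lebesgue (\<phi> ` A) powr (1 / p))"
    have S0: "S \<ge> 0" using C by (simp add: S_def)
    have A'\<Omega>': "\<phi> ` A \<subseteq> \<Omega>'" using A(2) hom by (auto simp: homeomorphism_def)
    have cont\<phi>: "continuous_on \<Omega> \<phi>" and cont\<psi>: "continuous_on \<Omega>' \<psi>" and \<psi>\<phi>: "\<And>x. x \<in> \<Omega> \<Longrightarrow> \<psi> (\<phi> x) = x"
      using hom by (auto simp: homeomorphism_def)
    have c\<phi>K: "compact (\<phi> ` K)" "\<phi> ` K \<subseteq> \<phi> ` A"
      using K A(2) compact_continuous_image[OF continuous_on_subset[OF cont\<phi>] K(1)] by auto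
    obtain f0 f1 f2 W where W: "open W" "\<phi> ` K \<subseteq> W" and test0: "test_function (\<phi> ` A) f0"
      and test1: "test_function (\<phi> ` A) f1" and test2: "test_function (\<phi> ` A) f2"
      and f0: "\<forall>z\<in>W. f0 z = z \<bullet> b"
      and grad: "\<forall>z. norm (gradient f1 z) \<le> C \<and> norm (gradient f2 z) \<le> C"
      and loc: "\<forall>z\<in>W. \<exists>V c. open V \<and> z \<in> V \<and> ((\<forall>y\<in>V. f0 y = f1 y + c) \<or> (\<forall>y\<in>V. f0 y = f2 y + c))"
      using osc[OF A'(1) c\<phi>K b] by (elim exE conjE) (rule that)
    have q0: "0 < q" by (rule n)
    note bound = composition_test_bound[OF \<Omega>' A'(1) A'\<Omega>' A'(2) q0 pq gen F(1)[unfolded set_function_def] F(2)]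
    have ex: "\<exists>g. has_weak_gradient \<Omega> (f \<circ> \<phi>) g" if "test_function (\<phi> ` A) f" for f
    proof -
      have "f \<in> L1_space p \<Omega>'"
        using test_function_L1_space[OF \<Omega>' test_function_mono[OF that A'\<Omega>']] q0 pq by simp
      then have "f \<circ> \<phi> \<in> L1_space q \<Omega>" using gen unfolding generates_bounded_composition_def by blast
      then show ?thesis unfolding L1_space_def by blast
    qed
    obtain g0 g1 g2 where g0: "has_weak_gradient \<Omega> (f0 \<circ> \<phi>) g0"
      and g1: "has_weak_gradient \<Omega> (f1 \<circ> \<phi>) g1" and g2: "has_weak_gradient \<Omega> (f2 \<circ> \<phi>) g2"
      using ex[OF test0] ex[OF test1] ex[OF test2] by blast
    have K\<Omega>: "K \<subseteq> \<Omega>" using K(2) A(2) by simp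
    have int: "(\<integral>\<^sup>+x\<in>K. ennreal (norm (g x) powr q) \<partial>lebesgue) \<le> ennreal (S powr q)"
      if "test_function (\<phi> ` A) f" "\<And>z. norm (gradient f z) \<le> C" "has_weak_gradient \<Omega> (f \<circ> \<phi>) g" for f g
    proof -
      have "Lp_norm q \<Omega> g \<le> ennreal S"
        using bound(2)[OF that(1,2)] L1_seminorm_eq[OF \<Omega> that(3), of q] by (simp add: S_def)
      then have "(\<integral>\<^sup>+x\<in>\<Omega>. ennreal (norm (g x) powr q) \<partial>lebesgue) \<le> ennreal (S powr (1 / (1 / q)))"
        unfolding Lp_norm_def by (rule epowr_le_imp_le) (use q0 S0 in simp_all)
      moreover have "(\<integral>\<^sup>+x\<in>K. ennreal (norm (g x) powr q) \<partial>lebesgue) \<le> (\<integral>\<^sup>+x\<in>\<Omega>. ennreal (norm (g x) powr q) \<partial>lebesgue)"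
        by (intro nn_integral_mono) (use K\<Omega> in \<open>auto simp: indicator_def\<close>)
      ultimately show ?thesis by (simp add: order_trans)
    qed
    have meas: "(\<lambda>x. ennreal (norm (g x) powr q) * indicator K x) \<in> borel_measurable lebesgue"
      if "has_weak_gradient \<Omega> h g" for h and g :: "'a \<Rightarrow> 'a"
    proof -
      have "integrable lebesgue (\<lambda>x. indicator K x *\<^sub>R g x)"
        using that K(1) K\<Omega> unfolding has_weak_gradient_def loc_integrable_def set_integrable_def by simp
      then have "(\<lambda>x. ennreal (norm (indicator K x *\<^sub>R g x) powr q)) \<in> borel_measurable lebesgue"
        using borel_measurable_integrable by measurable
      moreover have "(\<lambda>x. ennreal (norm (indicator K x *\<^sub>R g x) powr q)) = (\<lambda>x. ennreal (norm (g x) powr q) * indicator K x)"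
        by (auto simp: indicator_def)
      ultimately show ?thesis by (simp only:)
    qed
    have "AE x in lebesgue. x \<in> K \<longrightarrow> g0 x = g1 x \<or> g0 x = g2 x"
    proof (rule AE_locally)
      fix x assume x: "x \<in> K"
      then have "\<phi> x \<in> W" using W(2) by auto
      then obtain V c where V: "open V" "\<phi> x \<in> V" "(\<forall>y\<in>V. f0 y = f1 y + c) \<or> (\<forall>y\<in>V. f0 y = f2 y + c)"
        using bspec[OF loc] by blast
      \<comment> \<open>On this open set the two compositions with \<open>\<phi>\<close> differ by the constant \<open>c\<close>.\<close>
      define Y where "Y = \<Omega> \<inter> \<phi> -` V"
      have Y: "open Y" "Y \<subseteq> \<Omega>" "x \<in> Y"
        using continuous_open_preimage[OF cont\<phi> \<Omega> V(1)] V(2) x K\<Omega> by (auto simp: Y_def)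
      have "AE y in lebesgue. y \<in> Y \<longrightarrow> g0 y = g1 y \<or> g0 y = g2 y"
        using V(3)
      proof
        assume "\<forall>y\<in>V. f0 y = f1 y + c"
        then have "AE y in lebesgue. y \<in> Y \<longrightarrow> g0 y = g1 y"
          by (intro weak_gradient_unique[OF Y(1) weak_gradient_subset[OF g0 Y(2)] weak_gradient_subset[OF g1 Y(2)], of c])
             (auto simp: Y_def)
        then show ?thesis by eventually_elim simp
      next
        assume "\<forall>y\<in>V. f0 y = f2 y + c"
        then have "AE y in lebesgue. y \<in> Y \<longrightarrow> g0 y = g2 y"
          by (intro weak_gradient_unique[OF Y(1) weak_gradient_subset[OF g0 Y(2)] weak_gradient_subset[OF g2 Y(2)], of c])
             (auto simp: Y_def)
        then show ?thesis by eventually_elim simp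
      qed
      then show "\<exists>V. open V \<and> x \<in> V \<and> (AE y in lebesgue. y \<in> V \<longrightarrow> g0 y = g1 y \<or> g0 y = g2 y)"
        using Y by blast
    qed
    then have "(\<integral>\<^sup>+x\<in>K. ennreal (norm (g0 x) powr q) \<partial>lebesgue) \<le>
        (\<integral>\<^sup>+x. (ennreal (norm (g1 x) powr q) * indicator K x + ennreal (norm (g2 x) powr q) * indicator K x) \<partial>lebesgue)"
      by (intro nn_integral_mono_AE) (auto elim!: eventually_mono simp: indicator_def)
    also have "\<dots> = (\<integral>\<^sup>+x\<in>K. ennreal (norm (g1 x) powr q) \<partial>lebesgue) + (\<integral>\<^sup>+x\<in>K. ennreal (norm (g2 x) powr q) \<partial>lebesgue)"
      by (rule nn_integral_add[OF meas[OF g1] meas[OF g2]])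
    also have "\<dots> \<le> ennreal (S powr q) + ennreal (S powr q)"
      by (intro add_mono int[OF test1 _ g1] int[OF test2 _ g2]) (simp_all add: grad)
    also have "\<dots> = ennreal ((2 powr (1 / q) * S) powr q)"
      using S0 q0 by (simp add: ennreal_plus[symmetric] powr_mult powr_powr del: ennreal_plus)
    also have "2 powr (1 / q) * S = 2 powr (1 / q) * C * F powr (1 / q - 1 / p) * measure lebesgue (\<phi> ` A) powr (1 / p)"
      by (simp add: S_def)
    finally have final: "(\<integral>\<^sup>+x\<in>K. ennreal (norm (g0 x) powr q) \<partial>lebesgue) \<le>
      ennreal ((2 powr (1 / q) * C * F powr (1 / q - 1 / p) * measure lebesgue (\<phi> ` A) powr (1 / p)) powr q)" .
    define v where "v x = (if x \<in> \<Omega> then f0 (\<phi> x) else 0)" for x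
    obtain Q where Q: "compact Q" "Q \<subseteq> \<phi> ` A" "\<And>z. z \<notin> Q \<Longrightarrow> f0 z = 0" and sm: "smooth f0"
      using test0 unfolding test_function_iff by blast
    have cv: "continuous_on UNIV v"
      unfolding v_def[abs_def]
    proof (rule continuous_extend_by_zero[OF \<Omega>])
      show "continuous_on \<Omega> (\<lambda>x. f0 (\<phi> x))"
        by (rule continuous_on_compose2[OF smooth_continuous[OF sm] cont\<phi>]) simp
      \<comment> \<open>The composition is supported in the preimage of the support of \<open>f0\<close>, which is compact.\<close>
      show "compact (\<psi> ` Q)"
        using Q(2) A'\<Omega>' by (intro compact_continuous_image[OF continuous_on_subset[OF cont\<psi>] Q(1)]) blast
      show "\<psi> ` Q \<subseteq> \<Omega>" using Q(2) A(2) \<psi>\<phi> by force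
      fix x assume "x \<in> \<Omega> - \<psi> ` Q"
      then have "\<phi> x \<notin> Q" using \<psi>\<phi>[of x] by (metis DiffE imageI)
      then show "f0 (\<phi> x) = 0" by (rule Q(3))
    qed
    have "has_weak_gradient \<Omega> v g0"
      by (rule weak_gradient_cong[OF _ g0]) (simp add: v_def)
    moreover have "\<forall>x\<in>K. v x = \<phi> x \<bullet> b" using K\<Omega> W(2) f0 by (auto simp: v_def)
    ultimately show "\<exists>v g. continuous_on UNIV v \<and> (\<forall>x\<in>K. v x = \<phi> x \<bullet> b) \<and> has_weak_gradient \<Omega> v g \<and>
      (\<integral>\<^sup>+x\<in>K. ennreal (norm (g x) powr q) \<partial>lebesgue)
        \<le> ennreal ((2 powr (1 / q) * C * F powr (1 / q - 1 / p) * measure lebesgue (\<phi> ` A) powr (1 / p)) powr q)"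
      using cv final by blast
  qed
qed

section \<open>The dilatation quotient\<close>

text \<open>
  Morrey's inequality for the coordinates on smaller concentric balls, which are relatively compact in the
  given one, followed by a passage to the limit in the radius.
\<close>

lemma stretch_bound:
  fixes q :: real
  assumes q: "q > real DIM('a::euclidean_space)"
  obtains C where "C > 0" and "\<And>(\<Omega>::'a set) \<Omega>' \<phi> \<psi> p F x0 r.
    open \<Omega> \<Longrightarrow> open \<Omega>' \<Longrightarrow> q < p \<Longrightarrow> homeomorphism \<Omega> \<Omega>' \<phi> \<psi> \<Longrightarrow>
    generates_bounded_composition p q \<Omega> \<Omega>' \<phi> \<Longrightarrow> r > 0 \<Longrightarrow> cball x0 r \<subseteq> \<Omega> \<Longrightarrow>
    open (\<phi> ` ball x0 r) \<Longrightarrow> \<phi> ` ball x0 r \<in> lmeasurable \<Longrightarrow>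
    set_function p q \<Omega> \<phi> (ball x0 r) = ennreal F \<Longrightarrow> F \<ge> 0 \<Longrightarrow>
    max_stretch \<phi> x0 r \<le> C * F powr (1 / q - 1 / p) * measure lebesgue (\<phi> ` ball x0 r) powr (1 / p)
      * r powr (1 - real DIM('a) / q)"
proof -
  have q0: "q > 0" using q by (meson less_trans of_nat_0_less_iff DIM_positive)
  have \<alpha>: "1 - real DIM('a) / q \<ge> 0" using q by (simp add: field_simps)
  obtain C1 where C1: "C1 > 0" and morrey: "\<And>(v::'a \<Rightarrow> real) g x0 y r M.
    continuous_on UNIV v \<Longrightarrow> has_weak_gradient (ball x0 r) v g \<Longrightarrow> r > 0 \<Longrightarrow> dist x0 y \<le> r \<Longrightarrow> M > 0 \<Longrightarrow>
    (\<integral>\<^sup>+x\<in>ball x0 r. ennreal (norm (g x) powr q) \<partial>lebesgue) \<le> ennreal (M powr q) \<Longrightarrow>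
    \<bar>v y - v x0\<bar> \<le> C1 * M * r powr (1 - real DIM('a) / q)"
    by (rule Morrey_inequality[OF q]) (rule that)
  obtain C2 where C2: "C2 > 0" and coord: "\<And>(\<Omega>::'a set) \<Omega>' \<phi> \<psi> A p F K b.
    open \<Omega> \<Longrightarrow> open \<Omega>' \<Longrightarrow> q < p \<Longrightarrow> homeomorphism \<Omega> \<Omega>' \<phi> \<psi> \<Longrightarrow>
    generates_bounded_composition p q \<Omega> \<Omega>' \<phi> \<Longrightarrow> open A \<Longrightarrow> A \<subseteq> \<Omega> \<Longrightarrow> open (\<phi> ` A) \<Longrightarrow> \<phi> ` A \<in> lmeasurable \<Longrightarrow>
    set_function p q \<Omega> \<phi> A = ennreal F \<Longrightarrow> F \<ge> 0 \<Longrightarrow> compact K \<Longrightarrow> K \<subseteq> A \<Longrightarrow> b \<in> Basis \<Longrightarrow>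
    \<exists>v g. continuous_on UNIV v \<and> (\<forall>x\<in>K. v x = \<phi> x \<bullet> b) \<and> has_weak_gradient \<Omega> v g \<and>
      (\<integral>\<^sup>+x\<in>K. ennreal (norm (g x) powr q) \<partial>lebesgue)
        \<le> ennreal ((C2 * F powr (1 / q - 1 / p) * measure lebesgue (\<phi> ` A) powr (1 / p)) powr q)"
    by (rule coordinate_weak_gradient[OF q0]) (rule that)
  show ?thesis
  proof (rule that[of "real DIM('a) * C1 * C2"])
    show "real DIM('a) * C1 * C2 > 0" using C1 C2 by simp
    fix \<Omega> \<Omega>' :: "'a set" and \<phi> \<psi> :: "'a \<Rightarrow> 'a" and p F r :: real and x0 :: 'a
    assume h: "open \<Omega>" "open \<Omega>'" "q < p" "homeomorphism \<Omega> \<Omega>' \<phi> \<psi>" "generates_bounded_composition p q \<Omega> \<Omega>' \<phi>"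
      and r: "r > 0" "cball x0 r \<subseteq> \<Omega>" and A': "open (\<phi> ` ball x0 r)" "\<phi> ` ball x0 r \<in> lmeasurable"
      and F: "set_function p q \<Omega> \<phi> (ball x0 r) = ennreal F" "F \<ge> 0"
    have ball\<Omega>: "ball x0 r \<subseteq> \<Omega>" using r(2) ball_subset_cball by blast
    have cont: "continuous_on (cball x0 r) \<phi>"
      using h(4) r(2) unfolding homeomorphism_def by (meson continuous_on_subset)
    define S where "S = C2 * F powr (1 / q - 1 / p) * measure lebesgue (\<phi> ` ball x0 r) powr (1 / p)"
    have S: "S \<ge> 0" using C2 by (simp add: S_def)
    have inner: "\<bar>\<phi> y \<bullet> b - \<phi> x0 \<bullet> b\<bar> \<le> C1 * M * r powr (1 - real DIM('a) / q)"
      if b: "b \<in> Basis" and r': "0 < r'" "r' < r" and y: "y \<in> cball x0 r'" and M: "M > 0" "M \<ge> S" for b r' y M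
    proof -
      have K: "cball x0 r' \<subseteq> ball x0 r" using r' by (auto simp: subset_iff)
      have B: "ball x0 r' \<subseteq> \<Omega>" using K ball\<Omega> ball_subset_cball by blast
      obtain v g where v: "continuous_on UNIV v" "\<forall>x\<in>cball x0 r'. v x = \<phi> x \<bullet> b" and g: "has_weak_gradient \<Omega> v g"
        and int: "(\<integral>\<^sup>+x\<in>cball x0 r'. ennreal (norm (g x) powr q) \<partial>lebesgue) \<le> ennreal (S powr q)"
        using coord[OF h open_ball ball\<Omega> A' F compact_cball K b, folded S_def] by (elim exE conjE) (rule that)
      have "(\<integral>\<^sup>+x\<in>ball x0 r'. ennreal (norm (g x) powr q) \<partial>lebesgue) \<le>
          (\<integral>\<^sup>+x\<in>cball x0 r'. ennreal (norm (g x) powr q) \<partial>lebesgue)"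
        by (intro nn_integral_mono) (auto simp: indicator_def)
      also note int
      also have "ennreal (S powr q) \<le> ennreal (M powr q)"
        using S M q0 by (intro ennreal_leI powr_mono2) auto
      finally have "\<bar>v y - v x0\<bar> \<le> C1 * M * r' powr (1 - real DIM('a) / q)"
        using y by (intro morrey[OF v(1) weak_gradient_subset[OF g B] r'(1) _ M(1)]) auto
      also have "\<dots> \<le> C1 * M * r powr (1 - real DIM('a) / q)"
        using C1 M(1) r' \<alpha> by (intro mult_left_mono powr_mono2) auto
      finally show ?thesis using v(2) y r' by simp
    qed
    have sphere: "\<bar>\<phi> y \<bullet> b - \<phi> x0 \<bullet> b\<bar> \<le> C1 * S * r powr (1 - real DIM('a) / q)"
      if b: "b \<in> Basis" and y: "y \<in> sphere x0 r" for b y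
    proof -
      \<comment> \<open>Approach the point of the sphere along the radius.\<close>
      define \<gamma> where "\<gamma> t = x0 + t *\<^sub>R (y - x0)" for t :: real
      have \<gamma>: "dist x0 (\<gamma> t) = t * r" if "0 \<le> t" for t
        using y that by (simp add: \<gamma>_def dist_norm norm_minus_commute)
      have c: "continuous_on {0..1} (\<lambda>t. \<bar>\<phi> (\<gamma> t) \<bullet> b - \<phi> x0 \<bullet> b\<bar>)"
      proof -
        have "continuous_on {0..1} (\<lambda>t. \<phi> (\<gamma> t))"
        proof (rule continuous_on_compose2[OF cont])
          show "continuous_on {0..1} \<gamma>" unfolding \<gamma>_def by (intro continuous_intros)
          show "\<gamma> ` {0..1} \<subseteq> cball x0 r" using \<gamma> r(1) by (auto simp: mult_left_le_one_le)
        qed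
        then show ?thesis by (intro continuous_intros)
      qed
      have "\<bar>\<phi> y \<bullet> b - \<phi> x0 \<bullet> b\<bar> \<le> C1 * M * r powr (1 - real DIM('a) / q)" if M: "M > 0" "M \<ge> S" for M
      proof -
        have "((\<lambda>t. \<bar>\<phi> (\<gamma> t) \<bullet> b - \<phi> x0 \<bullet> b\<bar>) \<longlongrightarrow> \<bar>\<phi> (\<gamma> 1) \<bullet> b - \<phi> x0 \<bullet> b\<bar>) (at 1 within {0..1})"
          using c by (simp add: continuous_on_def)
        then have "((\<lambda>t. \<bar>\<phi> (\<gamma> t) \<bullet> b - \<phi> x0 \<bullet> b\<bar>) \<longlongrightarrow> \<bar>\<phi> (\<gamma> 1) \<bullet> b - \<phi> x0 \<bullet> b\<bar>) (at_left 1)"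
          by (simp add: at_within_Icc_at_left)
        moreover have "\<forall>\<^sub>F t in at_left 1. 0 < t \<and> t < (1::real)"
          by (auto simp: eventually_at_left_field intro!: exI[of _ 0])
        then have "\<forall>\<^sub>F t in at_left 1. \<bar>\<phi> (\<gamma> t) \<bullet> b - \<phi> x0 \<bullet> b\<bar> \<le> C1 * M * r powr (1 - real DIM('a) / q)"
        proof eventually_elim
          case (elim t)
          show ?case by (rule inner[OF b _ _ _ M, of "t * r"]) (use elim r(1) \<gamma>[of t] in auto)
        qed
        ultimately have "\<bar>\<phi> (\<gamma> 1) \<bullet> b - \<phi> x0 \<bullet> b\<bar> \<le> C1 * M * r powr (1 - real DIM('a) / q)"
          by (rule tendsto_upperbound) simp
        then show ?thesis by (simp add: \<gamma>_def)
      qed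
      note bound = this
      \<comment> \<open>Morrey's inequality was stated for positive \<open>M\<close>, but \<open>S\<close> may be \<open>0\<close>.\<close>
      have "((\<lambda>M. C1 * M * r powr (1 - real DIM('a) / q)) \<longlongrightarrow> C1 * S * r powr (1 - real DIM('a) / q)) (at_right S)"
        by (intro tendsto_intros)
      moreover have "\<forall>\<^sub>F M in at_right S. \<bar>\<phi> y \<bullet> b - \<phi> x0 \<bullet> b\<bar> \<le> C1 * M * r powr (1 - real DIM('a) / q)"
        using eventually_at_right_less[of S] by eventually_elim (use bound S in auto)
      ultimately show ?thesis by (rule tendsto_lowerbound) simp
    qed
    have "max_stretch \<phi> x0 r \<le> real DIM('a) * (C1 * S * r powr (1 - real DIM('a) / q))"
      unfolding max_stretch_def
    proof (rule cSUP_least)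
      show "sphere x0 r \<noteq> {}" using r(1) by simp
      fix y assume y: "y \<in> sphere x0 r"
      have "norm (\<phi> x0 - \<phi> y) \<le> (\<Sum>b\<in>Basis. \<bar>(\<phi> x0 - \<phi> y) \<bullet> b\<bar>)" by (rule norm_le_l1)
      also have "\<dots> \<le> (\<Sum>b\<in>(Basis::'a set). C1 * S * r powr (1 - real DIM('a) / q))"
        by (intro sum_mono) (use sphere[OF _ y] in \<open>simp add: inner_diff_left abs_minus_commute\<close>)
      finally show "norm (\<phi> x0 - \<phi> y) \<le> real DIM('a) * (C1 * S * r powr (1 - real DIM('a) / q))" by simp
    qed
    then show "max_stretch \<phi> x0 r \<le> real DIM('a) * C1 * C2 * F powr (1 / q - 1 / p) *
        measure lebesgue (\<phi> ` ball x0 r) powr (1 / p) * r powr (1 - real DIM('a) / q)"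
      by (simp add: S_def mult_ac)
  qed
qed

text \<open>
  Collecting exponents: those of \<open>F\<close> and \<open>V\<close> cancel because \<open>p (1/q - 1/p) = (p - q)/q\<close>, and those of
  \<open>r\<close> add up to \<open>p - p n/q + n - p + n (p - q)/q = 0\<close>.
\<close>

lemma dilatation_quotient_bound:
  fixes L V F r \<omega> C n p q :: real
  assumes "0 < q" "q < p" "0 \<le> L" "0 < V" "0 < F" "0 < r" "0 < \<omega>" "0 \<le> C"
    and L: "L \<le> C * F powr (1 / q - 1 / p) * V powr (1 / p) * r powr (1 - n / q)"
  shows "L powr p * r powr (n - p) / V * (\<omega> * r powr n / F) powr ((p - q) / q) \<le> C powr p * \<omega> powr ((p - q) / q)"
proof -
  have p: "p > 0" using assms by simp
  have e1: "(1 / q - 1 / p) * p = (p - q) / q" using assms(1) p by (simp add: field_simps)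
  have e2: "(1 - n / q) * p + (n - p) + n * ((p - q) / q) = 0" using assms(1) by (simp add: field_simps)
  have "L powr p \<le> (C * F powr (1 / q - 1 / p) * V powr (1 / p) * r powr (1 - n / q)) powr p"
    using assms p by (intro powr_mono2) auto
  also have "\<dots> = C powr p * F powr ((p - q) / q) * V * r powr ((1 - n / q) * p)"
    using assms p by (simp add: powr_mult powr_powr e1)
  finally have Lp: "L powr p \<le> C powr p * F powr ((p - q) / q) * V * r powr ((1 - n / q) * p)" .
  have "L powr p * r powr (n - p) / V * (\<omega> * r powr n / F) powr ((p - q) / q)
      \<le> C powr p * F powr ((p - q) / q) * V * r powr ((1 - n / q) * p) * r powr (n - p) / V * (\<omega> * r powr n / F) powr ((p - q) / q)"
    using assms by (intro mult_right_mono divide_right_mono Lp) auto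
  also have "\<dots> = C powr p * F powr ((p - q) / q) * r powr ((1 - n / q) * p) * r powr (n - p) *
      (\<omega> powr ((p - q) / q) * r powr (n * ((p - q) / q)) / F powr ((p - q) / q))"
    using assms by (simp add: powr_mult powr_divide powr_powr)
  also have "\<dots> = C powr p * \<omega> powr ((p - q) / q) * (r powr ((1 - n / q) * p) * r powr (n - p) * r powr (n * ((p - q) / q)))"
    using assms by simp
  also have "r powr ((1 - n / q) * p) * r powr (n - p) * r powr (n * ((p - q) / q)) = 1"
    using assms(6) unfolding powr_add[symmetric] e2 by simp
  finally show ?thesis by simp
qed

text \<open>
  For every ball whose closure lies in \<open>\<Omega>\<close>, the quotient is at most a constant that depends on
  \<open>n\<close>, \<open>p\<close> and \<open>q\<close> only; this is more than a bound for the upper limit.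
\<close>

theorem theorem3p10:
  fixes \<Omega> \<Omega>' :: "'a::euclidean_space set" and \<phi> \<psi> :: "'a \<Rightarrow> 'a" and p q :: real
  assumes "open \<Omega>" "connected \<Omega>" "\<Omega> \<noteq> {}"
    and "open \<Omega>'" "connected \<Omega>'" "\<Omega>' \<noteq> {}"
    and "real DIM('a) < q" "q < p"
    and "homeomorphism \<Omega> \<Omega>' \<phi> \<psi>"
    and "generates_bounded_composition p q \<Omega> \<Omega>' \<phi>"
  shows "\<exists>H<\<infinity>. \<forall>x\<^sub>0\<in>\<Omega>.
           Limsup (at_right 0) (\<lambda>r. dilatation_quotient p q \<Omega> \<phi> x\<^sub>0 r) \<le> H"
proof -
  obtain C where C: "C > 0" and stretch: "\<And>(\<Omega>::'a set) \<Omega>' \<phi> \<psi> p F x0 r.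
    open \<Omega> \<Longrightarrow> open \<Omega>' \<Longrightarrow> q < p \<Longrightarrow> homeomorphism \<Omega> \<Omega>' \<phi> \<psi> \<Longrightarrow>
    generates_bounded_composition p q \<Omega> \<Omega>' \<phi> \<Longrightarrow> r > 0 \<Longrightarrow> cball x0 r \<subseteq> \<Omega> \<Longrightarrow>
    open (\<phi> ` ball x0 r) \<Longrightarrow> \<phi> ` ball x0 r \<in> lmeasurable \<Longrightarrow>
    set_function p q \<Omega> \<phi> (ball x0 r) = ennreal F \<Longrightarrow> F \<ge> 0 \<Longrightarrow>
    max_stretch \<phi> x0 r \<le> C * F powr (1 / q - 1 / p) * measure lebesgue (\<phi> ` ball x0 r) powr (1 / p)
      * r powr (1 - real DIM('a) / q)"
    by (rule stretch_bound[OF assms(7)]) (rule that)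
  define \<omega> where "\<omega> = unit_ball_vol (real DIM('a))"
  have \<omega>: "\<omega> > 0" unfolding \<omega>_def by simp
  have q0: "q > 0" using assms(7) of_nat_0_le_iff[of "DIM('a)"] by linarith
  define H where "H = C powr p * \<omega> powr ((p - q) / q)"
  have bound: "dilatation_quotient p q \<Omega> \<phi> x0 r \<le> ennreal H" if r: "r > 0" "cball x0 r \<subseteq> \<Omega>" for x0 r
  proof -
    let ?A = "ball x0 r" and ?A' = "\<phi> ` ball x0 r"
    have cont: "continuous_on (cball x0 r) \<phi>"
      using assms(9) r(2) unfolding homeomorphism_def by (meson continuous_on_subset)
    have inj: "\<phi> x = \<phi> y \<Longrightarrow> x = y" if "x \<in> \<Omega>" "y \<in> \<Omega>" for x y
      using assms(9) that unfolding homeomorphism_def by metis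
    have ball\<Omega>: "?A \<subseteq> \<Omega>" using r(2) ball_subset_cball by blast
    have "openin (top_of_set \<Omega>') ?A'"
      by (rule homeomorphism_imp_open_map[OF assms(9)]) (use ball\<Omega> in \<open>simp add: open_subset\<close>)
    then have opA': "open ?A'" using assms(4) by (rule openin_open_trans)
    have "bounded ?A'"
      by (rule bounded_subset[OF compact_imp_bounded[OF compact_continuous_image[OF cont compact_cball]]]) auto
    then have mA': "?A' \<in> lmeasurable" using opA' by (rule lmeasurable_open)
    define V where "V = measure lebesgue ?A'"
    have eV: "emeasure lebesgue ?A' = ennreal V" unfolding V_def using mA' by (simp add: emeasure_eq_measure2)
    have V: "V > 0"
    proof -
      have "?A' \<noteq> {}" using r(1) by simp
      then have "\<not> negligible ?A'" by (rule open_not_negligible[OF opA'])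
      then show ?thesis using mA' unfolding V_def by (metis measure_nonneg negligible_iff_measure order_le_less)
    qed
    have eB: "emeasure lebesgue ?A = ennreal (\<omega> * r powr real DIM('a))"
      using r(1) by (simp add: emeasure_ball \<omega>_def powr_realpow)
    obtain b :: 'a where b: "b \<in> Basis" using nonempty_Basis by blast
    have y: "x0 + r *\<^sub>R b \<in> sphere x0 r" using b r(1) by (simp add: dist_norm)
    have L: "max_stretch \<phi> x0 r > 0"
    proof -
      have "x0 \<in> \<Omega>" "x0 + r *\<^sub>R b \<in> \<Omega>" "x0 \<noteq> x0 + r *\<^sub>R b"
        using r y b by (auto simp: subset_iff)
      then have "0 < norm (\<phi> x0 - \<phi> (x0 + r *\<^sub>R b))" using inj by force
      also have "\<dots> \<le> max_stretch \<phi> x0 r"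
        unfolding max_stretch_def
      proof (rule cSUP_upper[OF y])
        have "compact ((\<lambda>y. norm (\<phi> x0 - \<phi> y)) ` sphere x0 r)"
          by (intro compact_continuous_image continuous_intros continuous_on_subset[OF cont]) auto
        then show "bdd_above ((\<lambda>y. norm (\<phi> x0 - \<phi> y)) ` sphere x0 r)"
          by (intro bounded_imp_bdd_above compact_imp_bounded)
      qed
      finally show ?thesis .
    qed
    have a: "(p - q) / q > 0" using assms(8) q0 by simp
    show ?thesis
    proof (cases "set_function p q \<Omega> \<phi> ?A")
      case top
      \<comment> \<open>A finite number divided by \<open>\<infinity>\<close> is \<open>0\<close>, and so is the quotient.\<close>
      then show ?thesis using a by (simp add: dilatation_quotient_def epowr_def)
    next
      case (real F)
      have st: "max_stretch \<phi> x0 r \<le> C * F powr (1 / q - 1 / p) * V powr (1 / p) * r powr (1 - real DIM('a) / q)"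
        unfolding V_def using stretch[OF assms(1,4,8,9,10) r opA' mA'] real by simp
      \<comment> \<open>If the set function vanished on the ball, then so would the maximal stretch, against injectivity.\<close>
      have F: "F > 0"
      proof (rule ccontr)
        assume "\<not> F > 0"
        then have "F = 0" using real by simp
        then show False using st L by simp
      qed
      have "dilatation_quotient p q \<Omega> \<phi> x0 r = ennreal (max_stretch \<phi> x0 r powr p * r powr (real DIM('a) - p) / V
          * (\<omega> * r powr real DIM('a) / F) powr ((p - q) / q))"
        unfolding dilatation_quotient_def eV eB real(2)
        using V F \<omega> by (simp add: divide_ennreal epowr_ennreal ennreal_mult[symmetric])
      also have "\<dots> \<le> ennreal H"
        unfolding H_def
        by (intro ennreal_leI dilatation_quotient_bound[OF q0 assms(8) _ V F r(1) \<omega> _ st]) (use L C in auto)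
      finally show ?thesis .
    qed
  qed
  show ?thesis
  proof (intro exI[of _ "ennreal H"] conjI ballI)
    show "ennreal H < \<infinity>" by simp
    fix x0 assume "x0 \<in> \<Omega>"
    then obtain e where e: "e > 0" "cball x0 e \<subseteq> \<Omega>" using assms(1) open_contains_cball by blast
    have "\<forall>\<^sub>F r in at_right 0. 0 < r \<and> r < e"
      using e(1) by (auto simp: eventually_at_right_field intro!: exI[of _ e])
    then have "\<forall>\<^sub>F r in at_right 0. dilatation_quotient p q \<Omega> \<phi> x0 r \<le> ennreal H"
    proof eventually_elim
      case (elim r)
      then have "cball x0 r \<subseteq> \<Omega>" using e(2) subset_cball[of r e x0] by auto
      then show ?case using bound elim by blast
    qed
    then show "Limsup (at_right 0) (dilatation_quotient p q \<Omega> \<phi> x0) \<le> ennreal H"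
      by (rule Limsup_bounded)
  qed
qed

end
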